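(* Let $(f_1,\mathcal{F}_1):(H,\mathcal{S})\to(H_1,\mathcal{R}_1)$ and $(f_2,\mathcal{F}_2):(H,\mathcal{S})\to(H_2,\mathcal{R}_2)$ be any morphisms (1-cells) in $\mathsf{TwTr}$. Then there is a morphism $$\langle(f_1,\mathcal{F}_1),(f_2,\mathcal{F}_2)\rangle:(H,\mathcal{S})\to(H_1,\mathcal{R}_1)\otimes(H_2,\mathcal{R}_2)$$ in $\mathsf{TwTr}$ (the diagonal morphism) such that $$(\mathrm{Id}\otimes\varepsilon,1\otimes1)\circ\langle(f_1,\mathcal{F}_1),(f_2,\mathcal{F}_2)\rangle=(f_1,\mathcal{F}_1),\qquad(\varepsilon\otimes\mathrm{Id},1\otimes1)\circ\langle(f_1,\mathcal{F}_1),(f_2,\mathcal{F}_2)\rangle=(f_2,\mathcal{F}_2),$$ where $(\mathrm{Id}\otimes\varepsilon,1\otimes1):(H_1,\mathcal{R}_1)\otimes(H_2,\mathcal{R}_2)\to(H_1,\mathcal{R}_1)$ and $(\varepsilon\otimes\mathrm{Id},1\otimes1):(H_1,\mathcal{R}_1)\otimes(H_2,\mathcal{R}_2)\to(H_2,\mathcal{R}_2)$ are 1-cells of $\mathsf{TwTr}$; namely $$\langle(f_1,\mathcal{F}_1),(f_2,\mathcal{F}_2)\rangle:=\Big((f_1\otimes f_2)\Delta_H\,,\ \big(1_{H_1}\otimes(f_2\otimes f_1)(\mathcal{S}^{-1})\otimes1_{H_2}\big)\big((\mathrm{Id}\otimes\tau\otimes\mathrm{Id})(\mathcal{F}_1\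otimes\mathcal{F}_2)\big)\Big).$$
   Context: $\Bbbk$ is an arbitrary field; bialgebras and tensor products are over $\Bbbk$. $\tau$ is the canonical flip, $\varepsilon$ the counit. For $T=T^i\otimes T_i\in H\otimes H$ (summation understood), $T^{\mathrm{op}}=T_i\otimes T^i$. A triangular bialgebra is a pair $(H,\mathcal{R})$ with $H$ a bialgebra and $\mathcal{R}\in H\otimes H$ invertible such that $\Delta^{\mathrm{op}}(\cdot)=\mathcal{R}\Delta(\cdot)\mathcal{R}^{-1}$, $(\mathrm{Id}\otimes\Delta)(\mathcal{R})=\mathcal{R}_{13}\mathcal{R}_{12}$, $(\Delta\otimes\mathrm{Id})(\mathcal{R})=\mathcal{R}_{13}\mathcal{R}_{23}$ (leg notation) and $\mathcal{R}^{-1}=\mathcal{R}^{\mathrm{op}}$. A morphism $f:(H,\mathcal{R})\to(H',\mathcal{R}')$ of triangular bialgebras is a bialgebra map with $(f\otimes f)(\mathcal{R})=\mathcal{R}'$. A twist on $H$ is an invertible $\mathcal{F}\in H\otimes H$ with $(\mathcal{F}\otimes1)(\Delta\otimes\mathrm{Id})(\mathcal{F})=(1\otimes\mathcal{F})(\mathrm{Id}\otimes\Delta)(\mathcal{F})$ and $(\varepsilon\otimes\mathrm{Id})(\mathcal{F})=1=(\mathrm{Id}\otimes\varepsilon)(\mathcal{F})$. Then $H_{\mathcal{F}}$ is the bialgebra with the same algebra and counit and comultiplication $\Delta_{\mathcal{F}}(\cdot)=\mathcal{F}\Delta(\cdot)\mathcal{F}^{-1}$; if $(H,\mathcal{R})$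 is triangular, so is $(H_{\mathcal{F}},\mathcal{R}_{\mathcal{F}})$ with $\mathcal{R}_{\mathcal{F}}:=\mathcal{F}^{\mathrm{op}}\mathcal{R}\mathcal{F}^{-1}$. The objects of the 2-category $\mathsf{TwTr}$ are triangular bialgebras; a 1-cell (twisted morphism of triangular bialgebras) $(f,\mathcal{F}):(H,\mathcal{R})\to(H',\mathcal{R}')$ is a pair with $\mathcal{F}$ a twist on $H'$ and $f:(H,\mathcal{R})\to(H'_{\mathcal{F}},\mathcal{R}'_{\mathcal{F}})$ a morphism of triangular bialgebras. Composition of 1-cells: $(f',\mathcal{F}')\circ(f,\mathcal{F})=(f'f,(f'\otimes f')(\mathcal{F})\mathcal{F}')$. $(H_1,\mathcal{R}_1)\otimes(H_2,\mathcal{R}_2):=(H_1\otimes H_2,\widetilde{\mathcal{R}})$, where $H_1\otimes H_2$ is the tensor product bialgebra (comultiplication $(\mathrm{Id}\otimes\tau\otimes\mathrm{Id})(\Delta_{H_1}\otimes\Delta_{H_2})$) and $\widetilde{\mathcal{R}}=(\mathrm{Id}\otimes\tau\otimes\mathrm{Id})(\mathcal{R}_1\otimes\mathcal{R}_2)$; this is a triangular bialgebra. *)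

theory Defs
  imports "HOL-Algebra.Module" "HOL-Algebra.Generated_Groups" "HOL-Algebra.Free_Abelian_Groups"
begin

section \<open>Tensor products of modules\<close>

text \<open>
  The tensor product of two modules \<open>V\<close> and \<open>W\<close> over \<open>K\<close> is the free abelian group on
  \<open>carrier V \<times> carrier W\<close>, modulo the subgroup generated by the usual bilinearity and balancing
  relations; a tensor is thus a coset of formal integer combinations of pairs.
\<close>

type_synonym ('a, 'b) tensor = "('a \<times> 'b \<Rightarrow>\<^sub>0 int) set"

definition tensor_relators ::
  "('k, 'r) ring_scheme \<Rightarrow> ('k, 'a, 'm) module_scheme \<Rightarrow> ('k, 'b, 'n) module_scheme
    \<Rightarrow> ('a \<times> 'b \<Rightarrow>\<^sub>0 int) set"
  where "tensor_relators K V W =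
      {frag_of (v \<oplus>\<^bsub>V\<^esub> v', w) - frag_of (v, w) - frag_of (v', w) | v v' w.
         v \<in> carrier V \<and> v' \<in> carrier V \<and> w \<in> carrier W}
    \<union> {frag_of (v, w \<oplus>\<^bsub>W\<^esub> w') - frag_of (v, w) - frag_of (v, w') | v w w'.
         v \<in> carrier V \<and> w \<in> carrier W \<and> w' \<in> carrier W}
    \<union> {frag_of (c \<odot>\<^bsub>V\<^esub> v, w) - frag_of (v, c \<odot>\<^bsub>W\<^esub> w) | c v w.
         c \<in> carrier K \<and> v \<in> carrier V \<and> w \<in> carrier W}"

definition tensor_null ::
  "('k, 'r) ring_scheme \<Rightarrow> ('k, 'a, 'm) module_scheme \<Rightarrow> ('k, 'b, 'n) module_scheme
    \<Rightarrow> ('a \<times> 'b \<Rightarrow>\<^sub>0 int) set"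
  where "tensor_null K V W =
    generate (free_Abelian_group (carrier V \<times> carrier W)) (tensor_relators K V W)"

definition tensor_group ::
  "('k, 'r) ring_scheme \<Rightarrow> ('k, 'a, 'm) module_scheme \<Rightarrow> ('k, 'b, 'n) module_scheme
    \<Rightarrow> ('a, 'b) tensor monoid"
  where "tensor_group K V W =
    free_Abelian_group (carrier V \<times> carrier W) Mod tensor_null K V W"

definition tpure ::
  "('k, 'r) ring_scheme \<Rightarrow> ('k, 'a, 'm) module_scheme \<Rightarrow> ('k, 'b, 'n) module_scheme
    \<Rightarrow> 'a \<Rightarrow> 'b \<Rightarrow> ('a, 'b) tensor"
  where "tpure K V W v w =
    tensor_null K V W #>\<^bsub>free_Abelian_group (carrier V \<times> carrier W)\<^esub> frag_of (v, w)"

text \<open>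
  The homomorphism out of the tensor product with prescribed values \<open>\<beta> v w\<close> on pure tensors. It
  exists whenever \<open>\<beta>\<close> is biadditive and balanced, which is the case in all uses below, and it is
  unique on the carrier because the pure tensors generate; if \<open>\<beta>\<close> is bilinear then it is linear.
\<close>

definition balanced_lift ::
  "('k, 'r) ring_scheme \<Rightarrow> ('k, 'a, 'm) module_scheme \<Rightarrow> ('k, 'b, 'n) module_scheme
    \<Rightarrow> ('u, 'x) monoid_scheme \<Rightarrow> ('a \<Rightarrow> 'b \<Rightarrow> 'u) \<Rightarrow> ('a, 'b) tensor \<Rightarrow> 'u"
  where "balanced_lift K V W G \<beta> =
    (SOME h. h \<in> hom (tensor_group K V W) G \<and>
       (\<forall>v\<in>carrier V. \<forall>w\<in>carrier W. h (tpure K V W v w) = \<beta> v w))"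

definition tensor_lift ::
  "('k, 'r) ring_scheme \<Rightarrow> ('k, 'a, 'm) module_scheme \<Rightarrow> ('k, 'b, 'n) module_scheme
    \<Rightarrow> ('u, 'x) ring_scheme \<Rightarrow> ('a \<Rightarrow> 'b \<Rightarrow> 'u) \<Rightarrow> ('a, 'b) tensor \<Rightarrow> 'u"
  where "tensor_lift K V W U \<beta> = balanced_lift K V W (add_monoid U) \<beta>"


section \<open>Algebras and maps between tensor products\<close>

text \<open>The library locale \<open>algebra\<close> requires commutativity, hence the separate notion.\<close>

definition k_algebra :: "('k, 'r) ring_scheme \<Rightarrow> ('k, 'a, 'm) module_scheme \<Rightarrow> bool"
  where "k_algebra K A \<longleftrightarrow> module K A \<and> ring A \<and>
    (\<forall>c\<in>carrier K. \<forall>x\<in>carrier A. \<forall>y\<in>carrier A.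
       (c \<odot>\<^bsub>A\<^esub> x) \<otimes>\<^bsub>A\<^esub> y = c \<odot>\<^bsub>A\<^esub> (x \<otimes>\<^bsub>A\<^esub> y) \<and>
       x \<otimes>\<^bsub>A\<^esub> (c \<odot>\<^bsub>A\<^esub> y) = c \<odot>\<^bsub>A\<^esub> (x \<otimes>\<^bsub>A\<^esub> y))"

definition alg_hom ::
  "('k, 'r) ring_scheme \<Rightarrow> ('k, 'a, 'm) module_scheme \<Rightarrow> ('k, 'b, 'n) module_scheme
    \<Rightarrow> ('a \<Rightarrow> 'b) set"
  where "alg_hom K A B =
    {f \<in> ring_hom A B. \<forall>c\<in>carrier K. \<forall>x\<in>carrier A. f (c \<odot>\<^bsub>A\<^esub> x) = c \<odot>\<^bsub>B\<^esub> f x}"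

definition base_alg :: "('k, 'r) ring_scheme \<Rightarrow> ('k, 'k) module"
  where "base_alg K =
    \<lparr>carrier = carrier K, monoid.mult = (\<otimes>\<^bsub>K\<^esub>), one = \<one>\<^bsub>K\<^esub>,
     ring.zero = \<zero>\<^bsub>K\<^esub>, ring.add = (\<oplus>\<^bsub>K\<^esub>),
     smult = (\<otimes>\<^bsub>K\<^esub>)\<rparr>"

definition tensor_alg ::
  "('k, 'r) ring_scheme \<Rightarrow> ('k, 'a, 'm) module_scheme \<Rightarrow> ('k, 'b, 'n) module_scheme
    \<Rightarrow> ('k, ('a, 'b) tensor) module"
  where "tensor_alg K A B =
    (let T = tensor_group K A B in
     \<lparr>carrier = carrier T,
      monoid.mult = (\<lambda>X Y. balanced_lift K A B T
                (\<lambda>a b. balanced_lift K A B T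
                   (\<lambda>a' b'. tpure K A B (a \<otimes>\<^bsub>A\<^esub> a') (b \<otimes>\<^bsub>B\<^esub> b')) Y) X),
      one = tpure K A B \<one>\<^bsub>A\<^esub> \<one>\<^bsub>B\<^esub>,
      ring.zero = \<one>\<^bsub>T\<^esub>,
      ring.add = (\<otimes>\<^bsub>T\<^esub>),
      smult = (\<lambda>c. balanced_lift K A B T (\<lambda>a b. tpure K A B (c \<odot>\<^bsub>A\<^esub> a) b))\<rparr>)"

text \<open>The map \<open>f \<otimes> g\<close> from \<open>A \<otimes> B\<close> to \<open>A' \<otimes> B'\<close>.\<close>

definition tensor_map ::
  "('k, 'r) ring_scheme \<Rightarrow> ('k, 'a, 'm) module_scheme \<Rightarrow> ('k, 'b, 'n) module_scheme
    \<Rightarrow> ('k, 'c, 'p) module_scheme \<Rightarrow> ('k, 'd, 'q) module_scheme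
    \<Rightarrow> ('a \<Rightarrow> 'c) \<Rightarrow> ('b \<Rightarrow> 'd) \<Rightarrow> ('a, 'b) tensor \<Rightarrow> ('c, 'd) tensor"
  where "tensor_map K A B A' B' f g =
    tensor_lift K A B (tensor_alg K A' B') (\<lambda>a b. tpure K A' B' (f a) (g b))"

definition flip ::
  "('k, 'r) ring_scheme \<Rightarrow> ('k, 'a, 'm) module_scheme \<Rightarrow> ('k, 'b, 'n) module_scheme
    \<Rightarrow> ('a, 'b) tensor \<Rightarrow> ('b, 'a) tensor"
  where "flip K A B = tensor_lift K A B (tensor_alg K B A) (\<lambda>a b. tpure K B A b a)"

text \<open>The canonical isomorphism from \<open>(A \<otimes> B) \<otimes> C\<close> to \<open>A \<otimes> (B \<otimes> C)\<close>.\<close>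

definition tensor_assoc ::
  "('k, 'r) ring_scheme \<Rightarrow> ('k, 'a, 'm) module_scheme \<Rightarrow> ('k, 'b, 'n) module_scheme
    \<Rightarrow> ('k, 'c, 'p) module_scheme \<Rightarrow> (('a, 'b) tensor, 'c) tensor \<Rightarrow> ('a, ('b, 'c) tensor) tensor"
  where "tensor_assoc K A B C =
    (let T = tensor_alg K A (tensor_alg K B C) in
     tensor_lift K (tensor_alg K A B) C T
       (\<lambda>X c. tensor_lift K A B T
          (\<lambda>a b. tpure K A (tensor_alg K B C) a (tpure K B C b c)) X))"

text \<open>
  The map \<open>Id \<otimes> \<tau> \<otimes> Id\<close>, bracketed as a map from \<open>(A \<otimes> B) \<otimes> (C \<otimes> D)\<close> to
  \<open>(A \<otimes> C) \<otimes> (B \<otimes> D)\<close>.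
\<close>

definition middle_flip ::
  "('k, 'r) ring_scheme \<Rightarrow> ('k, 'a, 'm) module_scheme \<Rightarrow> ('k, 'b, 'n) module_scheme
    \<Rightarrow> ('k, 'c, 'p) module_scheme \<Rightarrow> ('k, 'd, 'q) module_scheme
    \<Rightarrow> (('a, 'b) tensor, ('c, 'd) tensor) tensor \<Rightarrow> (('a, 'c) tensor, ('b, 'd) tensor) tensor"
  where "middle_flip K A B C D =
    (let AC = tensor_alg K A C; BD = tensor_alg K B D; T = tensor_alg K AC BD in
     tensor_lift K (tensor_alg K A B) (tensor_alg K C D) T
       (\<lambda>X Y. tensor_lift K A B T
          (\<lambda>a b. tensor_lift K C D T
             (\<lambda>c d. tpure K AC BD (tpure K A C a c) (tpure K B D b d)) Y) X))"

text \<open>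
  \<open>e \<otimes> Id\<close> and \<open>Id \<otimes> e\<close> for a linear form \<open>e\<close>, with \<open>K \<otimes> B\<close> identified with \<open>B\<close> and
  \<open>A \<otimes> K\<close> with \<open>A\<close>.
\<close>

definition form_left ::
  "('k, 'r) ring_scheme \<Rightarrow> ('k, 'a, 'm) module_scheme \<Rightarrow> ('k, 'b, 'n) module_scheme
    \<Rightarrow> ('a \<Rightarrow> 'k) \<Rightarrow> ('a, 'b) tensor \<Rightarrow> 'b"
  where "form_left K A B e = tensor_lift K A B B (\<lambda>a b. e a \<odot>\<^bsub>B\<^esub> b)"

definition form_right ::
  "('k, 'r) ring_scheme \<Rightarrow> ('k, 'a, 'm) module_scheme \<Rightarrow> ('k, 'b, 'n) module_scheme
    \<Rightarrow> ('b \<Rightarrow> 'k) \<Rightarrow> ('a, 'b) tensor \<Rightarrow> 'a"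
  where "form_right K A B e = tensor_lift K A B A (\<lambda>a b. e b \<odot>\<^bsub>A\<^esub> a)"


section \<open>Bialgebras\<close>

record ('k, 'a) bialg = "('k, 'a) module" +
  comult :: "'a \<Rightarrow> ('a, 'a) tensor"
  counit :: "'a \<Rightarrow> 'k"

abbreviation tsquare ::
  "('k, 'r) ring_scheme \<Rightarrow> ('k, 'a, 'm) module_scheme \<Rightarrow> ('k, ('a, 'a) tensor) module"
  where "tsquare K A \<equiv> tensor_alg K A A"

abbreviation tcube ::
  "('k, 'r) ring_scheme \<Rightarrow> ('k, 'a, 'm) module_scheme
    \<Rightarrow> ('k, ('a, ('a, 'a) tensor) tensor) module"
  where "tcube K A \<equiv> tensor_alg K A (tsquare K A)"

text \<open>
  \<open>\<Delta> \<otimes> Id\<close> and \<open>Id \<otimes> \<Delta>\<close>; they take values in \<open>(H \<otimes> H) \<otimes> H\<close> and \<open>H \<otimes> (H \<otimes> H)\<close>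
  respectively, so that \<^const>\<open>tensor_assoc\<close> is needed to compare them.
\<close>

definition comult_left ::
  "('k, 'r) ring_scheme \<Rightarrow> ('k, 'a, 'm) bialg_scheme
    \<Rightarrow> ('a, 'a) tensor \<Rightarrow> (('a, 'a) tensor, 'a) tensor"
  where "comult_left K H = tensor_map K H H (tsquare K H) H (comult H) (\<lambda>x. x)"

definition comult_right ::
  "('k, 'r) ring_scheme \<Rightarrow> ('k, 'a, 'm) bialg_scheme
    \<Rightarrow> ('a, 'a) tensor \<Rightarrow> ('a, ('a, 'a) tensor) tensor"
  where "comult_right K H = tensor_map K H H H (tsquare K H) (\<lambda>x. x) (comult H)"

definition bialgebra :: "('k, 'r) ring_scheme \<Rightarrow> ('k, 'a, 'm) bialg_scheme \<Rightarrow> bool"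
  where "bialgebra K H \<longleftrightarrow>
    k_algebra K H \<and>
    comult H \<in> alg_hom K H (tsquare K H) \<and>
    counit H \<in> alg_hom K H (base_alg K) \<and>
    (\<forall>x\<in>carrier H.
       tensor_assoc K H H H (comult_left K H (comult H x)) = comult_right K H (comult H x) \<and>
       form_left K H H (counit H) (comult H x) = x \<and>
       form_right K H H (counit H) (comult H x) = x)"

definition bialg_hom ::
  "('k, 'r) ring_scheme \<Rightarrow> ('k, 'a, 'm) bialg_scheme \<Rightarrow> ('k, 'b, 'n) bialg_scheme \<Rightarrow> ('a \<Rightarrow> 'b) set"
  where "bialg_hom K H H' =
    {f \<in> alg_hom K H H'. \<forall>x\<in>carrier H.
       comult H' (f x) = tensor_map K H H H' H' f f (comult H x) \<and>
       counit H' (f x) = counit H x}"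

definition tensor_bialg ::
  "('k, 'r) ring_scheme \<Rightarrow> ('k, 'a, 'm) bialg_scheme \<Rightarrow> ('k, 'b, 'n) bialg_scheme
    \<Rightarrow> ('k, ('a, 'b) tensor) bialg"
  where "tensor_bialg K A B = module.extend (tensor_alg K A B)
    (bialg.fields
       (\<lambda>X. middle_flip K A A B B
          (tensor_map K A B (tsquare K A) (tsquare K B) (comult A) (comult B) X))
       (tensor_lift K A B K (\<lambda>a b. counit A a \<otimes>\<^bsub>K\<^esub> counit B b)))"


section \<open>Triangular bialgebras and twists\<close>

definition leg12 ::
  "('k, 'r) ring_scheme \<Rightarrow> ('k, 'a, 'm) module_scheme
    \<Rightarrow> ('a, 'a) tensor \<Rightarrow> ('a, ('a, 'a) tensor) tensor"
  where "leg12 K H = tensor_lift K H H (tcube K H)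
    (\<lambda>x y. tpure K H (tsquare K H) x (tpure K H H y \<one>\<^bsub>H\<^esub>))"

definition leg13 ::
  "('k, 'r) ring_scheme \<Rightarrow> ('k, 'a, 'm) module_scheme
    \<Rightarrow> ('a, 'a) tensor \<Rightarrow> ('a, ('a, 'a) tensor) tensor"
  where "leg13 K H = tensor_lift K H H (tcube K H)
    (\<lambda>x y. tpure K H (tsquare K H) x (tpure K H H \<one>\<^bsub>H\<^esub> y))"

definition leg23 ::
  "('k, 'r) ring_scheme \<Rightarrow> ('k, 'a, 'm) module_scheme
    \<Rightarrow> ('a, 'a) tensor \<Rightarrow> ('a, ('a, 'a) tensor) tensor"
  where "leg23 K H X = tpure K H (tsquare K H) \<one>\<^bsub>H\<^esub> X"

type_synonym ('k, 'a) bialg_pair = "('k, 'a) bialg \<times> ('a, 'a) tensor"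

fun triangular :: "('k, 'r) ring_scheme \<Rightarrow> ('k, 'a) bialg_pair \<Rightarrow> bool"
  where "triangular K (H, R) \<longleftrightarrow>
    bialgebra K H \<and>
    R \<in> Units (tsquare K H) \<and>
    (\<forall>x\<in>carrier H. flip K H H (comult H x) =
       R \<otimes>\<^bsub>tsquare K H\<^esub> comult H x \<otimes>\<^bsub>tsquare K H\<^esub> inv\<^bsub>tsquare K H\<^esub> R) \<and>
    comult_right K H R = leg13 K H R \<otimes>\<^bsub>tcube K H\<^esub> leg12 K H R \<and>
    tensor_assoc K H H H (comult_left K H R) = leg13 K H R \<otimes>\<^bsub>tcube K H\<^esub> leg23 K H R \<and>
    inv\<^bsub>tsquare K H\<^esub> R = flip K H H R"

fun triangular_hom ::
  "('k, 'r) ring_scheme \<Rightarrow> ('k, 'a) bialg_pair \<Rightarrow> ('k, 'b) bialg_pair \<Rightarrow> ('a \<Rightarrow> 'b) set"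
  where "triangular_hom K (H, R) (H', R') =
    {f \<in> bialg_hom K H H'. tensor_map K H H H' H' f f R = R'}"

definition twist :: "('k, 'r) ring_scheme \<Rightarrow> ('k, 'a) bialg \<Rightarrow> ('a, 'a) tensor \<Rightarrow> bool"
  where "twist K H F \<longleftrightarrow>
    F \<in> Units (tsquare K H) \<and>
    tensor_assoc K H H H
      (tpure K (tsquare K H) H F \<one>\<^bsub>H\<^esub> \<otimes>\<^bsub>tensor_alg K (tsquare K H) H\<^esub> comult_left K H F) =
    tpure K H (tsquare K H) \<one>\<^bsub>H\<^esub> F \<otimes>\<^bsub>tcube K H\<^esub> comult_right K H F \<and>
    form_left K H H (counit H) F = \<one>\<^bsub>H\<^esub> \<and>
    form_right K H H (counit H) F = \<one>\<^bsub>H\<^esub>"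

fun twisted ::
  "('k, 'r) ring_scheme \<Rightarrow> ('k, 'a) bialg_pair \<Rightarrow> ('a, 'a) tensor \<Rightarrow> ('k, 'a) bialg_pair"
  where "twisted K (H, R) F =
    (H\<lparr>comult := \<lambda>x. F \<otimes>\<^bsub>tsquare K H\<^esub> comult H x \<otimes>\<^bsub>tsquare K H\<^esub> inv\<^bsub>tsquare K H\<^esub> F\<rparr>,
     flip K H H F \<otimes>\<^bsub>tsquare K H\<^esub> R \<otimes>\<^bsub>tsquare K H\<^esub> inv\<^bsub>tsquare K H\<^esub> F)"

fun tensor_pair ::
  "('k, 'r) ring_scheme \<Rightarrow> ('k, 'a) bialg_pair \<Rightarrow> ('k, 'b) bialg_pair
    \<Rightarrow> ('k, ('a, 'b) tensor) bialg_pair"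
  where "tensor_pair K (H1, R1) (H2, R2) =
    (tensor_bialg K H1 H2,
     middle_flip K H1 H1 H2 H2 (tpure K (tsquare K H1) (tsquare K H2) R1 R2))"


section \<open>The 1-cells of TwTr\<close>

type_synonym ('a, 'b) twcell = "('a \<Rightarrow> 'b) \<times> ('b, 'b) tensor"

fun tw_cell ::
  "('k, 'r) ring_scheme \<Rightarrow> ('k, 'a) bialg_pair \<Rightarrow> ('k, 'b) bialg_pair \<Rightarrow> ('a, 'b) twcell \<Rightarrow> bool"
  where "tw_cell K X (H', R') (f, F) \<longleftrightarrow>
    triangular K X \<and> triangular K (H', R') \<and> twist K H' F \<and>
    f \<in> triangular_hom K X (twisted K (H', R') F)"

text \<open>Composition of a 1-cell into \<open>Y\<close>, given last, with a 1-cell from \<open>Y\<close> to \<open>Z\<close>.\<close>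

fun tw_comp ::
  "('k, 'r) ring_scheme \<Rightarrow> ('k, 'b) bialg_pair \<Rightarrow> ('k, 'c) bialg_pair
    \<Rightarrow> ('b, 'c) twcell \<Rightarrow> ('a, 'b) twcell \<Rightarrow> ('a, 'c) twcell"
  where "tw_comp K (H', R') (H'', R'') (f', F') (f, F) =
    (f' \<circ> f, tensor_map K H' H' H'' H'' f' f' F \<otimes>\<^bsub>tsquare K H''\<^esub> F')"

text \<open>
  Equality of 1-cells out of \<open>(H, R)\<close>: HOL functions are total, so the underlying maps have to be
  compared on the carrier of \<open>H\<close> only.
\<close>

fun tw_eq :: "('k, 'a) bialg_pair \<Rightarrow> ('a, 'b) twcell \<Rightarrow> ('a, 'b) twcell \<Rightarrow> bool"
  where "tw_eq (H, R) (f, F) (g, G) \<longleftrightarrow> (\<forall>x\<in>carrier H. f x = g x) \<and> F = G"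

fun tw_proj1 ::
  "('k, 'r) ring_scheme \<Rightarrow> ('k, 'a) bialg_pair \<Rightarrow> ('k, 'b) bialg_pair
    \<Rightarrow> (('a, 'b) tensor, 'a) twcell"
  where "tw_proj1 K (H1, R1) (H2, R2) =
    (form_right K H1 H2 (counit H2), tpure K H1 H1 \<one>\<^bsub>H1\<^esub> \<one>\<^bsub>H1\<^esub>)"

fun tw_proj2 ::
  "('k, 'r) ring_scheme \<Rightarrow> ('k, 'a) bialg_pair \<Rightarrow> ('k, 'b) bialg_pair
    \<Rightarrow> (('a, 'b) tensor, 'b) twcell"
  where "tw_proj2 K (H1, R1) (H2, R2) =
    (form_left K H1 H2 (counit H1), tpure K H2 H2 \<one>\<^bsub>H2\<^esub> \<one>\<^bsub>H2\<^esub>)"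

text \<open>
  The map \<open>X \<mapsto> 1 \<otimes> X \<otimes> 1\<close>, bracketed as a map from \<open>B \<otimes> A\<close> to
  \<open>(A \<otimes> B) \<otimes> (A \<otimes> B)\<close>.
\<close>

definition insert_middle ::
  "('k, 'r) ring_scheme \<Rightarrow> ('k, 'a, 'm) module_scheme \<Rightarrow> ('k, 'b, 'n) module_scheme
    \<Rightarrow> ('b, 'a) tensor \<Rightarrow> (('a, 'b) tensor, ('a, 'b) tensor) tensor"
  where "insert_middle K A B =
    tensor_lift K B A (tsquare K (tensor_alg K A B))
      (\<lambda>b a. tpure K (tensor_alg K A B) (tensor_alg K A B)
                (tpure K A B \<one>\<^bsub>A\<^esub> b) (tpure K A B a \<one>\<^bsub>B\<^esub>))"

fun tw_diagonal ::
  "('k, 'r) ring_scheme \<Rightarrow> ('k, 'h) bialg_pair \<Rightarrow> ('k, 'a) bialg_pair \<Rightarrow> ('k, 'b) bialg_pair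
    \<Rightarrow> ('h, 'a) twcell \<Rightarrow> ('h, 'b) twcell \<Rightarrow> ('h, ('a, 'b) tensor) twcell"
  where "tw_diagonal K (H, S) (H1, R1) (H2, R2) (f1, F1) (f2, F2) =
    (\<lambda>x. tensor_map K H H H1 H2 f1 f2 (comult H x),
     insert_middle K H1 H2 (tensor_map K H H H2 H1 f2 f1 (inv\<^bsub>tsquare K H\<^esub> S))
       \<otimes>\<^bsub>tsquare K (tensor_alg K H1 H2)\<^esub>
     middle_flip K H1 H1 H2 H2 (tpure K (tsquare K H1) (tsquare K H2) F1 F2))"

end

theory Submission
  imports Defs
begin

text \<open>
  The diagonal morphism is the composite of two simpler 1-cells. The first is the comultiplication
  \<open>(\<Delta>, 1 \<otimes> S\<^sup>-\<^sup>1 \<otimes> 1)\<close> from \<open>(H, S)\<close> to \<open>(H, S) \<otimes> (H, S)\<close> (lemma \<open>tw_cell_comult\<close>), the second is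
  the tensor product \<open>(f\<^sub>1 \<otimes> f\<^sub>2, (F\<^sub>1)\<^sub>1\<^sub>3 (F\<^sub>2)\<^sub>2\<^sub>4)\<close> of the two given 1-cells (lemma
  \<open>tw_cell_tensor\<close>). Hence it is a 1-cell because 1-cells compose (lemma \<open>tw_cell_comp\<close>).

  That \<open>\<Delta>\<close> is a 1-cell comes from the axioms of the \<open>R\<close>-matrix \<open>S\<close>. Write \<open>Q\<close> for the inverse of \<open>S\<close>,
  which is its flip, and number the legs of \<open>H \<otimes> H \<otimes> H \<otimes> H\<close> and of the sixfold tensor power of \<open>H\<close>.
  The hexagon identities give \<open>Q\<^sub>2\<^sub>3 Q\<^sub>4\<^sub>5 Q\<^sub>2\<^sub>5\<close> for one side of the cocycle identity of \<open>Q\<^sub>2\<^sub>3\<close>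
  and \<open>Q\<^sub>4\<^sub>5 Q\<^sub>2\<^sub>3 Q\<^sub>2\<^sub>5\<close> for the other, and disjoint legs commute. The relation
  \<open>Q \<Delta>\<^sup>o\<^sup>p = \<Delta> Q\<close>, applied to the middle factor of the fourfold coproduct, gives the
  compatibility with the comultiplications. Finally \<open>(\<Delta> \<otimes> \<Delta>)(S) = S\<^sub>1\<^sub>4 S\<^sub>1\<^sub>3 S\<^sub>2\<^sub>4 S\<^sub>2\<^sub>3\<close>, whence
  \<open>(\<Delta> \<otimes> \<Delta>)(S) Q\<^sub>2\<^sub>3 = S\<^sub>1\<^sub>4 (S\<^sub>1\<^sub>3 S\<^sub>2\<^sub>4)\<close>, and \<open>S\<^sub>1\<^sub>4\<close> is the flip of \<open>Q\<^sub>2\<^sub>3\<close>.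

  Everything about a tensor product \<open>A \<otimes> B\<close> of bialgebras is deduced from the two inclusions of \<open>A\<close> and
  \<open>B\<close>: they are bialgebra maps with commuting images that generate \<open>A \<otimes> B\<close>. If \<open>i\<close> and \<open>j\<close> are
  bialgebra maps into \<open>M\<close> with commuting images, then \<open>(X, Y) \<mapsto> (i \<otimes> i)(X) (j \<otimes> j)(Y)\<close> is
  multiplicative and compatible with flips, legs and comultiplications, so it carries twists to
  twists and the axioms of \<open>R\<close>-matrices to themselves. Identities between algebra homomorphisms on
  \<open>A \<otimes> B\<close> are checked on the two inclusions.

  In the composite with a projection, the twist of the other factor and the inserted \<open>Q\<close> become trivial
  because the counit sends one leg of a twist, and likewise of an \<open>R\<close>-matrix (lemma
  \<open>triangular_form_left\<close>), to \<open>1\<close>.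
\<close>

section \<open>Tensor products of modules\<close>

text \<open>
  The biadditive maps that identify \<open>(c v, w)\<close> with \<open>(v, c w)\<close>; the target is a group written
  multiplicatively.
\<close>

definition balanced ::
  "('k, 'r) ring_scheme \<Rightarrow> ('k, 'a, 'm) module_scheme \<Rightarrow> ('k, 'b, 'n) module_scheme
    \<Rightarrow> ('u, 'x) monoid_scheme \<Rightarrow> ('a \<Rightarrow> 'b \<Rightarrow> 'u) \<Rightarrow> bool"
  where "balanced K V W G \<beta> \<longleftrightarrow>
    (\<forall>v\<in>carrier V. \<forall>w\<in>carrier W. \<beta> v w \<in> carrier G) \<and>
    (\<forall>v\<in>carrier V. \<forall>v'\<in>carrier V. \<forall>w\<in>carrier W.
       \<beta> (v \<oplus>\<^bsub>V\<^esub> v') w = \<beta> v w \<otimes>\<^bsub>G\<^esub> \<beta> v' w) \<and>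
    (\<forall>v\<in>carrier V. \<forall>w\<in>carrier W. \<forall>w'\<in>carrier W.
       \<beta> v (w \<oplus>\<^bsub>W\<^esub> w') = \<beta> v w \<otimes>\<^bsub>G\<^esub> \<beta> v w') \<and>
    (\<forall>c\<in>carrier K. \<forall>v\<in>carrier V. \<forall>w\<in>carrier W.
       \<beta> (c \<odot>\<^bsub>V\<^esub> v) w = \<beta> v (c \<odot>\<^bsub>W\<^esub> w))"

lemma balancedI:
  assumes "\<And>v w. v \<in> carrier V \<Longrightarrow> w \<in> carrier W \<Longrightarrow> \<beta> v w \<in> carrier G"
    and "\<And>v v' w. v \<in> carrier V \<Longrightarrow> v' \<in> carrier V \<Longrightarrow> w \<in> carrier W \<Longrightarrow>
       \<beta> (v \<oplus>\<^bsub>V\<^esub> v') w = \<beta> v w \<otimes>\<^bsub>G\<^esub> \<beta> v' w"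
    and "\<And>v w w'. v \<in> carrier V \<Longrightarrow> w \<in> carrier W \<Longrightarrow> w' \<in> carrier W \<Longrightarrow>
       \<beta> v (w \<oplus>\<^bsub>W\<^esub> w') = \<beta> v w \<otimes>\<^bsub>G\<^esub> \<beta> v w'"
    and "\<And>c v w. c \<in> carrier K \<Longrightarrow> v \<in> carrier V \<Longrightarrow> w \<in> carrier W \<Longrightarrow>
       \<beta> (c \<odot>\<^bsub>V\<^esub> v) w = \<beta> v (c \<odot>\<^bsub>W\<^esub> w)"
  shows "balanced K V W G \<beta>"
  using assms unfolding balanced_def by blast

lemma tensor_relators_subset:
  assumes V: "module K V" and W: "module K W"
  shows "tensor_relators K V W \<subseteq> carrier (free_Abelian_group (carrier V \<times> carrier W))"
proof -
  interpret V: module K V by fact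
  interpret W: module K W by fact
  show ?thesis
    unfolding tensor_relators_def by (auto dest!: subsetD[OF keys_diff])
qed

lemma tensor_null_normal:
  assumes V: "module K V" and W: "module K W"
  shows "tensor_null K V W \<lhd> free_Abelian_group (carrier V \<times> carrier W)"
  unfolding tensor_null_def
  by (intro comm_group.subgroup_imp_normal abelian_free_Abelian_group
      group.generate_is_subgroup group_free_Abelian_group tensor_relators_subset assms)

lemma tensor_group_comm_group:
  assumes V: "module K V" and W: "module K W"
  shows "comm_group (tensor_group K V W)"
  unfolding tensor_group_def
  by (intro comm_group.abelian_FactGroup abelian_free_Abelian_group normal_imp_subgroup
      tensor_null_normal assms)

lemma tpure_closed_group:
  "v \<in> carrier V \<Longrightarrow> w \<in> carrier W \<Longrightarrow> tpure K V W v w \<in> carrier (tensor_group K V W)"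
  unfolding tpure_def tensor_group_def carrier_FactGroup by simp

lemma coset_frag_hom:
  assumes V: "module K V" and W: "module K W"
  shows "(\<lambda>x. tensor_null K V W #>\<^bsub>free_Abelian_group (carrier V \<times> carrier W)\<^esub> x)
    \<in> hom (free_Abelian_group (carrier V \<times> carrier W)) (tensor_group K V W)"
  unfolding tensor_group_def
  by (rule normal.r_coset_hom_Mod[OF tensor_null_normal[OF assms]])

lemma coset_diff_null:
  assumes V: "module K V" and W: "module K W"
    and x: "x \<in> carrier (free_Abelian_group (carrier V \<times> carrier W))"
    and y: "y \<in> carrier (free_Abelian_group (carrier V \<times> carrier W))"
    and d: "x - y \<in> tensor_null K V W"
  shows "tensor_null K V W #>\<^bsub>free_Abelian_group (carrier V \<times> carrier W)\<^esub> x =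
    tensor_null K V W #>\<^bsub>free_Abelian_group (carrier V \<times> carrier W)\<^esub> y"
proof -
  let ?F = "free_Abelian_group (carrier V \<times> carrier W)"
  interpret F: group ?F by simp
  interpret N: normal "tensor_null K V W" ?F by (rule tensor_null_normal[OF V W])
  have "x \<in> tensor_null K V W #>\<^bsub>?F\<^esub> y"
    unfolding r_coset_def using d by (force intro: bexI[of _ "x - y"])
  then show ?thesis
    using F.repr_independence[OF _ _ N.is_subgroup] y by auto
qed

lemma relator_null: "r \<in> tensor_relators K V W \<Longrightarrow> r \<in> tensor_null K V W"
  unfolding tensor_null_def by (rule generate.incl)

lemma tpure_group_rules:
  assumes V: "module K V" and W: "module K W"
  shows tpure_group_add_left: "v \<in> carrier V \<Longrightarrow> v' \<in> carrier V \<Longrightarrow> w \<in> carrier W \<Longrightarrow>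
      tpure K V W (v \<oplus>\<^bsub>V\<^esub> v') w = tpure K V W v w \<otimes>\<^bsub>tensor_group K V W\<^esub> tpure K V W v' w"
    and tpure_group_add_right: "v \<in> carrier V \<Longrightarrow> w \<in> carrier W \<Longrightarrow> w' \<in> carrier W \<Longrightarrow>
      tpure K V W v (w \<oplus>\<^bsub>W\<^esub> w') = tpure K V W v w \<otimes>\<^bsub>tensor_group K V W\<^esub> tpure K V W v w'"
    and tpure_group_balanced: "c \<in> carrier K \<Longrightarrow> v \<in> carrier V \<Longrightarrow> w \<in> carrier W \<Longrightarrow>
      tpure K V W (c \<odot>\<^bsub>V\<^esub> v) w = tpure K V W v (c \<odot>\<^bsub>W\<^esub> w)"
proof -
  let ?F = "free_Abelian_group (carrier V \<times> carrier W)"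
  interpret V: module K V by fact
  interpret W: module K W by fact
  interpret F: group ?F by simp
  note hm = hom_mult[OF coset_frag_hom[OF V W], symmetric]
  have add: "Poly_Mapping.keys (frag_of a + frag_of b) \<subseteq> carrier V \<times> carrier W"
    if "a \<in> carrier V \<times> carrier W" "b \<in> carrier V \<times> carrier W" for a b
    using keys_add[of "frag_of a" "frag_of b"] that by auto
  { assume "v \<in> carrier V" "v' \<in> carrier V" "w \<in> carrier W"
    then show "tpure K V W (v \<oplus>\<^bsub>V\<^esub> v') w = tpure K V W v w \<otimes>\<^bsub>tensor_group K V W\<^esub> tpure K V W v' w"
      unfolding tpure_def
      by (subst hm)
        (simp_all, intro coset_diff_null[OF V W] relator_null,
          auto simp: add tensor_relators_def simp flip: diff_diff_eq) }
  { assume "v \<in> carrier V" "w \<in> carrier W" "w' \<in> carrier W"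
    then show "tpure K V W v (w \<oplus>\<^bsub>W\<^esub> w') = tpure K V W v w \<otimes>\<^bsub>tensor_group K V W\<^esub> tpure K V W v w'"
      unfolding tpure_def
      by (subst hm)
        (simp_all, intro coset_diff_null[OF V W] relator_null,
          auto simp: add tensor_relators_def simp flip: diff_diff_eq) }
  { assume "c \<in> carrier K" "v \<in> carrier V" "w \<in> carrier W"
    then show "tpure K V W (c \<odot>\<^bsub>V\<^esub> v) w = tpure K V W v (c \<odot>\<^bsub>W\<^esub> w)"
      unfolding tpure_def
      by (intro coset_diff_null[OF V W] relator_null) (auto simp: tensor_relators_def) }
qed

text \<open>
  Sums of pure tensors exhaust the tensor product: no subtraction is needed, since the inverse of
  \<open>v \<otimes> w\<close> is \<open>(- v) \<otimes> w\<close>.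
\<close>

lemma tensor_group_induct:
  assumes V: "module K V" and W: "module K W" and X: "X \<in> carrier (tensor_group K V W)"
    and pure: "\<And>v w. v \<in> carrier V \<Longrightarrow> w \<in> carrier W \<Longrightarrow> P (tpure K V W v w)"
    and add: "\<And>X Y. X \<in> carrier (tensor_group K V W) \<Longrightarrow> Y \<in> carrier (tensor_group K V W) \<Longrightarrow>
      P X \<Longrightarrow> P Y \<Longrightarrow> P (X \<otimes>\<^bsub>tensor_group K V W\<^esub> Y)"
  shows "P X"
proof -
  let ?F = "free_Abelian_group (carrier V \<times> carrier W)"
  let ?T = "tensor_group K V W"
  let ?q = "\<lambda>x. tensor_null K V W #>\<^bsub>?F\<^esub> x"
  interpret V: module K V by fact
  interpret W: module K W by fact
  interpret T: comm_group ?T by (rule tensor_group_comm_group[OF V W])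
  interpret F: comm_group ?F by (rule abelian_free_Abelian_group)
  interpret q: group_hom ?F ?T ?q
    by unfold_locales (rule coset_frag_hom[OF V W])
  have neg: "inv\<^bsub>?T\<^esub> tpure K V W v w = tpure K V W (\<ominus>\<^bsub>V\<^esub> v) w"
    if v: "v \<in> carrier V" and w: "w \<in> carrier W" for v w
  proof -
    have z: "tpure K V W \<zero>\<^bsub>V\<^esub> w = \<one>\<^bsub>?T\<^esub>"
      using tpure_group_add_left[OF V W, of "\<zero>\<^bsub>V\<^esub>" "\<zero>\<^bsub>V\<^esub>" w] w
      by (simp add: tpure_closed_group)
    show ?thesis
      using tpure_group_add_left[OF V W, of "\<ominus>\<^bsub>V\<^esub> v" v w] v w z
      by (simp add: V.l_neg T.inv_equality tpure_closed_group)
  qed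
  \<comment> \<open>The property is carried along together with its validity at the inverse, because
    the free abelian group is generated under differences.\<close>
  define Q where "Q c \<longleftrightarrow> P (?q c) \<and> P (inv\<^bsub>?T\<^esub> ?q c)" for c
  obtain c where c: "Poly_Mapping.keys c \<subseteq> carrier V \<times> carrier W" "X = ?q c"
    using X unfolding tensor_group_def carrier_FactGroup by auto
  have "Q c"
    using c(1)
  proof (rule free_Abelian_group_induct)
    show "Q 0"
    proof -
      have "?q 0 = tpure K V W \<zero>\<^bsub>V\<^esub> \<zero>\<^bsub>W\<^esub>"
        using tpure_group_add_left[OF V W, of "\<zero>\<^bsub>V\<^esub>" "\<zero>\<^bsub>V\<^esub>" "\<zero>\<^bsub>W\<^esub>"] q.hom_one
        by (simp add: tpure_closed_group)
      then show ?thesis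
        unfolding Q_def using pure[of "\<zero>\<^bsub>V\<^esub>" "\<zero>\<^bsub>W\<^esub>"] q.hom_one by simp
    qed
  next
    fix x y
    assume xy: "Poly_Mapping.keys x \<subseteq> carrier V \<times> carrier W"
      "Poly_Mapping.keys y \<subseteq> carrier V \<times> carrier W" "Q x" "Q y"
    have d: "?q (x - y) = ?q x \<otimes>\<^bsub>?T\<^esub> inv\<^bsub>?T\<^esub> ?q y"
      using q.hom_mult[of x "inv\<^bsub>?F\<^esub> y"] q.hom_inv[of y] xy
      by simp
    have d': "inv\<^bsub>?T\<^esub> ?q (x - y) = inv\<^bsub>?T\<^esub> ?q x \<otimes>\<^bsub>?T\<^esub> ?q y"
      unfolding d using xy q.hom_closed[of x] q.hom_closed[of y]
      by (simp add: T.inv_mult)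
    show "Q (x - y)"
      unfolding Q_def unfolding d' unfolding d
      using xy q.hom_closed[of x] q.hom_closed[of y] by (auto simp: Q_def intro!: add)
  next
    fix a assume "a \<in> carrier V \<times> carrier W"
    then obtain v w where a: "a = (v, w)" "v \<in> carrier V" "w \<in> carrier W" by blast
    show "Q (frag_of a)"
      using neg[OF a(2,3)] pure[OF a(2,3)] pure[of "\<ominus>\<^bsub>V\<^esub> v" w] a
      unfolding Q_def a tpure_def by simp
  qed
  then show ?thesis
    unfolding Q_def c(2) by simp
qed

text \<open>
  The universal property: the homomorphism on the free abelian group with values \<open>\<beta> v w\<close> kills the
  relators, hence factors through the quotient.
\<close>

lemma balanced_lift:
  assumes V: "module K V" and W: "module K W" and G: "comm_group G"
    and \<beta>: "balanced K V W G \<beta>"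
  shows balanced_lift_hom: "balanced_lift K V W G \<beta> \<in> hom (tensor_group K V W) G"
    and balanced_lift_pure: "v \<in> carrier V \<Longrightarrow> w \<in> carrier W \<Longrightarrow>
      balanced_lift K V W G \<beta> (tpure K V W v w) = \<beta> v w"
proof -
  let ?F = "free_Abelian_group (carrier V \<times> carrier W)"
  interpret V: module K V by fact
  interpret W: module K W by fact
  interpret G: comm_group G by fact
  interpret F: comm_group ?F by (rule abelian_free_Abelian_group)
  have "(\<lambda>(v, w). \<beta> v w) ` (carrier V \<times> carrier W) \<subseteq> carrier G"
    using \<beta> unfolding balanced_def by auto
  then obtain h0 where h0: "h0 \<in> hom ?F G"
    "\<And>x. x \<in> carrier V \<times> carrier W \<Longrightarrow> h0 (frag_of x) = (\<lambda>(v, w). \<beta> v w) x"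
    by (rule G.free_Abelian_group_universal) blast
  interpret h: group_hom ?F G h0
    by unfold_locales (rule h0(1))
  have diff: "h0 (x - y) = h0 x \<otimes>\<^bsub>G\<^esub> inv\<^bsub>G\<^esub> h0 y"
    if "Poly_Mapping.keys x \<subseteq> carrier V \<times> carrier W"
      "Poly_Mapping.keys y \<subseteq> carrier V \<times> carrier W" for x y
    using h.hom_mult[of x "inv\<^bsub>?F\<^esub> y"] h.hom_inv[of y] that by simp
  have k: "Poly_Mapping.keys (a - b) \<subseteq> X"
    if "Poly_Mapping.keys a \<subseteq> X" "Poly_Mapping.keys b \<subseteq> X"
    for a b :: "'x \<Rightarrow>\<^sub>0 int" and X
    using keys_diff[of a b] that by blast
  have clos: "\<beta> v w \<in> carrier G" if "v \<in> carrier V" "w \<in> carrier W" for v w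
    using \<beta> that unfolding balanced_def by blast
  have cancel: "(a \<otimes>\<^bsub>G\<^esub> b) \<otimes>\<^bsub>G\<^esub> inv\<^bsub>G\<^esub> a \<otimes>\<^bsub>G\<^esub> inv\<^bsub>G\<^esub> b = \<one>\<^bsub>G\<^esub>"
    if "a \<in> carrier G" "b \<in> carrier G" for a b
    using that by (simp add: G.m_assoc G.m_comm[of b "inv\<^bsub>G\<^esub> a"] G.inv_solve_left')
  have rel: "h0 r = \<one>\<^bsub>G\<^esub>" if "r \<in> tensor_relators K V W" for r
    using that \<beta> unfolding tensor_relators_def balanced_def
    by (auto simp: diff k h0(2) clos cancel)
  have "tensor_null K V W \<subseteq> kernel ?F G h0"
    unfolding tensor_null_def
  proof (rule F.generate_subgroup_incl)
    show "tensor_relators K V W \<subseteq> kernel ?F G h0"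
      using rel tensor_relators_subset[OF V W]
        by (auto simp: kernel_def simp del: carrier_free_Abelian_group_iff)
    show "subgroup (kernel ?F G h0) ?F"
      by (rule h.subgroup_kernel)
  qed
  then obtain g where "g \<in> hom (?F Mod tensor_null K V W) G"
    "\<And>x. x \<in> carrier ?F \<Longrightarrow> g (tensor_null K V W #>\<^bsub>?F\<^esub> x) = h0 x"
    by (rule h.FactGroup_universal_kernel[OF tensor_null_normal[OF V W]]) blast
  then have "g \<in> hom (tensor_group K V W) G \<and>
      (\<forall>v\<in>carrier V. \<forall>w\<in>carrier W. g (tpure K V W v w) = \<beta> v w)"
    by (simp add: tensor_group_def tpure_def h0(2))
  from someI[where P = "\<lambda>h. h \<in> hom (tensor_group K V W) G \<and>
      (\<forall>v\<in>carrier V. \<forall>w\<in>carrier W. h (tpure K V W v w) = \<beta> v w)", OF this]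
  have *: "balanced_lift K V W G \<beta> \<in> hom (tensor_group K V W) G \<and>
      (\<forall>v\<in>carrier V. \<forall>w\<in>carrier W. balanced_lift K V W G \<beta> (tpure K V W v w) = \<beta> v w)"
    unfolding balanced_lift_def .
  from * show "balanced_lift K V W G \<beta> \<in> hom (tensor_group K V W) G" by blast
  from * show "v \<in> carrier V \<Longrightarrow> w \<in> carrier W \<Longrightarrow>
      balanced_lift K V W G \<beta> (tpure K V W v w) = \<beta> v w" by blast
qed

section \<open>Linear maps and algebras\<close>

text \<open>
  Linear maps, constrained on the carrier of the source only.
\<close>

definition lin ::
  "('k, 'r) ring_scheme \<Rightarrow> ('k, 'a, 'm) module_scheme \<Rightarrow> ('k, 'b, 'n) module_scheme \<Rightarrow> ('a \<Rightarrow> 'b) set"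
  where "lin K A U = {f \<in> carrier A \<rightarrow> carrier U.
    (\<forall>x\<in>carrier A. \<forall>y\<in>carrier A. f (x \<oplus>\<^bsub>A\<^esub> y) = f x \<oplus>\<^bsub>U\<^esub> f y) \<and>
    (\<forall>c\<in>carrier K. \<forall>x\<in>carrier A. f (c \<odot>\<^bsub>A\<^esub> x) = c \<odot>\<^bsub>U\<^esub> f x)}"

text \<open>
  Bilinear maps in curried form: linear in each argument when the other one is fixed.
\<close>

definition bilin ::
  "('k, 'r) ring_scheme \<Rightarrow> ('k, 'a, 'm) module_scheme \<Rightarrow> ('k, 'b, 'n) module_scheme
    \<Rightarrow> ('k, 'c, 'p) module_scheme \<Rightarrow> ('a \<Rightarrow> 'b \<Rightarrow> 'c) set"
  where "bilin K A B U = {\<beta>. (\<forall>a\<in>carrier A. \<beta> a \<in> lin K B U) \<and>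
    (\<forall>b\<in>carrier B. (\<lambda>a. \<beta> a b) \<in> lin K A U)}"

lemma linI:
  assumes "\<And>x. x \<in> carrier A \<Longrightarrow> f x \<in> carrier U"
    and "\<And>x y. x \<in> carrier A \<Longrightarrow> y \<in> carrier A \<Longrightarrow> f (x \<oplus>\<^bsub>A\<^esub> y) = f x \<oplus>\<^bsub>U\<^esub> f y"
    and "\<And>c x. c \<in> carrier K \<Longrightarrow> x \<in> carrier A \<Longrightarrow> f (c \<odot>\<^bsub>A\<^esub> x) = c \<odot>\<^bsub>U\<^esub> f x"
  shows "f \<in> lin K A U"
  using assms by (simp add: lin_def)

lemma lin_closed: "f \<in> lin K A U \<Longrightarrow> x \<in> carrier A \<Longrightarrow> f x \<in> carrier U"
  and lin_add: "f \<in> lin K A U \<Longrightarrow> x \<in> carrier A \<Longrightarrow> y \<in> carrier A \<Longrightarrow>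
    f (x \<oplus>\<^bsub>A\<^esub> y) = f x \<oplus>\<^bsub>U\<^esub> f y"
  and lin_smult: "f \<in> lin K A U \<Longrightarrow> c \<in> carrier K \<Longrightarrow> x \<in> carrier A \<Longrightarrow>
    f (c \<odot>\<^bsub>A\<^esub> x) = c \<odot>\<^bsub>U\<^esub> f x"
  by (auto simp: lin_def)

lemma lin_id [simp]: "(\<lambda>x. x) \<in> lin K A A"
  by (simp add: lin_def)

lemma lin_comp: "f \<in> lin K A B \<Longrightarrow> g \<in> lin K B C \<Longrightarrow> (\<lambda>x. g (f x)) \<in> lin K A C"
  by (auto simp: lin_def Pi_iff)

lemma bilinI:
  assumes "\<And>a. a \<in> carrier A \<Longrightarrow> \<beta> a \<in> lin K B U"
    and "\<And>b. b \<in> carrier B \<Longrightarrow> (\<lambda>a. \<beta> a b) \<in> lin K A U"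
  shows "\<beta> \<in> bilin K A B U"
  using assms by (simp add: bilin_def)

lemma bilin_left: "\<beta> \<in> bilin K A B U \<Longrightarrow> b \<in> carrier B \<Longrightarrow> (\<lambda>a. \<beta> a b) \<in> lin K A U"
  and bilin_right: "\<beta> \<in> bilin K A B U \<Longrightarrow> a \<in> carrier A \<Longrightarrow> \<beta> a \<in> lin K B U"
  by (simp_all add: bilin_def)

lemma alg_homI:
  assumes "f \<in> lin K A B"
    and "\<And>x y. x \<in> carrier A \<Longrightarrow> y \<in> carrier A \<Longrightarrow> f (x \<otimes>\<^bsub>A\<^esub> y) = f x \<otimes>\<^bsub>B\<^esub> f y"
    and "f \<one>\<^bsub>A\<^esub> = \<one>\<^bsub>B\<^esub>"
  shows "f \<in> alg_hom K A B"
  using assms unfolding alg_hom_def lin_def by (auto intro!: ring_hom_memI)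

lemma alg_hom_lin: "f \<in> alg_hom K A B \<Longrightarrow> f \<in> lin K A B"
  and alg_hom_mult: "f \<in> alg_hom K A B \<Longrightarrow> x \<in> carrier A \<Longrightarrow> y \<in> carrier A \<Longrightarrow>
    f (x \<otimes>\<^bsub>A\<^esub> y) = f x \<otimes>\<^bsub>B\<^esub> f y"
  and alg_hom_one: "f \<in> alg_hom K A B \<Longrightarrow> f \<one>\<^bsub>A\<^esub> = \<one>\<^bsub>B\<^esub>"
  by (auto simp: lin_def alg_hom_def ring_hom_def)

lemmas lin_rules = lin_closed lin_add lin_smult
lemmas alg_hom_rules = lin_rules[OF alg_hom_lin] alg_hom_mult alg_hom_one

lemma alg_hom_id [simp]: "(\<lambda>x. x) \<in> alg_hom K A A"
  by (rule alg_homI) simp_all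

lemma alg_hom_comp:
  "f \<in> alg_hom K A B \<Longrightarrow> g \<in> alg_hom K B C \<Longrightarrow> (\<lambda>x. g (f x)) \<in> alg_hom K A C"
  by (rule alg_homI) (auto intro: lin_comp alg_hom_lin simp: alg_hom_rules)

text \<open>
  A fixed commutative ring of scalars.
\<close>

locale scalars = K: cring K for K :: "('k, 'r) ring_scheme"
begin

lemma k_algebraI:
  assumes "abelian_group A"
    and "\<And>x y. x \<in> carrier A \<Longrightarrow> y \<in> carrier A \<Longrightarrow> x \<otimes>\<^bsub>A\<^esub> y \<in> carrier A"
    and "\<one>\<^bsub>A\<^esub> \<in> carrier A"
    and "\<And>x y z. x \<in> carrier A \<Longrightarrow> y \<in> carrier A \<Longrightarrow> z \<in> carrier A \<Longrightarrow>
      (x \<otimes>\<^bsub>A\<^esub> y) \<otimes>\<^bsub>A\<^esub> z = x \<otimes>\<^bsub>A\<^esub> (y \<otimes>\<^bsub>A\<^esub> z)"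
    and "\<And>x. x \<in> carrier A \<Longrightarrow> \<one>\<^bsub>A\<^esub> \<otimes>\<^bsub>A\<^esub> x = x"
    and "\<And>x. x \<in> carrier A \<Longrightarrow> x \<otimes>\<^bsub>A\<^esub> \<one>\<^bsub>A\<^esub> = x"
    and "\<And>x y z. x \<in> carrier A \<Longrightarrow> y \<in> carrier A \<Longrightarrow> z \<in> carrier A \<Longrightarrow>
      (x \<oplus>\<^bsub>A\<^esub> y) \<otimes>\<^bsub>A\<^esub> z = x \<otimes>\<^bsub>A\<^esub> z \<oplus>\<^bsub>A\<^esub> y \<otimes>\<^bsub>A\<^esub> z"
    and "\<And>x y z. x \<in> carrier A \<Longrightarrow> y \<in> carrier A \<Longrightarrow> z \<in> carrier A \<Longrightarrow>
      z \<otimes>\<^bsub>A\<^esub> (x \<oplus>\<^bsub>A\<^esub> y) = z \<otimes>\<^bsub>A\<^esub> x \<oplus>\<^bsub>A\<^esub> z \<otimes>\<^bsub>A\<^esub> y"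
    and "\<And>c x. c \<in> carrier K \<Longrightarrow> x \<in> carrier A \<Longrightarrow> c \<odot>\<^bsub>A\<^esub> x \<in> carrier A"
    and "\<And>c d x. c \<in> carrier K \<Longrightarrow> d \<in> carrier K \<Longrightarrow> x \<in> carrier A \<Longrightarrow>
      (c \<oplus>\<^bsub>K\<^esub> d) \<odot>\<^bsub>A\<^esub> x = c \<odot>\<^bsub>A\<^esub> x \<oplus>\<^bsub>A\<^esub> d \<odot>\<^bsub>A\<^esub> x"
    and "\<And>c x y. c \<in> carrier K \<Longrightarrow> x \<in> carrier A \<Longrightarrow> y \<in> carrier A \<Longrightarrow>
      c \<odot>\<^bsub>A\<^esub> (x \<oplus>\<^bsub>A\<^esub> y) = c \<odot>\<^bsub>A\<^esub> x \<oplus>\<^bsub>A\<^esub> c \<odot>\<^bsub>A\<^esub> y"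
    and "\<And>c d x. c \<in> carrier K \<Longrightarrow> d \<in> carrier K \<Longrightarrow> x \<in> carrier A \<Longrightarrow>
      (c \<otimes>\<^bsub>K\<^esub> d) \<odot>\<^bsub>A\<^esub> x = c \<odot>\<^bsub>A\<^esub> (d \<odot>\<^bsub>A\<^esub> x)"
    and "\<And>x. x \<in> carrier A \<Longrightarrow> \<one>\<^bsub>K\<^esub> \<odot>\<^bsub>A\<^esub> x = x"
    and "\<And>c x y. c \<in> carrier K \<Longrightarrow> x \<in> carrier A \<Longrightarrow> y \<in> carrier A \<Longrightarrow>
      (c \<odot>\<^bsub>A\<^esub> x) \<otimes>\<^bsub>A\<^esub> y = c \<odot>\<^bsub>A\<^esub> (x \<otimes>\<^bsub>A\<^esub> y)"
    and "\<And>c x y. c \<in> carrier K \<Longrightarrow> x \<in> carrier A \<Longrightarrow> y \<in> carrier A \<Longrightarrow>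
      x \<otimes>\<^bsub>A\<^esub> (c \<odot>\<^bsub>A\<^esub> y) = c \<odot>\<^bsub>A\<^esub> (x \<otimes>\<^bsub>A\<^esub> y)"
  shows "k_algebra K A"
proof -
  have "module K A"
    by (rule moduleI, rule K.is_cring) (rule assms; assumption)+
  moreover have "ring A"
    by (rule ringI monoidI; (rule assms; assumption)?)+
  ultimately show ?thesis
    unfolding k_algebra_def by (intro conjI ballI) (assumption | rule assms(14,15); assumption)+
qed

lemma k_algebra_module: "k_algebra K A \<Longrightarrow> module K A"
  and k_algebra_ring: "k_algebra K A \<Longrightarrow> ring A"
  by (simp_all add: k_algebra_def)

context
  fixes A :: "('k, 'a, 'm) module_scheme"
  assumes A: "k_algebra K A"
begin

interpretation A: module K A by (rule k_algebra_module[OF A])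
interpretation A: ring A by (rule k_algebra_ring[OF A])

lemma alg_abelian_group: "abelian_group A" by (rule A.is_abelian_group)

lemma alg_simps [simp]:
  "x \<in> carrier A \<Longrightarrow> y \<in> carrier A \<Longrightarrow> x \<oplus>\<^bsub>A\<^esub> y \<in> carrier A"
  "x \<in> carrier A \<Longrightarrow> y \<in> carrier A \<Longrightarrow> x \<otimes>\<^bsub>A\<^esub> y \<in> carrier A"
  "\<one>\<^bsub>A\<^esub> \<in> carrier A"
  "\<zero>\<^bsub>A\<^esub> \<in> carrier A"
  "c \<in> carrier K \<Longrightarrow> x \<in> carrier A \<Longrightarrow> c \<odot>\<^bsub>A\<^esub> x \<in> carrier A"
  "x \<in> carrier A \<Longrightarrow> \<one>\<^bsub>A\<^esub> \<otimes>\<^bsub>A\<^esub> x = x"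
  "x \<in> carrier A \<Longrightarrow> x \<otimes>\<^bsub>A\<^esub> \<one>\<^bsub>A\<^esub> = x"
  "x \<in> carrier A \<Longrightarrow> y \<in> carrier A \<Longrightarrow> z \<in> carrier A \<Longrightarrow>
    (x \<oplus>\<^bsub>A\<^esub> y) \<otimes>\<^bsub>A\<^esub> z = x \<otimes>\<^bsub>A\<^esub> z \<oplus>\<^bsub>A\<^esub> y \<otimes>\<^bsub>A\<^esub> z"
  "x \<in> carrier A \<Longrightarrow> y \<in> carrier A \<Longrightarrow> z \<in> carrier A \<Longrightarrow>
    z \<otimes>\<^bsub>A\<^esub> (x \<oplus>\<^bsub>A\<^esub> y) = z \<otimes>\<^bsub>A\<^esub> x \<oplus>\<^bsub>A\<^esub> z \<otimes>\<^bsub>A\<^esub> y"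
  "c \<in> carrier K \<Longrightarrow> x \<in> carrier A \<Longrightarrow> y \<in> carrier A \<Longrightarrow>
    c \<odot>\<^bsub>A\<^esub> (x \<oplus>\<^bsub>A\<^esub> y) = c \<odot>\<^bsub>A\<^esub> x \<oplus>\<^bsub>A\<^esub> c \<odot>\<^bsub>A\<^esub> y"
  "c \<in> carrier K \<Longrightarrow> d \<in> carrier K \<Longrightarrow> x \<in> carrier A \<Longrightarrow>
    (c \<oplus>\<^bsub>K\<^esub> d) \<odot>\<^bsub>A\<^esub> x = c \<odot>\<^bsub>A\<^esub> x \<oplus>\<^bsub>A\<^esub> d \<odot>\<^bsub>A\<^esub> x"
  "c \<in> carrier K \<Longrightarrow> d \<in> carrier K \<Longrightarrow> x \<in> carrier A \<Longrightarrow>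
    (c \<otimes>\<^bsub>K\<^esub> d) \<odot>\<^bsub>A\<^esub> x = c \<odot>\<^bsub>A\<^esub> (d \<odot>\<^bsub>A\<^esub> x)"
  "x \<in> carrier A \<Longrightarrow> \<one>\<^bsub>K\<^esub> \<odot>\<^bsub>A\<^esub> x = x"
  "c \<in> carrier K \<Longrightarrow> x \<in> carrier A \<Longrightarrow> y \<in> carrier A \<Longrightarrow>
    (c \<odot>\<^bsub>A\<^esub> x) \<otimes>\<^bsub>A\<^esub> y = c \<odot>\<^bsub>A\<^esub> (x \<otimes>\<^bsub>A\<^esub> y)"
  "c \<in> carrier K \<Longrightarrow> x \<in> carrier A \<Longrightarrow> y \<in> carrier A \<Longrightarrow>
    x \<otimes>\<^bsub>A\<^esub> (c \<odot>\<^bsub>A\<^esub> y) = c \<odot>\<^bsub>A\<^esub> (x \<otimes>\<^bsub>A\<^esub> y)"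
  using A
  by (auto simp: k_algebra_def A.l_distr A.r_distr A.smult_l_distr A.smult_r_distr A.smult_assoc1)

lemma alg_add_ac:
  "x \<in> carrier A \<Longrightarrow> y \<in> carrier A \<Longrightarrow> z \<in> carrier A \<Longrightarrow>
    (x \<oplus>\<^bsub>A\<^esub> y) \<oplus>\<^bsub>A\<^esub> z = x \<oplus>\<^bsub>A\<^esub> (y \<oplus>\<^bsub>A\<^esub> z)"
  "x \<in> carrier A \<Longrightarrow> y \<in> carrier A \<Longrightarrow> x \<oplus>\<^bsub>A\<^esub> y = y \<oplus>\<^bsub>A\<^esub> x"
  "x \<in> carrier A \<Longrightarrow> y \<in> carrier A \<Longrightarrow> z \<in> carrier A \<Longrightarrow>
    x \<oplus>\<^bsub>A\<^esub> (y \<oplus>\<^bsub>A\<^esub> z) = y \<oplus>\<^bsub>A\<^esub> (x \<oplus>\<^bsub>A\<^esub> z)"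
  by (simp_all add: A.a_ac A.a_lcomm)

lemma alg_m_assoc: "x \<in> carrier A \<Longrightarrow> y \<in> carrier A \<Longrightarrow> z \<in> carrier A \<Longrightarrow>
    (x \<otimes>\<^bsub>A\<^esub> y) \<otimes>\<^bsub>A\<^esub> z = x \<otimes>\<^bsub>A\<^esub> (y \<otimes>\<^bsub>A\<^esub> z)"
  by (rule A.m_assoc)

lemma alg_smult_swap: "c \<in> carrier K \<Longrightarrow> d \<in> carrier K \<Longrightarrow> x \<in> carrier A \<Longrightarrow>
    c \<odot>\<^bsub>A\<^esub> (d \<odot>\<^bsub>A\<^esub> x) = d \<odot>\<^bsub>A\<^esub> (c \<odot>\<^bsub>A\<^esub> x)"
  using A.smult_assoc1[of c d x] A.smult_assoc1[of d c x] by (simp add: K.m_comm)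

end

section \<open>The tensor product of two algebras\<close>

lemma tensor_alg_sel:
  "carrier (tensor_alg K A B) = carrier (tensor_group K A B)"
  "\<one>\<^bsub>tensor_alg K A B\<^esub> = tpure K A B \<one>\<^bsub>A\<^esub> \<one>\<^bsub>B\<^esub>"
  "\<zero>\<^bsub>tensor_alg K A B\<^esub> = \<one>\<^bsub>tensor_group K A B\<^esub>"
  "X \<oplus>\<^bsub>tensor_alg K A B\<^esub> Y = X \<otimes>\<^bsub>tensor_group K A B\<^esub> Y"
  "c \<odot>\<^bsub>tensor_alg K A B\<^esub> X =
     balanced_lift K A B (tensor_group K A B) (\<lambda>a b. tpure K A B (c \<odot>\<^bsub>A\<^esub> a) b) X"
  "X \<otimes>\<^bsub>tensor_alg K A B\<^esub> Y = balanced_lift K A B (tensor_group K A B)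
     (\<lambda>a b. balanced_lift K A B (tensor_group K A B)
        (\<lambda>a' b'. tpure K A B (a \<otimes>\<^bsub>A\<^esub> a') (b \<otimes>\<^bsub>B\<^esub> b')) Y) X"
  by (simp_all add: tensor_alg_def Let_def)

lemma tensor_alg_one: "\<one>\<^bsub>tensor_alg K A B\<^esub> = tpure K A B \<one>\<^bsub>A\<^esub> \<one>\<^bsub>B\<^esub>"
  by (rule tensor_alg_sel)

context
  fixes A :: "('k, 'a, 'm) module_scheme" and B :: "('k, 'b, 'n) module_scheme"
  assumes A [simp]: "k_algebra K A" and B [simp]: "k_algebra K B"
begin

lemmas AB_modules = k_algebra_module[OF A] k_algebra_module[OF B]

interpretation T: comm_group "tensor_group K A B"
  by (rule tensor_group_comm_group[OF AB_modules])

lemma tensor_induct [consumes 1, case_names pure add]: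
  assumes "X \<in> carrier (tensor_alg K A B)"
    and "\<And>a b. a \<in> carrier A \<Longrightarrow> b \<in> carrier B \<Longrightarrow> P (tpure K A B a b)"
    and "\<And>X Y. X \<in> carrier (tensor_alg K A B) \<Longrightarrow> Y \<in> carrier (tensor_alg K A B) \<Longrightarrow>
      P X \<Longrightarrow> P Y \<Longrightarrow> P (X \<oplus>\<^bsub>tensor_alg K A B\<^esub> Y)"
  shows "P X"
  using tensor_group_induct[OF AB_modules, of X P] assms by (simp add: tensor_alg_sel)

lemma tpure_closed [simp]:
  "a \<in> carrier A \<Longrightarrow> b \<in> carrier B \<Longrightarrow> tpure K A B a b \<in> carrier (tensor_alg K A B)"
  by (simp add: tensor_alg_sel tpure_closed_group)

lemma tpure_add_left [simp]: "a \<in> carrier A \<Longrightarrow> a' \<in> carrier A \<Longrightarrow> b \<in> carrier B \<Longrightarrow>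
    tpure K A B (a \<oplus>\<^bsub>A\<^esub> a') b = tpure K A B a b \<oplus>\<^bsub>tensor_alg K A B\<^esub> tpure K A B a' b"
  by (simp add: tensor_alg_sel tpure_group_add_left[OF AB_modules])

lemma tpure_add_right [simp]: "a \<in> carrier A \<Longrightarrow> b \<in> carrier B \<Longrightarrow> b' \<in> carrier B \<Longrightarrow>
    tpure K A B a (b \<oplus>\<^bsub>B\<^esub> b') = tpure K A B a b \<oplus>\<^bsub>tensor_alg K A B\<^esub> tpure K A B a b'"
  by (simp add: tensor_alg_sel tpure_group_add_right[OF AB_modules])

lemma balanced_tensor_smult:
  "c \<in> carrier K \<Longrightarrow>
    balanced K A B (tensor_group K A B) (\<lambda>a b. tpure K A B (c \<odot>\<^bsub>A\<^esub> a) b)"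
  by (rule balancedI, unfold tensor_alg_sel(1,4)[symmetric])
    (simp_all add: alg_smult_swap[OF A, of c] flip: tpure_group_balanced[OF AB_modules])

lemma tpure_smult_left [simp]: "c \<in> carrier K \<Longrightarrow> a \<in> carrier A \<Longrightarrow> b \<in> carrier B \<Longrightarrow>
    tpure K A B (c \<odot>\<^bsub>A\<^esub> a) b = c \<odot>\<^bsub>tensor_alg K A B\<^esub> tpure K A B a b"
  by (simp add: tensor_alg_sel(5) balanced_lift_pure[OF AB_modules T.comm_group_axioms]
      balanced_tensor_smult)

lemma tpure_smult_right [simp]: "c \<in> carrier K \<Longrightarrow> a \<in> carrier A \<Longrightarrow> b \<in> carrier B \<Longrightarrow>
    tpure K A B a (c \<odot>\<^bsub>B\<^esub> b) = c \<odot>\<^bsub>tensor_alg K A B\<^esub> tpure K A B a b"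
  using tpure_group_balanced[OF AB_modules] by (simp flip: tpure_smult_left)

lemma tensor_smult_lift:
  assumes "c \<in> carrier K"
  shows "X \<in> carrier (tensor_alg K A B) \<Longrightarrow>
      c \<odot>\<^bsub>tensor_alg K A B\<^esub> X \<in> carrier (tensor_alg K A B)"
    and "X \<in> carrier (tensor_alg K A B) \<Longrightarrow> Y \<in> carrier (tensor_alg K A B) \<Longrightarrow>
      c \<odot>\<^bsub>tensor_alg K A B\<^esub> (X \<oplus>\<^bsub>tensor_alg K A B\<^esub> Y) =
      c \<odot>\<^bsub>tensor_alg K A B\<^esub> X \<oplus>\<^bsub>tensor_alg K A B\<^esub> c \<odot>\<^bsub>tensor_alg K A B\<^esub> Y"
  using balanced_lift_hom[OF AB_modules T.comm_group_axioms balanced_tensor_smult[OF assms]]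
  by (auto simp: tensor_alg_sel hom_def)

lemma tensor_abelian_group: "abelian_group (tensor_alg K A B)"
  by (rule abelian_groupI) (auto simp: tensor_alg_sel T.m_ac intro: T.l_inv_ex)

text \<open>
  The product of two tensors is a lift nested in a lift: the inner one multiplies the pure tensor
  \<open>a \<otimes> b\<close> into its right argument, the outer one lets \<open>a \<otimes> b\<close> vary.
\<close>

lemma balanced_mult_inner:
  "a \<in> carrier A \<Longrightarrow> b \<in> carrier B \<Longrightarrow> balanced K A B (tensor_group K A B)
     (\<lambda>a' b'. tpure K A B (a \<otimes>\<^bsub>A\<^esub> a') (b \<otimes>\<^bsub>B\<^esub> b'))"
  by (rule balancedI) (auto simp flip: tensor_alg_sel(1,4))

lemmas inner_pure = balanced_lift_pure[OF AB_modules T.comm_group_axioms balanced_mult_inner]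
lemmas inner_hom = balanced_lift_hom[OF AB_modules T.comm_group_axioms balanced_mult_inner]

lemma inner_add:
  assumes "a \<in> carrier A" "b \<in> carrier B"
    "X \<in> carrier (tensor_alg K A B)" "Y \<in> carrier (tensor_alg K A B)"
  shows "balanced_lift K A B (tensor_group K A B)
      (\<lambda>a' b'. tpure K A B (a \<otimes>\<^bsub>A\<^esub> a') (b \<otimes>\<^bsub>B\<^esub> b')) (X \<oplus>\<^bsub>tensor_alg K A B\<^esub> Y) =
    balanced_lift K A B (tensor_group K A B)
      (\<lambda>a' b'. tpure K A B (a \<otimes>\<^bsub>A\<^esub> a') (b \<otimes>\<^bsub>B\<^esub> b')) X \<oplus>\<^bsub>tensor_alg K A B\<^esub>
    balanced_lift K A B (tensor_group K A B)
      (\<lambda>a' b'. tpure K A B (a \<otimes>\<^bsub>A\<^esub> a') (b \<otimes>\<^bsub>B\<^esub> b')) Y"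
  using inner_hom[OF assms(1,2)] assms(3,4) by (simp add: tensor_alg_sel hom_def)

lemma inner_closed:
  assumes "a \<in> carrier A" "b \<in> carrier B" "X \<in> carrier (tensor_alg K A B)"
  shows "balanced_lift K A B (tensor_group K A B)
      (\<lambda>a' b'. tpure K A B (a \<otimes>\<^bsub>A\<^esub> a') (b \<otimes>\<^bsub>B\<^esub> b')) X \<in> carrier (tensor_alg K A B)"
  using inner_hom[OF assms(1,2)] assms(3) by (auto simp add: tensor_alg_sel hom_def)

interpretation TA: abelian_group "tensor_alg K A B"
  by (rule tensor_abelian_group)

lemma balanced_mult_outer:
  assumes Y: "Y \<in> carrier (tensor_alg K A B)"
  shows "balanced K A B (tensor_group K A B)
     (\<lambda>a b. balanced_lift K A B (tensor_group K A B)
        (\<lambda>a' b'. tpure K A B (a \<otimes>\<^bsub>A\<^esub> a') (b \<otimes>\<^bsub>B\<^esub> b')) Y)"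
proof (rule balancedI, unfold tensor_alg_sel(1,4)[symmetric], goal_cases)
  case (1 a b)
  then show ?case using inner_closed Y by simp
next
  case (2 a1 a2 b)
  from Y show ?case
    by (induct rule: tensor_induct) (simp_all add: 2 inner_pure inner_add inner_closed TA.a_ac)
next
  case (3 a b1 b2)
  from Y show ?case
    by (induct rule: tensor_induct) (simp_all add: 3 inner_pure inner_add inner_closed TA.a_ac)
next
  case (4 c a b)
  from Y show ?case
    by (induct rule: tensor_induct) (simp_all add: 4 inner_pure inner_add inner_closed)
qed

lemma tensor_mult_pure [simp]:
  assumes "a \<in> carrier A" "b \<in> carrier B" "a' \<in> carrier A" "b' \<in> carrier B"
  shows "tpure K A B a b \<otimes>\<^bsub>tensor_alg K A B\<^esub> tpure K A B a' b' =
    tpure K A B (a \<otimes>\<^bsub>A\<^esub> a') (b \<otimes>\<^bsub>B\<^esub> b')"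
  using assms
  by (simp add: tensor_alg_sel(6) inner_pure
      balanced_lift_pure[OF AB_modules T.comm_group_axioms balanced_mult_outer])

lemma tensor_mult_lift:
  assumes "X \<in> carrier (tensor_alg K A B)" "Y \<in> carrier (tensor_alg K A B)"
  shows "X \<otimes>\<^bsub>tensor_alg K A B\<^esub> Y \<in> carrier (tensor_alg K A B)"
    and "Z \<in> carrier (tensor_alg K A B) \<Longrightarrow> (X \<oplus>\<^bsub>tensor_alg K A B\<^esub> Y) \<otimes>\<^bsub>tensor_alg K A B\<^esub> Z =
      X \<otimes>\<^bsub>tensor_alg K A B\<^esub> Z \<oplus>\<^bsub>tensor_alg K A B\<^esub> Y \<otimes>\<^bsub>tensor_alg K A B\<^esub> Z"
  using balanced_lift_hom[OF AB_modules T.comm_group_axioms balanced_mult_outer] assms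
  by (auto simp: tensor_alg_sel hom_def)

lemma tensor_mult_add_right:
  assumes "Z \<in> carrier (tensor_alg K A B)"
    "X \<in> carrier (tensor_alg K A B)" "Y \<in> carrier (tensor_alg K A B)"
  shows "Z \<otimes>\<^bsub>tensor_alg K A B\<^esub> (X \<oplus>\<^bsub>tensor_alg K A B\<^esub> Y) =
      Z \<otimes>\<^bsub>tensor_alg K A B\<^esub> X \<oplus>\<^bsub>tensor_alg K A B\<^esub> Z \<otimes>\<^bsub>tensor_alg K A B\<^esub> Y"
  using assms(1)
proof (induct rule: tensor_induct)
  case (pure a b)
  then show ?case
    using assms
    by (simp add: tensor_alg_sel(6) inner_add
      balanced_lift_pure[OF AB_modules T.comm_group_axioms balanced_mult_outer])
next
  case (add U V)
  then show ?case
    using assms by (simp add: tensor_mult_lift TA.a_ac)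
qed

lemmas tensor_ring_rules =
  tensor_mult_lift tensor_mult_add_right tensor_smult_lift TA.a_ac

lemma tensor_alg_k_algebra [simp]: "k_algebra K (tensor_alg K A B)"
proof (rule k_algebraI)
  let ?T = "tensor_alg K A B"
  show "abelian_group ?T" by (rule tensor_abelian_group)
  show one: "\<one>\<^bsub>?T\<^esub> \<in> carrier ?T"
    by (simp add: tensor_alg_one)
  fix x assume x: "x \<in> carrier ?T"
  show "\<one>\<^bsub>?T\<^esub> \<otimes>\<^bsub>?T\<^esub> x = x"
    using x by (induct rule: tensor_induct) (simp_all add: tensor_ring_rules one, simp add: tensor_alg_one)
  show "x \<otimes>\<^bsub>?T\<^esub> \<one>\<^bsub>?T\<^esub> = x"
    using x by (induct rule: tensor_induct) (simp_all add: tensor_ring_rules one, simp add: tensor_alg_one)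
  show "\<one>\<^bsub>K\<^esub> \<odot>\<^bsub>?T\<^esub> x = x"
    using x by (induct rule: tensor_induct)
      (simp_all add: tensor_ring_rules flip: tpure_smult_left)
  fix y assume y: "y \<in> carrier ?T"
  show "x \<otimes>\<^bsub>?T\<^esub> y \<in> carrier ?T"
    using x y by (rule tensor_mult_lift)
  {
  fix z assume z: "z \<in> carrier ?T"
  show "(x \<oplus>\<^bsub>?T\<^esub> y) \<otimes>\<^bsub>?T\<^esub> z = x \<otimes>\<^bsub>?T\<^esub> z \<oplus>\<^bsub>?T\<^esub> y \<otimes>\<^bsub>?T\<^esub> z"
    using x y z by (rule tensor_mult_lift)
  show "z \<otimes>\<^bsub>?T\<^esub> (x \<oplus>\<^bsub>?T\<^esub> y) = z \<otimes>\<^bsub>?T\<^esub> x \<oplus>\<^bsub>?T\<^esub> z \<otimes>\<^bsub>?T\<^esub> y"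
    using z x y by (rule tensor_mult_add_right)
  show "(x \<otimes>\<^bsub>?T\<^esub> y) \<otimes>\<^bsub>?T\<^esub> z = x \<otimes>\<^bsub>?T\<^esub> (y \<otimes>\<^bsub>?T\<^esub> z)"
    using x
  proof (induct rule: tensor_induct)
    case (pure a b)
    from y show ?case
    proof (induct rule: tensor_induct)
      case (pure a' b')
      from z show ?case
        by (induct rule: tensor_induct)
          (simp_all add: \<open>a \<in> _\<close> \<open>b \<in> _\<close> pure tensor_ring_rules alg_m_assoc[OF A] alg_m_assoc[OF B])
    qed (simp add: tensor_ring_rules z pure)
  qed (simp add: tensor_ring_rules y z)
  }
  fix c assume c: "c \<in> carrier K"
  show "c \<odot>\<^bsub>?T\<^esub> x \<in> carrier ?T"
    using c x by (rule tensor_smult_lift)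
  show "c \<odot>\<^bsub>?T\<^esub> (x \<oplus>\<^bsub>?T\<^esub> y) = c \<odot>\<^bsub>?T\<^esub> x \<oplus>\<^bsub>?T\<^esub> c \<odot>\<^bsub>?T\<^esub> y"
    using c x y by (rule tensor_smult_lift)
  have pure_smult: "c \<odot>\<^bsub>?T\<^esub> tpure K A B a b = tpure K A B (c \<odot>\<^bsub>A\<^esub> a) b"
    if "a \<in> carrier A" "b \<in> carrier B" for a b
    using that c by simp
  have p1: "(c \<odot>\<^bsub>?T\<^esub> tpure K A B a b) \<otimes>\<^bsub>?T\<^esub> tpure K A B a' b' =
      c \<odot>\<^bsub>?T\<^esub> tpure K A B (a \<otimes>\<^bsub>A\<^esub> a') (b \<otimes>\<^bsub>B\<^esub> b')"
    if "a \<in> carrier A" "b \<in> carrier B" "a' \<in> carrier A" "b' \<in> carrier B" for a b a' b'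
    using that c by (simp add: pure_smult del: tpure_smult_left)
  have p2: "tpure K A B a b \<otimes>\<^bsub>?T\<^esub> (c \<odot>\<^bsub>?T\<^esub> tpure K A B a' b') =
      c \<odot>\<^bsub>?T\<^esub> tpure K A B (a \<otimes>\<^bsub>A\<^esub> a') (b \<otimes>\<^bsub>B\<^esub> b')"
    if "a \<in> carrier A" "b \<in> carrier B" "a' \<in> carrier A" "b' \<in> carrier B" for a b a' b'
    using that c by (simp add: pure_smult del: tpure_smult_left)
  show "(c \<odot>\<^bsub>?T\<^esub> x) \<otimes>\<^bsub>?T\<^esub> y = c \<odot>\<^bsub>?T\<^esub> (x \<otimes>\<^bsub>?T\<^esub> y)"
    using x
  proof (induct rule: tensor_induct)
    case (pure a b)
    from y show ?case
      by (induct rule: tensor_induct) (simp_all add: pure c p1 tensor_ring_rules)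
  qed (simp add: tensor_ring_rules y c)
  show "x \<otimes>\<^bsub>?T\<^esub> (c \<odot>\<^bsub>?T\<^esub> y) = c \<odot>\<^bsub>?T\<^esub> (x \<otimes>\<^bsub>?T\<^esub> y)"
    using x
  proof (induct rule: tensor_induct)
    case (pure a b)
    from y show ?case
      by (induct rule: tensor_induct) (simp_all add: pure c p2 tensor_ring_rules)
  qed (simp add: tensor_ring_rules y c)
  fix d assume d: "d \<in> carrier K"
  show "(c \<oplus>\<^bsub>K\<^esub> d) \<odot>\<^bsub>?T\<^esub> x = c \<odot>\<^bsub>?T\<^esub> x \<oplus>\<^bsub>?T\<^esub> d \<odot>\<^bsub>?T\<^esub> x"
    using x
  proof (induct rule: tensor_induct)
    case (pure a b)
    then show ?case using c d by (simp flip: tpure_smult_left)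
  qed (simp add: tensor_ring_rules c d)
  show "(c \<otimes>\<^bsub>K\<^esub> d) \<odot>\<^bsub>?T\<^esub> x = c \<odot>\<^bsub>?T\<^esub> (d \<odot>\<^bsub>?T\<^esub> x)"
    using x
  proof (induct rule: tensor_induct)
    case (pure a b)
    then show ?case using c d by (simp flip: tpure_smult_left)
  qed (simp add: tensor_ring_rules c d)
qed

end


text \<open>
  The form of the induction rule in which the algebra assumptions come last, as goals left to
  simplification.
\<close>

lemmas tensor_induction [consumes 1, case_names pure add] = tensor_induct[rotated 2]

section \<open>Linear maps out of a tensor product\<close>

declare alg_hom_lin [simp]

text \<open>
  Over algebras, the lift of a bilinear map is linear and not only additive.
\<close>

lemma tensor_lift:
  assumes A: "k_algebra K A" and B: "k_algebra K B" and U: "k_algebra K U"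
    and \<beta>: "\<beta> \<in> bilin K A B U"
  shows tensor_lift_lin: "tensor_lift K A B U \<beta> \<in> lin K (tensor_alg K A B) U"
    and tensor_lift_pure: "a \<in> carrier A \<Longrightarrow> b \<in> carrier B \<Longrightarrow>
      tensor_lift K A B U \<beta> (tpure K A B a b) = \<beta> a b"
proof -
  note [simp] = A B U
  note \<beta>l = lin_rules[OF bilin_left[OF \<beta>]] and \<beta>r = lin_rules[OF bilin_right[OF \<beta>]]
  have bal: "balanced K A B (add_monoid U) \<beta>"
    by (rule balancedI) (auto simp: \<beta>l \<beta>r)
  have G: "comm_group (add_monoid U)"
    by (rule abelian_group.a_comm_group[OF alg_abelian_group[OF U]])
  note bl = balanced_lift[OF k_algebra_module[OF A] k_algebra_module[OF B] G bal,
      folded tensor_lift_def]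
  show lift_pure: "tensor_lift K A B U \<beta> (tpure K A B a b) = \<beta> a b"
    if "a \<in> carrier A" "b \<in> carrier B" for a b
    using bl(2) that .
  have cl: "X \<in> carrier (tensor_alg K A B) \<Longrightarrow> tensor_lift K A B U \<beta> X \<in> carrier U" for X
    using bl(1) by (auto simp: hom_def tensor_alg_sel)
  have ad: "X \<in> carrier (tensor_alg K A B) \<Longrightarrow> Y \<in> carrier (tensor_alg K A B) \<Longrightarrow>
      tensor_lift K A B U \<beta> (X \<oplus>\<^bsub>tensor_alg K A B\<^esub> Y) =
      tensor_lift K A B U \<beta> X \<oplus>\<^bsub>U\<^esub> tensor_lift K A B U \<beta> Y" for X Y
    using bl(1) by (auto simp: hom_def tensor_alg_sel)
  have sm: "tensor_lift K A B U \<beta> (c \<odot>\<^bsub>tensor_alg K A B\<^esub> X) = c \<odot>\<^bsub>U\<^esub> tensor_lift K A B U \<beta> X"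
    if c: "c \<in> carrier K" and X: "X \<in> carrier (tensor_alg K A B)" for c X
    using X
  proof (induct rule: tensor_induction)
    case (pure a b)
    then show ?case
      using c by (simp add: pure lift_pure \<beta>l del: tpure_smult_left flip: tpure_smult_left[OF A B])
  qed (simp_all add: ad c cl)
  show "tensor_lift K A B U \<beta> \<in> lin K (tensor_alg K A B) U"
    by (rule linI) (simp_all add: cl ad sm)
qed

lemma lin_eqI:
  assumes A: "k_algebra K A" and B: "k_algebra K B"
    and f: "f \<in> lin K (tensor_alg K A B) U" and g: "g \<in> lin K (tensor_alg K A B) U"
    and eq: "\<And>a b. a \<in> carrier A \<Longrightarrow> b \<in> carrier B \<Longrightarrow> f (tpure K A B a b) = g (tpure K A B a b)"
    and X: "X \<in> carrier (tensor_alg K A B)"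
  shows "f X = g X"
  using X by (induct rule: tensor_induction)
    (simp_all add: A B eq lin_rules[OF f] lin_rules[OF g])

text \<open>A tensor lift that depends linearly on a further argument is again bilinear.\<close>

lemma tensor_lift_param:
  assumes A [simp]: "k_algebra K A" and B [simp]: "k_algebra K B"
    and Z [simp]: "k_algebra K Z" and U [simp]: "k_algebra K U"
    and bil: "\<And>z. z \<in> carrier Z \<Longrightarrow> (\<lambda>a b. \<gamma> a b z) \<in> bilin K A B U"
    and lin: "\<And>a b. a \<in> carrier A \<Longrightarrow> b \<in> carrier B \<Longrightarrow> \<gamma> a b \<in> lin K Z U"
  shows "(\<lambda>X z. tensor_lift K A B U (\<lambda>a b. \<gamma> a b z) X) \<in> bilin K (tensor_alg K A B) Z U"
proof (rule bilinI)
  fix z assume z: "z \<in> carrier Z"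
  show "(\<lambda>X. tensor_lift K A B U (\<lambda>a b. \<gamma> a b z) X) \<in> lin K (tensor_alg K A B) U"
    using tensor_lift_lin[OF A B U bil[OF z]] .
next
  fix X assume "X \<in> carrier (tensor_alg K A B)"
  then show "(\<lambda>z. tensor_lift K A B U (\<lambda>a b. \<gamma> a b z) X) \<in> lin K Z U"
  proof (induct rule: tensor_induction)
    case (pure a b)
    then show ?case
      by (intro linI) (simp_all add: tensor_lift_pure[OF A B U bil] lin_rules[OF lin])
  next
    case (add X Y)
    note [simp] = lin_rules[OF add(3)] lin_rules[OF add(4)]
    show ?case
      by (intro linI)
        (simp_all add: lin_add[OF tensor_lift_lin[OF A B U bil]] add(1,2) alg_add_ac[OF U])
  qed simp_all
qed

text \<open>
  By bilinearity, multiplicativity needs checking on pure tensors only.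
\<close>

lemma tensor_alg_homI:
  assumes A [simp]: "k_algebra K A" and B [simp]: "k_algebra K B" and U [simp]: "k_algebra K U"
    and f: "f \<in> lin K (tensor_alg K A B) U"
    and mult: "\<And>a b a' b'. a \<in> carrier A \<Longrightarrow> b \<in> carrier B \<Longrightarrow> a' \<in> carrier A \<Longrightarrow> b' \<in> carrier B \<Longrightarrow>
      f (tpure K A B (a \<otimes>\<^bsub>A\<^esub> a') (b \<otimes>\<^bsub>B\<^esub> b')) = f (tpure K A B a b) \<otimes>\<^bsub>U\<^esub> f (tpure K A B a' b')"
    and one: "f (tpure K A B \<one>\<^bsub>A\<^esub> \<one>\<^bsub>B\<^esub>) = \<one>\<^bsub>U\<^esub>"
  shows "f \<in> alg_hom K (tensor_alg K A B) U"
proof (rule alg_homI[OF f])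
  note [simp] = lin_rules[OF f]
  show "f \<one>\<^bsub>tensor_alg K A B\<^esub> = \<one>\<^bsub>U\<^esub>"
    using one by (simp add: tensor_alg_one)
  fix X Y assume X: "X \<in> carrier (tensor_alg K A B)" and Y [simp]: "Y \<in> carrier (tensor_alg K A B)"
  show "f (X \<otimes>\<^bsub>tensor_alg K A B\<^esub> Y) = f X \<otimes>\<^bsub>U\<^esub> f Y"
    using X
  proof (induct rule: tensor_induction)
    case (pure a b)
    from Y show ?case
      by (induct rule: tensor_induction)
        (simp_all add: pure mult)
  qed simp_all
qed

lemma tpure_lin_left [simp]: "k_algebra K A \<Longrightarrow> k_algebra K B \<Longrightarrow> b \<in> carrier B \<Longrightarrow>
    (\<lambda>a. tpure K A B a b) \<in> lin K A (tensor_alg K A B)"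
  and tpure_lin_right [simp]: "k_algebra K A \<Longrightarrow> k_algebra K B \<Longrightarrow> a \<in> carrier A \<Longrightarrow>
    tpure K A B a \<in> lin K B (tensor_alg K A B)"
  by (rule linI; simp)+

text \<open>
  The inclusions of the two factors.
\<close>

lemma incl1_alg_hom [simp]: "k_algebra K A \<Longrightarrow> k_algebra K B \<Longrightarrow>
    (\<lambda>a. tpure K A B a \<one>\<^bsub>B\<^esub>) \<in> alg_hom K A (tensor_alg K A B)"
  and incl2_alg_hom [simp]: "k_algebra K A \<Longrightarrow> k_algebra K B \<Longrightarrow>
    tpure K A B \<one>\<^bsub>A\<^esub> \<in> alg_hom K B (tensor_alg K A B)"
  by (rule alg_homI; simp add: tensor_alg_one)+

text \<open>Two algebra homomorphisms on \<open>A \<otimes> B\<close> agree once they agree on \<open>A \<otimes> 1\<close> and on \<open>1 \<otimes> B\<close>.\<close>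

lemma alg_hom_eqI:
  assumes A [simp]: "k_algebra K A" and B [simp]: "k_algebra K B"
    and f: "f \<in> alg_hom K (tensor_alg K A B) U" and g: "g \<in> alg_hom K (tensor_alg K A B) U"
    and eq1: "\<And>a. a \<in> carrier A \<Longrightarrow> f (tpure K A B a \<one>\<^bsub>B\<^esub>) = g (tpure K A B a \<one>\<^bsub>B\<^esub>)"
    and eq2: "\<And>b. b \<in> carrier B \<Longrightarrow> f (tpure K A B \<one>\<^bsub>A\<^esub> b) = g (tpure K A B \<one>\<^bsub>A\<^esub> b)"
    and X: "X \<in> carrier (tensor_alg K A B)"
  shows "f X = g X"
proof (rule lin_eqI[OF A B alg_hom_lin[OF f] alg_hom_lin[OF g] _ X])
  fix a b assume ab: "a \<in> carrier A" "b \<in> carrier B"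
  then have p: "tpure K A B a b = tpure K A B a \<one>\<^bsub>B\<^esub> \<otimes>\<^bsub>tensor_alg K A B\<^esub> tpure K A B \<one>\<^bsub>A\<^esub> b"
    by simp
  show "f (tpure K A B a b) = g (tpure K A B a b)"
    using ab unfolding p by (simp add: alg_hom_mult[OF f] alg_hom_mult[OF g] eq1 eq2 del: tensor_mult_pure)
qed


subsection \<open>Tensor products of maps\<close>

context
  fixes A :: "('k, 'a, 'm) module_scheme" and B :: "('k, 'b, 'n) module_scheme"
    and A' :: "('k, 'c, 'p) module_scheme" and B' :: "('k, 'd, 'q) module_scheme"
  assumes A [simp]: "k_algebra K A" and B [simp]: "k_algebra K B"
    and A' [simp]: "k_algebra K A'" and B' [simp]: "k_algebra K B'"
begin

lemma tensor_map_bilin: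
  assumes "f \<in> lin K A A'" "g \<in> lin K B B'"
  shows "(\<lambda>a b. tpure K A' B' (f a) (g b)) \<in> bilin K A B (tensor_alg K A' B')"
  by (intro bilinI linI) (simp_all add: lin_rules[OF assms(1)] lin_rules[OF assms(2)])

lemmas tensor_map_lift = tensor_lift[OF A B tensor_alg_k_algebra[OF A' B'] tensor_map_bilin,
    folded tensor_map_def]

lemma tensor_map_pure [simp]:
  "f \<in> lin K A A' \<Longrightarrow> g \<in> lin K B B' \<Longrightarrow> a \<in> carrier A \<Longrightarrow> b \<in> carrier B \<Longrightarrow>
    tensor_map K A B A' B' f g (tpure K A B a b) = tpure K A' B' (f a) (g b)"
  by (rule tensor_map_lift)

lemma tensor_map_lin [simp]:
  "f \<in> lin K A A' \<Longrightarrow> g \<in> lin K B B' \<Longrightarrow>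
    tensor_map K A B A' B' f g \<in> lin K (tensor_alg K A B) (tensor_alg K A' B')"
  by (rule tensor_map_lift)

lemmas tensor_map_lin_rules [simp] = lin_rules[OF tensor_map_lin]

lemma tensor_map_alg_hom [simp]:
  assumes f: "f \<in> alg_hom K A A'" and g: "g \<in> alg_hom K B B'"
  shows "tensor_map K A B A' B' f g \<in> alg_hom K (tensor_alg K A B) (tensor_alg K A' B')"
  by (rule tensor_alg_homI)
    (simp_all add: f g tensor_alg_one alg_hom_rules[OF f] alg_hom_rules[OF g])

lemmas tensor_map_alg_rules [simp] = alg_hom_rules(4,5)[OF tensor_map_alg_hom]

end

lemma tensor_map_comp:
  assumes [simp]: "k_algebra K A" "k_algebra K B" "k_algebra K A'" "k_algebra K B'"
    "k_algebra K A''" "k_algebra K B''"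
    and f: "f \<in> lin K A A'" and g: "g \<in> lin K B B'"
    and f': "f' \<in> lin K A' A''" and g': "g' \<in> lin K B' B''"
    and X: "X \<in> carrier (tensor_alg K A B)"
  shows "tensor_map K A' B' A'' B'' f' g' (tensor_map K A B A' B' f g X) =
    tensor_map K A B A'' B'' (\<lambda>x. f' (f x)) (\<lambda>x. g' (g x)) X"
proof -
  note [simp] = f g f' g' lin_comp[OF f f'] lin_comp[OF g g'] lin_closed[OF f] lin_closed[OF g]
  show ?thesis
    using X by (induct rule: tensor_induction) simp_all
qed

lemma tensor_map_cong:
  assumes [simp]: "k_algebra K A" "k_algebra K B" "k_algebra K A'" "k_algebra K B'"
    "f \<in> lin K A A'" "g \<in> lin K B B'" "f' \<in> lin K A A'" "g' \<in> lin K B B'"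
    and [simp]: "\<And>a. a \<in> carrier A \<Longrightarrow> f a = f' a" "\<And>b. b \<in> carrier B \<Longrightarrow> g b = g' b"
    and X: "X \<in> carrier (tensor_alg K A B)"
  shows "tensor_map K A B A' B' f g X = tensor_map K A B A' B' f' g' X"
  using X by (induct rule: tensor_induction) simp_all


subsection \<open>The structural isomorphisms\<close>

context
  fixes A :: "('k, 'a, 'm) module_scheme" and B :: "('k, 'b, 'n) module_scheme"
  assumes A [simp]: "k_algebra K A" and B [simp]: "k_algebra K B"
begin

lemma flip_bilin: "(\<lambda>a b. tpure K B A b a) \<in> bilin K A B (tensor_alg K B A)"
  by (intro bilinI) simp_all

lemmas flip_lift = tensor_lift[OF A B tensor_alg_k_algebra[OF B A] flip_bilin, folded flip_def]

lemma flip_pure [simp]: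
  "a \<in> carrier A \<Longrightarrow> b \<in> carrier B \<Longrightarrow> flip K A B (tpure K A B a b) = tpure K B A b a"
  by (rule flip_lift)

lemma flip_alg_hom [simp]: "flip K A B \<in> alg_hom K (tensor_alg K A B) (tensor_alg K B A)"
  using flip_lift by (intro tensor_alg_homI) (simp_all add: tensor_alg_one)

lemmas flip_rules [simp] = alg_hom_rules[OF flip_alg_hom]

end

lemma flip_flip [simp]:
  assumes [simp]: "k_algebra K A" "k_algebra K B" and X: "X \<in> carrier (tensor_alg K A B)"
  shows "flip K B A (flip K A B X) = X"
  using X by (induct rule: tensor_induction) simp_all

lemma flip_tensor_map:
  assumes [simp]: "k_algebra K A" "k_algebra K B" "k_algebra K A'" "k_algebra K B'"
    and f: "f \<in> lin K A A'" and g: "g \<in> lin K B B'"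
    and X: "X \<in> carrier (tensor_alg K A B)"
  shows "flip K A' B' (tensor_map K A B A' B' f g X) = tensor_map K B A B' A' g f (flip K A B X)"
  using X by (induct rule: tensor_induction)
    (simp_all add: f g lin_closed[OF f] lin_closed[OF g])

context
  fixes A :: "('k, 'a, 'm) module_scheme" and B :: "('k, 'b, 'n) module_scheme"
    and C :: "('k, 'c, 'p) module_scheme"
  assumes A [simp]: "k_algebra K A" and B [simp]: "k_algebra K B" and C [simp]: "k_algebra K C"
begin

lemma assoc_inner_bilin: "c \<in> carrier C \<Longrightarrow>
    (\<lambda>a b. tpure K A (tensor_alg K B C) a (tpure K B C b c))
      \<in> bilin K A B (tensor_alg K A (tensor_alg K B C))"
  by (intro bilinI linI) simp_all

lemma assoc_bilin: "(\<lambda>X c. tensor_lift K A B (tensor_alg K A (tensor_alg K B C))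
      (\<lambda>a b. tpure K A (tensor_alg K B C) a (tpure K B C b c)) X)
    \<in> bilin K (tensor_alg K A B) C (tensor_alg K A (tensor_alg K B C))"
  by (rule tensor_lift_param) (simp_all add: assoc_inner_bilin, intro linI, simp_all)

lemmas assoc_lift = tensor_lift[OF tensor_alg_k_algebra[OF A B] C
    tensor_alg_k_algebra[OF A tensor_alg_k_algebra[OF B C]] assoc_bilin,
    folded tensor_assoc_def[unfolded Let_def]]

lemma tensor_assoc_pure [simp]: "a \<in> carrier A \<Longrightarrow> b \<in> carrier B \<Longrightarrow> c \<in> carrier C \<Longrightarrow>
    tensor_assoc K A B C (tpure K (tensor_alg K A B) C (tpure K A B a b) c) =
    tpure K A (tensor_alg K B C) a (tpure K B C b c)"
  by (simp add: assoc_lift tensor_lift_pure assoc_inner_bilin)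

lemma tensor_assoc_alg_hom [simp]: "tensor_assoc K A B C
    \<in> alg_hom K (tensor_alg K (tensor_alg K A B) C) (tensor_alg K A (tensor_alg K B C))"
proof (rule tensor_alg_homI)
  show lin: "tensor_assoc K A B C
      \<in> lin K (tensor_alg K (tensor_alg K A B) C) (tensor_alg K A (tensor_alg K B C))"
    by (rule assoc_lift)
  note [simp] = lin_rules[OF lin]
  show "tensor_assoc K A B C (tpure K (tensor_alg K A B) C \<one>\<^bsub>tensor_alg K A B\<^esub> \<one>\<^bsub>C\<^esub>) =
      \<one>\<^bsub>tensor_alg K A (tensor_alg K B C)\<^esub>"
    by (simp add: tensor_alg_one)
  fix X c Y d
  assume X: "X \<in> carrier (tensor_alg K A B)" and c [simp]: "c \<in> carrier C"
    and Y [simp]: "Y \<in> carrier (tensor_alg K A B)" and d [simp]: "d \<in> carrier C"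
  show "tensor_assoc K A B C
      (tpure K (tensor_alg K A B) C (X \<otimes>\<^bsub>tensor_alg K A B\<^esub> Y) (c \<otimes>\<^bsub>C\<^esub> d)) =
    tensor_assoc K A B C (tpure K (tensor_alg K A B) C X c) \<otimes>\<^bsub>tensor_alg K A (tensor_alg K B C)\<^esub>
    tensor_assoc K A B C (tpure K (tensor_alg K A B) C Y d)"
    using X
  proof (induct rule: tensor_induction)
    case (pure a b)
    from Y show ?case
      by (induct rule: tensor_induction) (simp_all add: pure)
  qed simp_all
qed simp_all

lemmas tensor_assoc_rules [simp] = alg_hom_rules[OF tensor_assoc_alg_hom]

end

text \<open>The inverse of the associator, obtained from the associator by cyclic rotation.\<close>

definition tensor_unassoc :: "('k, 'a, 'm) module_scheme \<Rightarrow> ('k, 'b, 'n) module_scheme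
    \<Rightarrow> ('k, 'c, 'p) module_scheme \<Rightarrow> ('a, ('b, 'c) tensor) tensor \<Rightarrow> (('a, 'b) tensor, 'c) tensor"
  where "tensor_unassoc A B C X =
    flip K C (tensor_alg K A B) (tensor_assoc K C A B (flip K B (tensor_alg K C A)
      (tensor_assoc K B C A (flip K A (tensor_alg K B C) X))))"

context
  fixes A :: "('k, 'a, 'm) module_scheme" and B :: "('k, 'b, 'n) module_scheme"
    and C :: "('k, 'c, 'p) module_scheme"
  assumes A [simp]: "k_algebra K A" and B [simp]: "k_algebra K B" and C [simp]: "k_algebra K C"
begin

lemma tensor_unassoc_pure [simp]: "a \<in> carrier A \<Longrightarrow> b \<in> carrier B \<Longrightarrow> c \<in> carrier C \<Longrightarrow>
    tensor_unassoc A B C (tpure K A (tensor_alg K B C) a (tpure K B C b c)) =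
    tpure K (tensor_alg K A B) C (tpure K A B a b) c"
  by (simp add: tensor_unassoc_def)

lemma tensor_unassoc_alg_hom [simp]: "tensor_unassoc A B C
    \<in> alg_hom K (tensor_alg K A (tensor_alg K B C)) (tensor_alg K (tensor_alg K A B) C)"
  by (rule alg_homI; (rule linI)?) (simp_all add: tensor_unassoc_def)

lemmas tensor_unassoc_rules [simp] = alg_hom_rules[OF tensor_unassoc_alg_hom]

lemma tensor_unassoc_assoc [simp]:
  assumes X: "X \<in> carrier (tensor_alg K (tensor_alg K A B) C)"
  shows "tensor_unassoc A B C (tensor_assoc K A B C X) = X"
  using X
proof (induct rule: tensor_induction)
  case (pure Y c)
  then show ?case
    by (induct Y rule: tensor_induction) simp_all
qed simp_all

end

lemma tensor_assoc_map:
  assumes [simp]: "k_algebra K A" "k_algebra K B" "k_algebra K C"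
    "k_algebra K A'" "k_algebra K B'" "k_algebra K C'"
    and f: "f \<in> lin K A A'" and g: "g \<in> lin K B B'" and h: "h \<in> lin K C C'"
    and X: "X \<in> carrier (tensor_alg K (tensor_alg K A B) C)"
  shows "tensor_assoc K A' B' C' (tensor_map K (tensor_alg K A B) C (tensor_alg K A' B') C'
      (tensor_map K A B A' B' f g) h X) =
    tensor_map K A (tensor_alg K B C) A' (tensor_alg K B' C') f (tensor_map K B C B' C' g h)
      (tensor_assoc K A B C X)"
proof -
  note [simp] = f g h lin_closed[OF f] lin_closed[OF g] lin_closed[OF h]
  show ?thesis
    using X
  proof (induct rule: tensor_induction)
    case (pure Y c)
    note [simp] = pure(2)
    from pure(1) show ?case
      by (induct Y rule: tensor_induction)
        (simp_all add: lin_add[OF h])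
  qed simp_all
qed

context
  fixes A :: "('k, 'a, 'm) module_scheme" and B :: "('k, 'b, 'n) module_scheme"
    and C :: "('k, 'c, 'p) module_scheme" and D :: "('k, 'd, 'q) module_scheme"
  assumes A [simp]: "k_algebra K A" and B [simp]: "k_algebra K B"
    and C [simp]: "k_algebra K C" and D [simp]: "k_algebra K D"
begin

text \<open>
  The target of the middle flip, and its values on quadruples of elements.
\<close>

abbreviation (input) "mfU \<equiv> tensor_alg K (tensor_alg K A C) (tensor_alg K B D)"
abbreviation (input) "mfp \<equiv> \<lambda>a b c d. tpure K (tensor_alg K A C) (tensor_alg K B D)
  (tpure K A C a c) (tpure K B D b d)"

lemma mf_inner_bilin: "a \<in> carrier A \<Longrightarrow> b \<in> carrier B \<Longrightarrow> (\<lambda>c d. mfp a b c d) \<in> bilin K C D mfU"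
  by (intro bilinI linI) simp_all

lemma mf_middle_bilin:
  assumes Y: "Y \<in> carrier (tensor_alg K C D)"
  shows "(\<lambda>a b. tensor_lift K C D mfU (\<lambda>c d. mfp a b c d) Y) \<in> bilin K A B mfU"
proof (rule bilinI)
  fix a assume a: "a \<in> carrier A"
  have "(\<lambda>Y b. tensor_lift K C D mfU (\<lambda>c d. mfp a b c d) Y) \<in> bilin K (tensor_alg K C D) B mfU"
    by (rule tensor_lift_param) (simp_all add: mf_inner_bilin a, intro linI, simp_all add: a)
  then show "(\<lambda>b. tensor_lift K C D mfU (\<lambda>c d. mfp a b c d) Y) \<in> lin K B mfU"
    using Y by (rule bilin_right)
next
  fix b assume b: "b \<in> carrier B"
  have "(\<lambda>Y a. tensor_lift K C D mfU (\<lambda>c d. mfp a b c d) Y) \<in> bilin K (tensor_alg K C D) A mfU"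
    by (rule tensor_lift_param) (simp_all add: mf_inner_bilin b, intro linI, simp_all add: b)
  then show "(\<lambda>a. tensor_lift K C D mfU (\<lambda>c d. mfp a b c d) Y) \<in> lin K A mfU"
    using Y by (rule bilin_right)
qed

lemma mf_bilin: "(\<lambda>X Y. tensor_lift K A B mfU (\<lambda>a b. tensor_lift K C D mfU (\<lambda>c d. mfp a b c d) Y) X)
    \<in> bilin K (tensor_alg K A B) (tensor_alg K C D) mfU"
  by (rule tensor_lift_param) (simp_all add: mf_middle_bilin tensor_lift_lin mf_inner_bilin)

lemmas mf_lift = tensor_lift[OF tensor_alg_k_algebra[OF A B] tensor_alg_k_algebra[OF C D]
    tensor_alg_k_algebra[OF tensor_alg_k_algebra[OF A C] tensor_alg_k_algebra[OF B D]] mf_bilin,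
    folded middle_flip_def[unfolded Let_def]]

lemma middle_flip_pure [simp]:
  "a \<in> carrier A \<Longrightarrow> b \<in> carrier B \<Longrightarrow> c \<in> carrier C \<Longrightarrow> d \<in> carrier D \<Longrightarrow>
    middle_flip K A B C D
      (tpure K (tensor_alg K A B) (tensor_alg K C D) (tpure K A B a b) (tpure K C D c d)) =
    tpure K (tensor_alg K A C) (tensor_alg K B D) (tpure K A C a c) (tpure K B D b d)"
  by (simp add: mf_lift tensor_lift_pure mf_inner_bilin mf_middle_bilin)

lemma middle_flip_alg_hom [simp]: "middle_flip K A B C D
    \<in> alg_hom K (tensor_alg K (tensor_alg K A B) (tensor_alg K C D))
        (tensor_alg K (tensor_alg K A C) (tensor_alg K B D))"
proof (rule tensor_alg_homI)
  show lin: "middle_flip K A B C D \<in> lin K (tensor_alg K (tensor_alg K A B) (tensor_alg K C D)) mfU"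
    by (rule mf_lift)
  note [simp] = lin_rules[OF lin]
  show "middle_flip K A B C D (tpure K (tensor_alg K A B) (tensor_alg K C D)
      \<one>\<^bsub>tensor_alg K A B\<^esub> \<one>\<^bsub>tensor_alg K C D\<^esub>) = \<one>\<^bsub>mfU\<^esub>"
    by (simp add: tensor_alg_one)
  fix X Y X' Y'
  assume X: "X \<in> carrier (tensor_alg K A B)" and Y [simp]: "Y \<in> carrier (tensor_alg K C D)"
    and X' [simp]: "X' \<in> carrier (tensor_alg K A B)" and Y' [simp]: "Y' \<in> carrier (tensor_alg K C D)"
  show "middle_flip K A B C D (tpure K (tensor_alg K A B) (tensor_alg K C D)
      (X \<otimes>\<^bsub>tensor_alg K A B\<^esub> X') (Y \<otimes>\<^bsub>tensor_alg K C D\<^esub> Y')) =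
    middle_flip K A B C D (tpure K (tensor_alg K A B) (tensor_alg K C D) X Y) \<otimes>\<^bsub>mfU\<^esub>
    middle_flip K A B C D (tpure K (tensor_alg K A B) (tensor_alg K C D) X' Y')"
    using X
  proof (induct rule: tensor_induction)
    case ab: (pure a b)
    from X' show ?case
    proof (induct rule: tensor_induction)
      case ab': (pure a' b')
      from Y show ?case
      proof (induct rule: tensor_induction)
        case cd: (pure c d)
        from Y' show ?case
          by (induct rule: tensor_induction)
            (simp_all add: ab ab' cd)
      qed (simp_all add: ab ab')
    qed (simp_all add: ab)
  qed simp_all
qed simp_all

lemmas middle_flip_rules [simp] = alg_hom_rules[OF middle_flip_alg_hom]

end

subsection \<open>Linear forms\<close>

lemma base_alg_sel [simp]:
  "carrier (base_alg K) = carrier K" "(\<otimes>\<^bsub>base_alg K\<^esub>) = (\<otimes>\<^bsub>K\<^esub>)" "\<one>\<^bsub>base_alg K\<^esub> = \<one>\<^bsub>K\<^esub>"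
  "(\<oplus>\<^bsub>base_alg K\<^esub>) = (\<oplus>\<^bsub>K\<^esub>)" "\<zero>\<^bsub>base_alg K\<^esub> = \<zero>\<^bsub>K\<^esub>" "(\<odot>\<^bsub>base_alg K\<^esub>) = (\<otimes>\<^bsub>K\<^esub>)"
  by (simp_all add: base_alg_def)

lemma base_alg_k_algebra [simp]: "k_algebra K (base_alg K)"
proof (rule k_algebraI)
  show "abelian_group (base_alg K)"
    by (rule abelian_groupI) (auto simp: K.a_ac intro: K.add.l_inv_ex)
qed (simp_all add: K.m_ac K.l_distr K.r_distr)

context
  fixes A :: "('k, 'a, 'm) module_scheme" and B :: "('k, 'b, 'n) module_scheme"
  assumes A [simp]: "k_algebra K A" and B [simp]: "k_algebra K B"
begin

lemma form_left_bilin: "e \<in> lin K A (base_alg K) \<Longrightarrow> (\<lambda>a b. e a \<odot>\<^bsub>B\<^esub> b) \<in> bilin K A B B"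
  using lin_rules[of e K A "base_alg K"]
  by (intro bilinI linI) (simp_all add: alg_smult_swap[OF B])

lemma form_right_bilin: "e \<in> lin K B (base_alg K) \<Longrightarrow> (\<lambda>a b. e b \<odot>\<^bsub>A\<^esub> a) \<in> bilin K A B A"
  using lin_rules[of e K B "base_alg K"]
  by (intro bilinI linI) (simp_all add: alg_smult_swap[OF A])

lemmas form_left_lift = tensor_lift[OF A B B form_left_bilin, folded form_left_def]
lemmas form_right_lift = tensor_lift[OF A B A form_right_bilin, folded form_right_def]

lemma form_left_pure [simp]: "e \<in> lin K A (base_alg K) \<Longrightarrow> a \<in> carrier A \<Longrightarrow> b \<in> carrier B \<Longrightarrow>
    form_left K A B e (tpure K A B a b) = e a \<odot>\<^bsub>B\<^esub> b"
  by (rule form_left_lift)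

lemma form_right_pure [simp]: "e \<in> lin K B (base_alg K) \<Longrightarrow> a \<in> carrier A \<Longrightarrow> b \<in> carrier B \<Longrightarrow>
    form_right K A B e (tpure K A B a b) = e b \<odot>\<^bsub>A\<^esub> a"
  by (rule form_right_lift)

lemma form_left_alg_hom [simp]:
  assumes e: "e \<in> alg_hom K A (base_alg K)"
  shows "form_left K A B e \<in> alg_hom K (tensor_alg K A B) B"
  using form_left_lift(1)[OF alg_hom_lin[OF e]] alg_hom_rules[OF e]
  by (intro tensor_alg_homI) (simp_all add: e alg_smult_swap[OF B])

lemma form_right_alg_hom [simp]:
  assumes e: "e \<in> alg_hom K B (base_alg K)"
  shows "form_right K A B e \<in> alg_hom K (tensor_alg K A B) A"
  using form_right_lift(1)[OF alg_hom_lin[OF e]] alg_hom_rules[OF e]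
  by (intro tensor_alg_homI) (simp_all add: e alg_smult_swap[OF A])

lemmas form_left_rules [simp] = alg_hom_rules[OF form_left_alg_hom]
lemmas form_right_rules [simp] = alg_hom_rules[OF form_right_alg_hom]

end

end

section \<open>Bialgebras\<close>

text \<open>
  All constructions on algebras only depend on the fields inherited from modules. Agreement of two
  records in these fields relates \<open>tensor_bialg K A B\<close> to the algebra
  \<open>tensor_alg K A B\<close> and a bialgebra to the one with another comultiplication.
\<close>

definition same_alg :: "('k, 'a, 'm) module_scheme \<Rightarrow> ('k, 'a, 'n) module_scheme \<Rightarrow> bool"
  where "same_alg A A' \<longleftrightarrow> carrier A = carrier A' \<and> monoid.mult A = monoid.mult A' \<and> \<one>\<^bsub>A\<^esub> = \<one>\<^bsub>A'\<^esub> \<and>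
    \<zero>\<^bsub>A\<^esub> = \<zero>\<^bsub>A'\<^esub> \<and> add A = add A' \<and> smult A = smult A'"

lemma same_alg_refl: "same_alg A A"
  by (simp add: same_alg_def)

lemma tpure_same: "same_alg A A' \<Longrightarrow> same_alg B B' \<Longrightarrow> tpure K A B = tpure K A' B'"
  and tensor_alg_same: "same_alg A A' \<Longrightarrow> same_alg B B' \<Longrightarrow> tensor_alg K A B = tensor_alg K A' B'"
  by (simp_all add: same_alg_def tensor_alg_def tpure_def tensor_null_def tensor_relators_def
      tensor_group_def balanced_lift_def fun_eq_iff)

lemma tensor_lift_same:
  "same_alg A A' \<Longrightarrow> same_alg B B' \<Longrightarrow> tensor_lift K A B U = tensor_lift K A' B' U"
  by (simp add: same_alg_def tensor_lift_def tpure_def tensor_null_def tensor_relators_def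
      tensor_group_def balanced_lift_def fun_eq_iff)

lemma tensor_map_same:
  "same_alg A A' \<Longrightarrow> same_alg B B' \<Longrightarrow> same_alg C C' \<Longrightarrow> same_alg D D' \<Longrightarrow>
    tensor_map K A B C D = tensor_map K A' B' C' D'"
  by (simp add: tensor_map_def tensor_lift_same tpure_same[of C C' D D'] tensor_alg_same[of C C' D D']
      fun_eq_iff)

lemma flip_same: "same_alg A A' \<Longrightarrow> same_alg B B' \<Longrightarrow> flip K A B = flip K A' B'"
  by (simp add: flip_def tensor_lift_same tpure_same[of B B' A A'] tensor_alg_same[of B B' A A']
      fun_eq_iff)

lemma alg_hom_same: "same_alg A A' \<Longrightarrow> same_alg B B' \<Longrightarrow> alg_hom K A B = alg_hom K A' B'"
  by (simp add: alg_hom_def ring_hom_def same_alg_def)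

lemma same_alg_update: "same_alg (H\<lparr>comult := d\<rparr>) H"
  by (simp add: same_alg_def)

lemma same_alg_tensor_bialg: "same_alg (tensor_bialg K A B) (tensor_alg K A B)"
  by (simp add: same_alg_def tensor_bialg_def module.defs bialg.defs)

context scalars
begin

text \<open>
  The maps \<open>f \<otimes> f\<close> and \<open>f \<otimes> (f \<otimes> f)\<close>.
\<close>

abbreviation sq_map :: "('k, 'a, 'm) module_scheme \<Rightarrow> ('k, 'b, 'n) module_scheme
    \<Rightarrow> ('a \<Rightarrow> 'b) \<Rightarrow> ('a, 'a) tensor \<Rightarrow> ('b, 'b) tensor"
  where "sq_map A B f \<equiv> tensor_map K A A B B f f"

abbreviation cube_map :: "('k, 'a, 'm) module_scheme \<Rightarrow> ('k, 'b, 'n) module_scheme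
    \<Rightarrow> ('a \<Rightarrow> 'b) \<Rightarrow> ('a, ('a, 'a) tensor) tensor \<Rightarrow> ('b, ('b, 'b) tensor) tensor"
  where "cube_map A B f \<equiv> tensor_map K A (tsquare K A) B (tsquare K B) f (sq_map A B f)"

text \<open>
  \<open>\<Delta> \<otimes> Id\<close>, rebracketed to take values in \<open>H \<otimes> (H \<otimes> H)\<close>.
\<close>

abbreviation comult_left3 :: "('k, 'a, 'm) bialg_scheme \<Rightarrow> ('a, 'a) tensor \<Rightarrow> ('a, ('a, 'a) tensor) tensor"
  where "comult_left3 H X \<equiv> tensor_assoc K H H H (comult_left K H X)"

subsection \<open>Units and commuting elements\<close>

text \<open>
  The interchange law when \<open>b\<close> commutes past \<open>c\<close> up to replacing \<open>c\<close> by \<open>c'\<close>.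
\<close>

lemma alg_interchange:
  assumes N: "k_algebra K N" and "a \<in> carrier N" "b \<in> carrier N" "c \<in> carrier N" "c' \<in> carrier N"
      "d \<in> carrier N"
    and bc: "b \<otimes>\<^bsub>N\<^esub> c = c' \<otimes>\<^bsub>N\<^esub> b"
  shows "(a \<otimes>\<^bsub>N\<^esub> b) \<otimes>\<^bsub>N\<^esub> (c \<otimes>\<^bsub>N\<^esub> d) = (a \<otimes>\<^bsub>N\<^esub> c') \<otimes>\<^bsub>N\<^esub> (b \<otimes>\<^bsub>N\<^esub> d)"
proof -
  interpret ring N using N by (rule k_algebra_ring)
  have "(a \<otimes>\<^bsub>N\<^esub> b) \<otimes>\<^bsub>N\<^esub> (c \<otimes>\<^bsub>N\<^esub> d) = a \<otimes>\<^bsub>N\<^esub> (b \<otimes>\<^bsub>N\<^esub> c) \<otimes>\<^bsub>N\<^esub> d"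
    using assms(2-6) by (simp add: m_assoc)
  also have "\<dots> = (a \<otimes>\<^bsub>N\<^esub> c') \<otimes>\<^bsub>N\<^esub> (b \<otimes>\<^bsub>N\<^esub> d)"
    unfolding bc using assms(2-6) by (simp add: m_assoc)
  finally show ?thesis .
qed

lemma alg_monoid: "k_algebra K A \<Longrightarrow> monoid A"
  by (intro ring.is_monoid k_algebra_ring)

text \<open>
  Conjugation by a unit in a form without inverses.
\<close>

lemma alg_conj_iff:
  assumes N: "k_algebra K N" and U: "U \<in> Units N" and "x \<in> carrier N" "y \<in> carrier N"
  shows "y = U \<otimes>\<^bsub>N\<^esub> x \<otimes>\<^bsub>N\<^esub> inv\<^bsub>N\<^esub> U \<longleftrightarrow> y \<otimes>\<^bsub>N\<^esub> U = U \<otimes>\<^bsub>N\<^esub> x"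
proof -
  interpret monoid N using N by (rule alg_monoid)
  have "(y \<otimes>\<^bsub>N\<^esub> U) \<otimes>\<^bsub>N\<^esub> inv\<^bsub>N\<^esub> U = y" "(U \<otimes>\<^bsub>N\<^esub> x \<otimes>\<^bsub>N\<^esub> inv\<^bsub>N\<^esub> U) \<otimes>\<^bsub>N\<^esub> U = U \<otimes>\<^bsub>N\<^esub> x"
    using assms Units_closed[OF U] by (simp_all add: m_assoc)
  then show ?thesis
    by auto
qed

lemma alg_inv_mult:
  assumes N: "k_algebra K N" and U: "U \<in> Units N" and V: "V \<in> Units N"
  shows "inv\<^bsub>N\<^esub> (U \<otimes>\<^bsub>N\<^esub> V) = inv\<^bsub>N\<^esub> V \<otimes>\<^bsub>N\<^esub> inv\<^bsub>N\<^esub> U"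
proof -
  interpret monoid N using N by (rule alg_monoid)
  note [simp] = U V Units_closed[OF U] Units_closed[OF V]
  have "V \<otimes>\<^bsub>N\<^esub> (inv\<^bsub>N\<^esub> V \<otimes>\<^bsub>N\<^esub> inv\<^bsub>N\<^esub> U) = inv\<^bsub>N\<^esub> U" "inv\<^bsub>N\<^esub> U \<otimes>\<^bsub>N\<^esub> (U \<otimes>\<^bsub>N\<^esub> V) = V"
    by (simp_all flip: m_assoc)
  then show ?thesis
    by (intro inv_char) (simp_all add: m_assoc)
qed

lemma alg_hom_Units:
  assumes A: "k_algebra K A" and B: "k_algebra K B" and f: "f \<in> alg_hom K A B" and U: "U \<in> Units A"
  shows "f U \<in> Units B" and "f (inv\<^bsub>A\<^esub> U) = inv\<^bsub>B\<^esub> f U"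
proof -
  interpret A: monoid A using A by (rule alg_monoid)
  interpret B: monoid B using B by (rule alg_monoid)
  note [simp] = lin_closed[OF alg_hom_lin[OF f]]
  have *: "f U \<otimes>\<^bsub>B\<^esub> f (inv\<^bsub>A\<^esub> U) = \<one>\<^bsub>B\<^esub>" "f (inv\<^bsub>A\<^esub> U) \<otimes>\<^bsub>B\<^esub> f U = \<one>\<^bsub>B\<^esub>"
    using U A.Units_closed[OF U] by (simp_all add: alg_hom_one[OF f] flip: alg_hom_mult[OF f])
  then show "f U \<in> Units B"
    using U unfolding Units_def[of B] by auto
  show "f (inv\<^bsub>A\<^esub> U) = inv\<^bsub>B\<^esub> f U"
    using * U by (intro B.inv_char[symmetric]) auto
qed

text \<open>Two maps with commuting images; the notion passes to tensor products of maps.\<close>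

definition commuting :: "('k, 'a, 'm) module_scheme \<Rightarrow> ('k, 'b, 'n) module_scheme
    \<Rightarrow> ('k, 'c, 'p) module_scheme \<Rightarrow> ('a \<Rightarrow> 'c) \<Rightarrow> ('b \<Rightarrow> 'c) \<Rightarrow> bool"
  where "commuting A B M f g \<longleftrightarrow>
    (\<forall>a\<in>carrier A. \<forall>b\<in>carrier B. f a \<otimes>\<^bsub>M\<^esub> g b = g b \<otimes>\<^bsub>M\<^esub> f a)"

lemma commuting_tensor_map:
  assumes [simp]: "k_algebra K A" "k_algebra K B" "k_algebra K M"
    "k_algebra K A'" "k_algebra K B'" "k_algebra K M'"
    and [simp]: "f \<in> lin K A M" "g \<in> lin K B M" "f' \<in> lin K A' M'" "g' \<in> lin K B' M'"
    and c: "commuting A B M f g" and c': "commuting A' B' M' f' g'"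
  shows "commuting (tensor_alg K A A') (tensor_alg K B B') (tensor_alg K M M')
    (tensor_map K A A' M M' f f') (tensor_map K B B' M M' g g')"
  unfolding commuting_def
proof (intro ballI)
  fix X Y assume X: "X \<in> carrier (tensor_alg K A A')" and Y [simp]: "Y \<in> carrier (tensor_alg K B B')"
  note [simp] = lin_closed[OF assms(7)] lin_closed[OF assms(8)] lin_closed[OF assms(9)] lin_closed[OF assms(10)]
  show "tensor_map K A A' M M' f f' X \<otimes>\<^bsub>tensor_alg K M M'\<^esub> tensor_map K B B' M M' g g' Y =
      tensor_map K B B' M M' g g' Y \<otimes>\<^bsub>tensor_alg K M M'\<^esub> tensor_map K A A' M M' f f' X"
    using X
  proof (induct X rule: tensor_induction)
    case (pure a a')
    from Y pure show ?case
      using c c'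
      by (induct Y rule: tensor_induction)
        (simp_all add: commuting_def)
  qed simp_all
qed

subsection \<open>Bialgebras and their homomorphisms\<close>

text \<open>
  A bialgebra without coassociativity and counit laws. The naturality statements below hold at this
  generality, and they serve to prove those laws for a tensor product of bialgebras.
\<close>

definition pre_bialgebra :: "('k, 'a, 'm) bialg_scheme \<Rightarrow> bool"
  where "pre_bialgebra H \<longleftrightarrow> k_algebra K H \<and> comult H \<in> alg_hom K H (tsquare K H) \<and>
    counit H \<in> alg_hom K H (base_alg K)"

lemma bialgebra_pre [simp]: "bialgebra K H \<Longrightarrow> pre_bialgebra H"
  by (simp add: bialgebra_def pre_bialgebra_def)

lemma bialg_k_algebra [simp]: "pre_bialgebra H \<Longrightarrow> k_algebra K H"
  and comult_alg_hom [simp]: "pre_bialgebra H \<Longrightarrow> comult H \<in> alg_hom K H (tsquare K H)"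
  and counit_alg_hom [simp]: "pre_bialgebra H \<Longrightarrow> counit H \<in> alg_hom K H (base_alg K)"
  by (simp_all add: pre_bialgebra_def)

lemma coassoc: "bialgebra K H \<Longrightarrow> x \<in> carrier H \<Longrightarrow>
    comult_left3 H (comult H x) = comult_right K H (comult H x)"
  and counit_left [simp]: "bialgebra K H \<Longrightarrow> x \<in> carrier H \<Longrightarrow>
    form_left K H H (counit H) (comult H x) = x"
  and counit_right [simp]: "bialgebra K H \<Longrightarrow> x \<in> carrier H \<Longrightarrow>
    form_right K H H (counit H) (comult H x) = x"
  unfolding bialgebra_def by blast+

lemmas comult_rules [simp] = alg_hom_rules[OF comult_alg_hom]
lemmas counit_rules [simp] = alg_hom_rules[OF counit_alg_hom, simplified]

lemma comult_left_alg_hom [simp]: "pre_bialgebra H \<Longrightarrow>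
    comult_left K H \<in> alg_hom K (tsquare K H) (tensor_alg K (tsquare K H) H)"
  and comult_right_alg_hom [simp]: "pre_bialgebra H \<Longrightarrow>
    comult_right K H \<in> alg_hom K (tsquare K H) (tcube K H)"
  by (simp_all add: comult_left_def comult_right_def)

lemmas comult_left_rules [simp] = alg_hom_rules[OF comult_left_alg_hom]
lemmas comult_right_rules [simp] = alg_hom_rules[OF comult_right_alg_hom]

lemma comult_left_pure [simp]: "pre_bialgebra H \<Longrightarrow> x \<in> carrier H \<Longrightarrow> y \<in> carrier H \<Longrightarrow>
    comult_left K H (tpure K H H x y) = tpure K (tsquare K H) H (comult H x) y"
  and comult_right_pure [simp]: "pre_bialgebra H \<Longrightarrow> x \<in> carrier H \<Longrightarrow> y \<in> carrier H \<Longrightarrow>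
    comult_right K H (tpure K H H x y) = tpure K H (tsquare K H) x (comult H y)"
  by (simp_all add: comult_left_def comult_right_def)

lemma comult_left3_alg_hom: "pre_bialgebra H \<Longrightarrow> comult_left3 H \<in> alg_hom K (tsquare K H) (tcube K H)"
  by (rule alg_hom_comp[OF comult_left_alg_hom tensor_assoc_alg_hom]) simp_all

lemma leg_alg_hom [simp]:
  assumes "k_algebra K H"
  shows "leg12 K H \<in> alg_hom K (tsquare K H) (tcube K H)"
    and "leg13 K H \<in> alg_hom K (tsquare K H) (tcube K H)"
    and "leg23 K H \<in> alg_hom K (tsquare K H) (tcube K H)"
proof -
  note [simp] = assms
  have "leg12 K H = tensor_map K H H H (tsquare K H) (\<lambda>x. x) (\<lambda>y. tpure K H H y \<one>\<^bsub>H\<^esub>)"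
    "leg13 K H = tensor_map K H H H (tsquare K H) (\<lambda>x. x) (\<lambda>y. tpure K H H \<one>\<^bsub>H\<^esub> y)"
    by (simp_all add: leg12_def leg13_def tensor_map_def)
  then show "leg12 K H \<in> alg_hom K (tsquare K H) (tcube K H)"
    "leg13 K H \<in> alg_hom K (tsquare K H) (tcube K H)"
    by simp_all
  have "leg23 K H = tpure K H (tsquare K H) \<one>\<^bsub>H\<^esub>"
    by (simp add: leg23_def fun_eq_iff)
  then show "leg23 K H \<in> alg_hom K (tsquare K H) (tcube K H)"
    by simp
qed

lemmas leg_rules [simp] = alg_hom_rules[OF leg_alg_hom(1)] alg_hom_rules[OF leg_alg_hom(2)]
  alg_hom_rules[OF leg_alg_hom(3)]

lemma leg_pure [simp]:
  assumes "k_algebra K H" and "x \<in> carrier H" "y \<in> carrier H"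
  shows "leg12 K H (tpure K H H x y) = tpure K H (tsquare K H) x (tpure K H H y \<one>\<^bsub>H\<^esub>)"
    and "leg13 K H (tpure K H H x y) = tpure K H (tsquare K H) x (tpure K H H \<one>\<^bsub>H\<^esub> y)"
    and "leg23 K H (tpure K H H x y) = tpure K H (tsquare K H) \<one>\<^bsub>H\<^esub> (tpure K H H x y)"
proof -
  have "leg12 K H = tensor_map K H H H (tsquare K H) (\<lambda>x. x) (\<lambda>y. tpure K H H y \<one>\<^bsub>H\<^esub>)"
    "leg13 K H = tensor_map K H H H (tsquare K H) (\<lambda>x. x) (\<lambda>y. tpure K H H \<one>\<^bsub>H\<^esub> y)"
    by (simp_all add: leg12_def leg13_def tensor_map_def)
  with assms show "leg12 K H (tpure K H H x y) = tpure K H (tsquare K H) x (tpure K H H y \<one>\<^bsub>H\<^esub>)"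
    "leg13 K H (tpure K H H x y) = tpure K H (tsquare K H) x (tpure K H H \<one>\<^bsub>H\<^esub> y)"
    by simp_all
qed (simp add: leg23_def)

text \<open>
  Up to rebracketing, \<open>X \<otimes> 1\<close> is the tensor \<open>X\<close> in legs 1 and 2.
\<close>

lemma leg12_assoc:
  assumes [simp]: "k_algebra K H" and X: "X \<in> carrier (tsquare K H)"
  shows "tensor_assoc K H H H (tpure K (tsquare K H) H X \<one>\<^bsub>H\<^esub>) = leg12 K H X"
  using X by (induct rule: tensor_induction) simp_all

lemma leg_map:
  assumes [simp]: "k_algebra K A" "k_algebra K M" and f [simp]: "f \<in> alg_hom K A M"
    and X: "X \<in> carrier (tsquare K A)"
  shows "leg12 K M (sq_map A M f X) = cube_map A M f (leg12 K A X)"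
    and "leg13 K M (sq_map A M f X) = cube_map A M f (leg13 K A X)"
    and "leg23 K M (sq_map A M f X) = cube_map A M f (leg23 K A X)"
  using X
  by (induct rule: tensor_induction)
    (simp_all add: alg_hom_rules[OF f])

lemma bialg_homD:
  assumes "f \<in> bialg_hom K H M"
  shows bialg_hom_alg_hom: "f \<in> alg_hom K H M"
    and bialg_hom_comult: "x \<in> carrier H \<Longrightarrow> comult M (f x) = sq_map H M f (comult H x)"
    and bialg_hom_counit: "x \<in> carrier H \<Longrightarrow> counit M (f x) = counit H x"
  using assms by (simp_all add: bialg_hom_def)

lemma bialg_homI:
  assumes "f \<in> alg_hom K H M"
    and "\<And>x. x \<in> carrier H \<Longrightarrow> comult M (f x) = sq_map H M f (comult H x)"
    and "\<And>x. x \<in> carrier H \<Longrightarrow> counit M (f x) = counit H x"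
  shows "f \<in> bialg_hom K H M"
  using assms by (simp add: bialg_hom_def)

lemma comult_tensor_map:
  assumes H [simp]: "pre_bialgebra H" and [simp]: "pre_bialgebra M"
    and f: "f \<in> bialg_hom K H M" and g: "g \<in> bialg_hom K H M" and X: "X \<in> carrier (tsquare K H)"
  shows "comult_left3 M (tensor_map K H H M M f g X) =
      tensor_map K H (tsquare K H) M (tsquare K M) f (tensor_map K H H M M f g) (comult_left3 H X)"
    and "comult_right K M (tensor_map K H H M M f g X) =
      tensor_map K H (tsquare K H) M (tsquare K M) f (sq_map H M g) (comult_right K H X)"
proof -
  note [simp] = bialg_hom_alg_hom[OF f] alg_hom_rules[OF bialg_hom_alg_hom[OF f]] bialg_hom_comult[OF f]
    bialg_hom_alg_hom[OF g] alg_hom_rules[OF bialg_hom_alg_hom[OF g]] bialg_hom_comult[OF g]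
  have "comult_left K M (tensor_map K H H M M f g X) =
      tensor_map K (tsquare K H) H (tsquare K M) M (sq_map H M f) g (comult_left K H X)"
    using X by (induct rule: tensor_induction) simp_all
  then show "comult_left3 M (tensor_map K H H M M f g X) =
      tensor_map K H (tsquare K H) M (tsquare K M) f (tensor_map K H H M M f g) (comult_left3 H X)"
    using X by (simp add: tensor_assoc_map)
  show "comult_right K M (tensor_map K H H M M f g X) =
      tensor_map K H (tsquare K H) M (tsquare K M) f (sq_map H M g) (comult_right K H X)"
    using X by (induct rule: tensor_induction) simp_all
qed

lemmas comult_cube_map = comult_tensor_map[where f = f and g = f for f]

lemma form_tensor_map:
  assumes [simp]: "pre_bialgebra H" "pre_bialgebra M" "pre_bialgebra N"
    and f [simp]: "f \<in> alg_hom K H M" and g [simp]: "g \<in> alg_hom K H N"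
    and X: "X \<in> carrier (tsquare K H)"
  shows "(\<And>x. x \<in> carrier H \<Longrightarrow> counit M (f x) = counit H x) \<Longrightarrow>
      form_left K M N (counit M) (tensor_map K H H M N f g X) = g (form_left K H H (counit H) X)"
    and "(\<And>x. x \<in> carrier H \<Longrightarrow> counit N (g x) = counit H x) \<Longrightarrow>
      form_right K M N (counit N) (tensor_map K H H M N f g X) = f (form_right K H H (counit H) X)"
  using X by (induct rule: tensor_induction)
    (simp_all add: alg_hom_rules[OF f] alg_hom_rules[OF g])

lemma form_sq_map:
  assumes "pre_bialgebra H" "pre_bialgebra M" "f \<in> alg_hom K H M"
    and "\<And>x. x \<in> carrier H \<Longrightarrow> counit M (f x) = counit H x"
    and "X \<in> carrier (tsquare K H)"
  shows "form_left K M M (counit M) (sq_map H M f X) = f (form_left K H H (counit H) X)"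
    and "form_right K M M (counit M) (sq_map H M f X) = f (form_right K H H (counit H) X)"
  by (rule form_tensor_map; fact assms)+

subsection \<open>Twists, triangular structures and twisted morphisms\<close>

text \<open>
  The cocycle condition in leg notation, with both sides in \<open>H \<otimes> (H \<otimes> H)\<close>.
\<close>

lemma twist_iff:
  assumes [simp]: "bialgebra K H"
  shows "twist K H F \<longleftrightarrow> F \<in> Units (tsquare K H) \<and>
    leg12 K H F \<otimes>\<^bsub>tcube K H\<^esub> comult_left3 H F = leg23 K H F \<otimes>\<^bsub>tcube K H\<^esub> comult_right K H F \<and>
    form_left K H H (counit H) F = \<one>\<^bsub>H\<^esub> \<and> form_right K H H (counit H) F = \<one>\<^bsub>H\<^esub>"
proof -
  have "F \<in> carrier (tsquare K H)" if "F \<in> Units (tsquare K H)"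
    using that by (rule monoid.Units_closed[OF alg_monoid, rotated]) simp
  then have "F \<in> Units (tsquare K H) \<Longrightarrow>
    tensor_assoc K H H H
      (tpure K (tsquare K H) H F \<one>\<^bsub>H\<^esub> \<otimes>\<^bsub>tensor_alg K (tsquare K H) H\<^esub> comult_left K H F) =
    leg12 K H F \<otimes>\<^bsub>tcube K H\<^esub> comult_left3 H F"
    by (simp add: leg12_assoc)
  then show ?thesis
    unfolding twist_def leg23_def by (simp only: cong: conj_cong)
qed

text \<open>
  Invertibility of \<open>R\<close> together with \<open>R\<^sup>-\<^sup>1 = R\<^sup>o\<^sup>p\<close> amounts to \<open>R R\<^sup>o\<^sup>p = 1\<close>: flipping this equation
  yields \<open>R\<^sup>o\<^sup>p R = 1\<close>.
\<close>

lemma triangular_iff: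
  "triangular K (H, R) \<longleftrightarrow> bialgebra K H \<and> R \<in> carrier (tsquare K H) \<and>
    R \<otimes>\<^bsub>tsquare K H\<^esub> flip K H H R = \<one>\<^bsub>tsquare K H\<^esub> \<and>
    (\<forall>x\<in>carrier H. flip K H H (comult H x) \<otimes>\<^bsub>tsquare K H\<^esub> R = R \<otimes>\<^bsub>tsquare K H\<^esub> comult H x) \<and>
    comult_right K H R = leg13 K H R \<otimes>\<^bsub>tcube K H\<^esub> leg12 K H R \<and>
    comult_left3 H R = leg13 K H R \<otimes>\<^bsub>tcube K H\<^esub> leg23 K H R"
proof (cases "bialgebra K H")
  case True
  note [simp] = this
  interpret T: monoid "tsquare K H" by (rule alg_monoid) simp
  have u: "R \<in> Units (tsquare K H) \<and> inv\<^bsub>tsquare K H\<^esub> R = flip K H H R \<longleftrightarrow>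
      R \<in> carrier (tsquare K H) \<and> R \<otimes>\<^bsub>tsquare K H\<^esub> flip K H H R = \<one>\<^bsub>tsquare K H\<^esub>"
  proof (intro iffI conjI; elim conjE)
    assume R: "R \<in> Units (tsquare K H)" "inv\<^bsub>tsquare K H\<^esub> R = flip K H H R"
    then show "R \<in> carrier (tsquare K H)" "R \<otimes>\<^bsub>tsquare K H\<^esub> flip K H H R = \<one>\<^bsub>tsquare K H\<^esub>"
      using T.Units_r_inv[OF R(1)] T.Units_closed[OF R(1)] by simp_all
  next
    assume R: "R \<in> carrier (tsquare K H)" "R \<otimes>\<^bsub>tsquare K H\<^esub> flip K H H R = \<one>\<^bsub>tsquare K H\<^esub>"
    have "flip K H H (R \<otimes>\<^bsub>tsquare K H\<^esub> flip K H H R) = \<one>\<^bsub>tsquare K H\<^esub>"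
      unfolding R(2) by simp
    then have l: "flip K H H R \<otimes>\<^bsub>tsquare K H\<^esub> R = \<one>\<^bsub>tsquare K H\<^esub>"
      using R(1) by simp
    show "R \<in> Units (tsquare K H)"
      using R l unfolding Units_def by (auto intro!: bexI[of _ "flip K H H R"])
    show "inv\<^bsub>tsquare K H\<^esub> R = flip K H H R"
      using R l by (intro T.inv_char) auto
  qed
  have c: "(\<forall>x\<in>carrier H. flip K H H (comult H x) =
        R \<otimes>\<^bsub>tsquare K H\<^esub> comult H x \<otimes>\<^bsub>tsquare K H\<^esub> inv\<^bsub>tsquare K H\<^esub> R) \<longleftrightarrow>
      (\<forall>x\<in>carrier H. flip K H H (comult H x) \<otimes>\<^bsub>tsquare K H\<^esub> R = R \<otimes>\<^bsub>tsquare K H\<^esub> comult H x)"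
    if "R \<in> Units (tsquare K H)"
    by (intro ball_cong refl alg_conj_iff that) simp_all
  show ?thesis
    unfolding triangular.simps using u c by blast
qed simp

lemma triangular_Units:
  assumes "triangular K (H, R)"
  shows "R \<in> Units (tsquare K H)" "inv\<^bsub>tsquare K H\<^esub> R = flip K H H R"
  using assms by simp_all

text \<open>
  The conditions on a 1-cell with the twisted structures unfolded and the inverse of \<open>F\<close> moved to the
  other side: \<open>F \<Delta>(f x) = (f \<otimes> f)(\<Delta> x) F\<close> and \<open>(f \<otimes> f)(R) F = F\<^sup>o\<^sup>p R'\<close>.
\<close>

lemma tw_cell_iff:
  assumes X: "triangular K (H, R)" and Y: "triangular K (H', R')"
  shows "tw_cell K (H, R) (H', R') (f, F) \<longleftrightarrow> twist K H' F \<and> f \<in> alg_hom K H H' \<and>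
    (\<forall>x\<in>carrier H. counit H' (f x) = counit H x) \<and>
    (\<forall>x\<in>carrier H. F \<otimes>\<^bsub>tsquare K H'\<^esub> comult H' (f x) = sq_map H H' f (comult H x) \<otimes>\<^bsub>tsquare K H'\<^esub> F) \<and>
    sq_map H H' f R \<otimes>\<^bsub>tsquare K H'\<^esub> F = flip K H' H' F \<otimes>\<^bsub>tsquare K H'\<^esub> R'"
proof (cases "twist K H' F \<and> f \<in> alg_hom K H H'")
  case True
  from X Y have [simp]: "bialgebra K H" "bialgebra K H'" "R \<in> carrier (tsquare K H)"
    "R' \<in> carrier (tsquare K H')"
    by (simp_all add: triangular_iff del: triangular.simps)
  from True have U: "F \<in> Units (tsquare K H')" and [simp]: "f \<in> alg_hom K H H'"
    by (simp_all add: twist_def)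
  note [simp] = alg_hom_rules[OF \<open>f \<in> alg_hom K H H'\<close>]
  interpret T: monoid "tsquare K H'" by (rule alg_monoid) simp
  note [simp] = T.Units_closed[OF U] T.Units_inv_closed[OF U]
  note same = same_alg_refl same_alg_update
  have 1: "F \<otimes>\<^bsub>tsquare K H'\<^esub> comult H' (f x) \<otimes>\<^bsub>tsquare K H'\<^esub> inv\<^bsub>tsquare K H'\<^esub> F = sq_map H H' f (comult H x) \<longleftrightarrow>
      F \<otimes>\<^bsub>tsquare K H'\<^esub> comult H' (f x) = sq_map H H' f (comult H x) \<otimes>\<^bsub>tsquare K H'\<^esub> F"
    if "x \<in> carrier H" for x
    using alg_conj_iff[OF _ U, of "comult H' (f x)" "sq_map H H' f (comult H x)"] that by auto
  have 2: "Y = Z \<otimes>\<^bsub>tsquare K H'\<^esub> inv\<^bsub>tsquare K H'\<^esub> F \<longleftrightarrow> Y \<otimes>\<^bsub>tsquare K H'\<^esub> F = Z"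
    if "Y \<in> carrier (tsquare K H')" "Z \<in> carrier (tsquare K H')" for Y Z
    using that U by (auto simp: T.m_assoc)
  show ?thesis
    using True X Y
    by (simp add: bialg_hom_def alg_hom_same[OF same] tensor_map_same[OF same(1,1) same(2,2)]
        1 2 del: triangular.simps) blast
next
  case False
  then show ?thesis
    by (auto simp: bialg_hom_def alg_hom_same[OF same_alg_refl same_alg_update]
        simp del: triangular.simps)
qed


section \<open>Bialgebra maps with commuting images\<close>

text \<open>
  The product \<open>(i \<otimes> i)(X) (j \<otimes> j)(Y)\<close> and its analogue for threefold tensors. When \<open>i\<close> and \<open>j\<close> are the
  inclusions into \<open>A \<otimes> B\<close>, the former is the middle flip of \<open>X \<otimes> Y\<close>, that is \<open>X\<^sub>1\<^sub>3 Y\<^sub>2\<^sub>4\<close> (lemma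
  \<open>middle_flip_join2\<close>).
\<close>

definition join2 :: "('k, 'a, 'm) module_scheme \<Rightarrow> ('k, 'b, 'n) module_scheme
    \<Rightarrow> ('k, 'c, 'p) module_scheme \<Rightarrow> ('a \<Rightarrow> 'c) \<Rightarrow> ('b \<Rightarrow> 'c)
    \<Rightarrow> ('a, 'a) tensor \<Rightarrow> ('b, 'b) tensor \<Rightarrow> ('c, 'c) tensor"
  where "join2 A B M i j X Y = sq_map A M i X \<otimes>\<^bsub>tsquare K M\<^esub> sq_map B M j Y"

definition join3 :: "('k, 'a, 'm) module_scheme \<Rightarrow> ('k, 'b, 'n) module_scheme
    \<Rightarrow> ('k, 'c, 'p) module_scheme \<Rightarrow> ('a \<Rightarrow> 'c) \<Rightarrow> ('b \<Rightarrow> 'c)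
    \<Rightarrow> ('a, ('a, 'a) tensor) tensor \<Rightarrow> ('b, ('b, 'b) tensor) tensor \<Rightarrow> ('c, ('c, 'c) tensor) tensor"
  where "join3 A B M i j X Y = cube_map A M i X \<otimes>\<^bsub>tcube K M\<^esub> cube_map B M j Y"

context
  fixes A :: "('k, 'a) bialg" and B :: "('k, 'b) bialg"
    and M :: "('k, 'c) bialg" and i :: "'a \<Rightarrow> 'c" and j :: "'b \<Rightarrow> 'c"
  assumes A [simp]: "bialgebra K A" and B [simp]: "bialgebra K B" and M [simp]: "bialgebra K M"
    and i: "i \<in> bialg_hom K A M" and j: "j \<in> bialg_hom K B M"
    and comm: "commuting A B M i j"
begin

lemmas ij_hom [simp] = bialg_hom_alg_hom[OF i] bialg_hom_alg_hom[OF j]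

lemma commuting_sq: "commuting (tsquare K A) (tsquare K B) (tsquare K M) (sq_map A M i) (sq_map B M j)"
  by (rule commuting_tensor_map) (simp_all add: comm)

lemma commuting_cube: "commuting (tcube K A) (tcube K B) (tcube K M) (cube_map A M i) (cube_map B M j)"
  by (rule commuting_tensor_map) (simp_all add: comm commuting_sq)

lemma join2_closed [simp]:
  "X \<in> carrier (tsquare K A) \<Longrightarrow> Y \<in> carrier (tsquare K B) \<Longrightarrow>
    join2 A B M i j X Y \<in> carrier (tsquare K M)"
  by (simp add: join2_def)

lemma join2_mult:
  assumes [simp]: "X \<in> carrier (tsquare K A)" "X' \<in> carrier (tsquare K A)"
    "Y \<in> carrier (tsquare K B)" "Y' \<in> carrier (tsquare K B)"
  shows "join2 A B M i j X Y \<otimes>\<^bsub>tsquare K M\<^esub> join2 A B M i j X' Y' =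
    join2 A B M i j (X \<otimes>\<^bsub>tsquare K A\<^esub> X') (Y \<otimes>\<^bsub>tsquare K B\<^esub> Y')"
  using commuting_sq unfolding join2_def commuting_def
  by (subst alg_interchange) simp_all

lemma join3_mult:
  assumes [simp]: "X \<in> carrier (tcube K A)" "X' \<in> carrier (tcube K A)"
    "Y \<in> carrier (tcube K B)" "Y' \<in> carrier (tcube K B)"
  shows "join3 A B M i j X Y \<otimes>\<^bsub>tcube K M\<^esub> join3 A B M i j X' Y' =
    join3 A B M i j (X \<otimes>\<^bsub>tcube K A\<^esub> X') (Y \<otimes>\<^bsub>tcube K B\<^esub> Y')"
  using commuting_cube unfolding join3_def commuting_def
  by (subst alg_interchange) simp_all

lemma join2_one: "join2 A B M i j \<one>\<^bsub>tsquare K A\<^esub> \<one>\<^bsub>tsquare K B\<^esub> = \<one>\<^bsub>tsquare K M\<^esub>"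
  and join2_left: "X \<in> carrier (tsquare K A) \<Longrightarrow>
    sq_map A M i X = join2 A B M i j X \<one>\<^bsub>tsquare K B\<^esub>"
  and join2_right: "Y \<in> carrier (tsquare K B) \<Longrightarrow>
    sq_map B M j Y = join2 A B M i j \<one>\<^bsub>tsquare K A\<^esub> Y"
  by (simp_all add: join2_def)

lemma join2_structure:
  assumes [simp]: "X \<in> carrier (tsquare K A)" "Y \<in> carrier (tsquare K B)"
  shows "flip K M M (join2 A B M i j X Y) = join2 A B M i j (flip K A A X) (flip K B B Y)"
    and "leg12 K M (join2 A B M i j X Y) = join3 A B M i j (leg12 K A X) (leg12 K B Y)"
    and "leg13 K M (join2 A B M i j X Y) = join3 A B M i j (leg13 K A X) (leg13 K B Y)"
    and "leg23 K M (join2 A B M i j X Y) = join3 A B M i j (leg23 K A X) (leg23 K B Y)"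
    and "comult_left3 M (join2 A B M i j X Y) =
      join3 A B M i j (comult_left3 A X) (comult_left3 B Y)"
    and "comult_right K M (join2 A B M i j X Y) =
      join3 A B M i j (comult_right K A X) (comult_right K B Y)"
  unfolding join2_def join3_def
  using comult_cube_map[OF _ _ i i] comult_cube_map[OF _ _ j j]
  by (simp_all add: leg_map flip_tensor_map)

lemma form_join2:
  assumes [simp]: "X \<in> carrier (tsquare K A)" "Y \<in> carrier (tsquare K B)"
  shows "form_left K M M (counit M) (join2 A B M i j X Y) =
      i (form_left K A A (counit A) X) \<otimes>\<^bsub>M\<^esub> j (form_left K B B (counit B) Y)"
    and "form_right K M M (counit M) (join2 A B M i j X Y) =
      i (form_right K A A (counit A) X) \<otimes>\<^bsub>M\<^esub> j (form_right K B B (counit B) Y)"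
  unfolding join2_def
  using form_sq_map[OF _ _ _ bialg_hom_counit[OF i]] form_sq_map[OF _ _ _ bialg_hom_counit[OF j]]
  by simp_all

lemma join2_Units:
  assumes "F \<in> Units (tsquare K A)" "G \<in> Units (tsquare K B)"
  shows "join2 A B M i j F G \<in> Units (tsquare K M)"
  unfolding join2_def
  by (intro monoid.Units_m_closed alg_monoid alg_hom_Units(1)[OF _ _ tensor_map_alg_hom] assms) simp_all

text \<open>
  Both sides of the cocycle identity are multiplicative in the pair \<open>(F, G)\<close>.
\<close>

lemma twist_join2:
  assumes F: "twist K A F" and G: "twist K B G"
  shows "twist K M (join2 A B M i j F G)"
proof -
  have FU: "F \<in> Units (tsquare K A)" and GU: "G \<in> Units (tsquare K B)"
    using F G by (simp_all add: twist_def)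
  then have [simp]: "F \<in> carrier (tsquare K A)" "G \<in> carrier (tsquare K B)"
    by (simp_all add: monoid.Units_closed alg_monoid)
  show ?thesis
    using F G unfolding twist_iff[OF A] twist_iff[OF B] twist_iff[OF M]
    by (simp add: join2_Units join2_structure join3_mult form_join2 alg_hom_one[OF ij_hom(1)]
        alg_hom_one[OF ij_hom(2)])
qed

end

lemma sq_map_square:
  assumes [simp]: "k_algebra K A" "k_algebra K B" "k_algebra K C" "k_algebra K D"
    and [simp]: "f \<in> lin K A B" "g \<in> lin K B D" "h \<in> lin K A C" "k \<in> lin K C D"
    and [simp]: "\<And>a. a \<in> carrier A \<Longrightarrow> g (f a) = k (h a)"
    and X: "X \<in> carrier (tsquare K A)"
  shows "sq_map B D g (sq_map A B f X) = sq_map C D k (sq_map A C h X)"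
  using X by (induct rule: tensor_induction)
    (simp_all add: lin_closed[OF assms(5)] lin_closed[OF assms(7)])


section \<open>The tensor product of two bialgebras\<close>

lemma tensor_bialg_sel [simp]:
  "carrier (tensor_bialg K A B) = carrier (tensor_alg K A B)"
  "monoid.mult (tensor_bialg K A B) = monoid.mult (tensor_alg K A B)"
  "\<one>\<^bsub>tensor_bialg K A B\<^esub> = \<one>\<^bsub>tensor_alg K A B\<^esub>"
  "add (tensor_bialg K A B) = add (tensor_alg K A B)"
  "\<zero>\<^bsub>tensor_bialg K A B\<^esub> = \<zero>\<^bsub>tensor_alg K A B\<^esub>"
  "smult (tensor_bialg K A B) = smult (tensor_alg K A B)"
  using same_alg_tensor_bialg[of K A B] by (simp_all add: same_alg_def)

text \<open>
  The counit is written with the base ring as a target algebra, which makes the general results on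
  lifts applicable; the lift only sees the additive structure of its target.
\<close>

lemma tensor_bialg_comult: "comult (tensor_bialg K A B) = (\<lambda>X. middle_flip K A A B B
      (tensor_map K A B (tsquare K A) (tsquare K B) (comult A) (comult B) X))"
  and tensor_bialg_counit: "counit (tensor_bialg K A B) =
      tensor_lift K A B (base_alg K) (\<lambda>a b. counit A a \<otimes>\<^bsub>K\<^esub> counit B b)"
  by (simp_all add: tensor_bialg_def module.defs bialg.defs tensor_lift_def balanced_lift_def hom_def)

lemmas tb_same = same_alg_tensor_bialg[of K] same_alg_refl

text \<open>
  Constructions over the tensor product bialgebra rewritten to the underlying algebra.
\<close>

lemmas tensor_bialg_norm =
  tensor_alg_same[OF tb_same(1,2)] tensor_alg_same[OF tb_same(2,1)]
  tpure_same[OF tb_same(1,2)] tpure_same[OF tb_same(2,1)]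
  alg_hom_same[OF tb_same(1,2)] alg_hom_same[OF tb_same(2,1)]
  flip_same[OF tb_same(1,2)] flip_same[OF tb_same(2,1)]
  tensor_map_same[OF tb_same(1,2,2,2)] tensor_map_same[OF tb_same(2,1,2,2)]
  tensor_map_same[OF tb_same(2,2,1,2)] tensor_map_same[OF tb_same(2,2,2,1)]


text \<open>
  The tensor product bialgebra.
\<close>

abbreviation tensor_bialg_infix :: "('k, 'a) bialg \<Rightarrow> ('k, 'b) bialg \<Rightarrow> ('k, ('a, 'b) tensor) bialg"
    (infixr "\<boxtimes>" 75)
  where "A \<boxtimes> B \<equiv> tensor_bialg K A B"

text \<open>
  The inclusions \<open>a \<mapsto> a \<otimes> 1\<close> and \<open>b \<mapsto> 1 \<otimes> b\<close> into the tensor product bialgebra.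
\<close>

abbreviation in1 :: "('k, 'a) bialg \<Rightarrow> ('k, 'b) bialg \<Rightarrow> 'a \<Rightarrow> ('a, 'b) tensor"
  where "in1 A B \<equiv> (\<lambda>a. tpure K A B a \<one>\<^bsub>B\<^esub>)"

abbreviation in2 :: "('k, 'a) bialg \<Rightarrow> ('k, 'b) bialg \<Rightarrow> 'b \<Rightarrow> ('a, 'b) tensor"
  where "in2 A B \<equiv> tpure K A B \<one>\<^bsub>A\<^esub>"

context
  fixes A :: "('k, 'a) bialg" and B :: "('k, 'b) bialg"
  assumes A [simp]: "bialgebra K A" and B [simp]: "bialgebra K B"
begin

lemma tensor_bialg_k_algebra: "k_algebra K (A \<boxtimes> B)"
proof (rule k_algebraI)
  have T: "k_algebra K (tensor_alg K A B)" by simp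
  interpret T: abelian_group "tensor_alg K A B" by (rule alg_abelian_group[OF T])
  show "abelian_group (A \<boxtimes> B)"
    by (rule abelian_groupI) (auto simp: T.a_ac intro: T.l_neg bexI[of _ "\<ominus>\<^bsub>tensor_alg K A B\<^esub> x" for x])
qed (simp_all add: alg_m_assoc)

lemma counit_tensor_bilin:
  "(\<lambda>a b. counit A a \<otimes>\<^bsub>K\<^esub> counit B b) \<in> bilin K A B (base_alg K)"
  by (intro bilinI linI) (simp_all add: K.l_distr K.r_distr K.m_ac)

lemma counit_tensor_pure: "a \<in> carrier A \<Longrightarrow> b \<in> carrier B \<Longrightarrow>
    counit (A \<boxtimes> B) (tpure K A B a b) = counit A a \<otimes>\<^bsub>K\<^esub> counit B b"
  unfolding tensor_bialg_counit by (rule tensor_lift_pure) (simp_all add: counit_tensor_bilin)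

lemma counit_tensor_alg_hom: "counit (A \<boxtimes> B) \<in> alg_hom K (A \<boxtimes> B) (base_alg K)"
  unfolding tensor_bialg_norm
proof (rule tensor_alg_homI)
  show "counit (A \<boxtimes> B) \<in> lin K (tensor_alg K A B) (base_alg K)"
    unfolding tensor_bialg_counit by (rule tensor_lift_lin) (simp_all add: counit_tensor_bilin)
qed (simp_all add: counit_tensor_pure K.m_ac)

lemma comult_tensor_alg_hom: "comult (A \<boxtimes> B) \<in> alg_hom K (A \<boxtimes> B) (tsquare K (A \<boxtimes> B))"
  unfolding tensor_bialg_norm tensor_bialg_comult
  by (rule alg_hom_comp[OF tensor_map_alg_hom middle_flip_alg_hom]) simp_all

lemma tensor_bialg_pre: "pre_bialgebra (A \<boxtimes> B)"
  by (simp add: pre_bialgebra_def tensor_bialg_k_algebra counit_tensor_alg_hom comult_tensor_alg_hom)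

lemma middle_flip_one_right:
  assumes X: "X \<in> carrier (tsquare K A)"
  shows "middle_flip K A A B B (tpure K (tsquare K A) (tsquare K B) X \<one>\<^bsub>tsquare K B\<^esub>) =
    sq_map A (A \<boxtimes> B) (in1 A B) X"
  unfolding tensor_bialg_norm
  using X by (induct rule: tensor_induction)
    (simp_all, simp add: tensor_alg_one)

lemma middle_flip_one_left:
  assumes Y: "Y \<in> carrier (tsquare K B)"
  shows "middle_flip K A A B B (tpure K (tsquare K A) (tsquare K B) \<one>\<^bsub>tsquare K A\<^esub> Y) =
    sq_map B (A \<boxtimes> B) (in2 A B) Y"
  unfolding tensor_bialg_norm
  using Y by (induct rule: tensor_induction)
    (simp_all, simp add: tensor_alg_one)

lemma middle_flip_join2:
  assumes [simp]: "X \<in> carrier (tsquare K A)" "Y \<in> carrier (tsquare K B)"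
  shows "middle_flip K A A B B (tpure K (tsquare K A) (tsquare K B) X Y) = join2 A B (A \<boxtimes> B) (in1 A B) (in2 A B) X Y"
proof -
  have "tpure K (tsquare K A) (tsquare K B) X Y =
      tpure K (tsquare K A) (tsquare K B) X \<one>\<^bsub>tsquare K B\<^esub>
        \<otimes>\<^bsub>tensor_alg K (tsquare K A) (tsquare K B)\<^esub>
      tpure K (tsquare K A) (tsquare K B) \<one>\<^bsub>tsquare K A\<^esub> Y"
    by simp
  then show ?thesis
    unfolding join2_def
    by (simp only: middle_flip_rules(4) tpure_closed alg_simps(3) tensor_alg_k_algebra bialgebra_pre
        bialg_k_algebra A B assms middle_flip_one_left middle_flip_one_right tensor_bialg_norm)
qed

lemma in1_bialg_hom: "(in1 A B) \<in> bialg_hom K A (A \<boxtimes> B)"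
proof (rule bialg_homI)
  show "(in1 A B) \<in> alg_hom K A (A \<boxtimes> B)" by (simp add: tensor_bialg_norm)
  fix a assume "a \<in> carrier A"
  then show "comult (A \<boxtimes> B) ((in1 A B) a) = sq_map A (A \<boxtimes> B) (in1 A B) (comult A a)" "counit (A \<boxtimes> B) ((in1 A B) a) = counit A a"
    by (simp_all add: counit_tensor_pure middle_flip_one_right flip: middle_flip_one_right)
       (simp_all add: tensor_bialg_comult)
qed

lemma in2_bialg_hom: "(in2 A B) \<in> bialg_hom K B (A \<boxtimes> B)"
proof (rule bialg_homI)
  show "(in2 A B) \<in> alg_hom K B (A \<boxtimes> B)" by (simp add: tensor_bialg_norm)
  fix b assume "b \<in> carrier B"
  then show "comult (A \<boxtimes> B) ((in2 A B) b) = sq_map B (A \<boxtimes> B) (in2 A B) (comult B b)" "counit (A \<boxtimes> B) ((in2 A B) b) = counit B b"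
    by (simp_all add: counit_tensor_pure flip: middle_flip_one_left)
       (simp_all add: tensor_bialg_comult)
qed

lemma in1_in2_commuting: "commuting A B (A \<boxtimes> B) (in1 A B) (in2 A B)"
  by (simp add: commuting_def)

text \<open>
  If \<open>U\<close> intertwines two algebra homomorphisms on the images of both inclusions, it does so everywhere,
  because the property passes to products and sums.
\<close>

lemma tensor_bialg_intertwine:
  assumes N [simp]: "k_algebra K N" and f: "f \<in> alg_hom K (A \<boxtimes> B) N" and g: "g \<in> alg_hom K (A \<boxtimes> B) N"
    and U [simp]: "U \<in> carrier N"
    and 1: "\<And>a. a \<in> carrier A \<Longrightarrow> f ((in1 A B) a) \<otimes>\<^bsub>N\<^esub> U = U \<otimes>\<^bsub>N\<^esub> g ((in1 A B) a)"
    and 2: "\<And>b. b \<in> carrier B \<Longrightarrow> f ((in2 A B) b) \<otimes>\<^bsub>N\<^esub> U = U \<otimes>\<^bsub>N\<^esub> g ((in2 A B) b)"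
    and x: "x \<in> carrier (A \<boxtimes> B)"
  shows "f x \<otimes>\<^bsub>N\<^esub> U = U \<otimes>\<^bsub>N\<^esub> g x"
proof -
  have f': "f \<in> alg_hom K (tensor_alg K A B) N" and g': "g \<in> alg_hom K (tensor_alg K A B) N"
    using f g by (simp_all add: tensor_bialg_norm)
  note f_rules [simp] = alg_hom_rules(1,2)[OF f'] and g_rules [simp] = alg_hom_rules(1,2)[OF g']
  show ?thesis
    using x unfolding tensor_bialg_sel
  proof (induct rule: tensor_induction)
    case (pure a b)
    then have p: "tpure K A B a b = (in1 A B) a \<otimes>\<^bsub>tensor_alg K A B\<^esub> (in2 A B) b"
      by simp
    have [simp]: "(in1 A B) a \<in> carrier (tensor_alg K A B)" "(in2 A B) b \<in> carrier (tensor_alg K A B)"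
      using pure by simp_all
    have "f (tpure K A B a b) \<otimes>\<^bsub>N\<^esub> U = f ((in1 A B) a) \<otimes>\<^bsub>N\<^esub> (f ((in2 A B) b) \<otimes>\<^bsub>N\<^esub> U)"
      unfolding p by (simp add: alg_hom_mult[OF f'] alg_m_assoc[OF N] del: tensor_mult_pure)
    also have "\<dots> = (f ((in1 A B) a) \<otimes>\<^bsub>N\<^esub> U) \<otimes>\<^bsub>N\<^esub> g ((in2 A B) b)"
      unfolding 2[OF pure(2)] by (simp add: alg_m_assoc[OF N])
    also have "\<dots> = U \<otimes>\<^bsub>N\<^esub> g (tpure K A B a b)"
      unfolding 1[OF pure(1)] p
      by (simp add: alg_hom_mult[OF g'] alg_m_assoc[OF N] del: tensor_mult_pure)
    finally show ?case .
  qed simp_all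
qed

lemma tensor_bialg_hom_eqI:
  assumes N [simp]: "k_algebra K N" and f: "f \<in> alg_hom K (A \<boxtimes> B) N" and g: "g \<in> alg_hom K (A \<boxtimes> B) N"
    and 1: "\<And>a. a \<in> carrier A \<Longrightarrow> f ((in1 A B) a) = g ((in1 A B) a)"
    and 2: "\<And>b. b \<in> carrier B \<Longrightarrow> f ((in2 A B) b) = g ((in2 A B) b)"
    and x: "x \<in> carrier (A \<boxtimes> B)"
  shows "f x = g x"
  by (rule alg_hom_eqI[where A = A and B = B and U = N])
    (use f g x in \<open>simp_all add: tensor_bialg_norm 1 2\<close>)

lemma tensor_bialgebra [simp]: "bialgebra K (A \<boxtimes> B)"
proof -
  note [simp] = tensor_bialg_pre bialg_hom_comult[OF in1_bialg_hom] bialg_hom_comult[OF in2_bialg_hom]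
    bialg_hom_alg_hom[OF in1_bialg_hom] bialg_hom_alg_hom[OF in2_bialg_hom]
  note [simp del] = tensor_bialg_sel
  note e1 = bialg_hom_counit[OF in1_bialg_hom] and e2 = bialg_hom_counit[OF in2_bialg_hom]
  have "comult_left3 (A \<boxtimes> B) (comult (A \<boxtimes> B) x) = comult_right K (A \<boxtimes> B) (comult (A \<boxtimes> B) x)" if x: "x \<in> carrier (A \<boxtimes> B)" for x
  proof (rule tensor_bialg_hom_eqI[OF _ _ _ _ _ x])
    show "(\<lambda>x. comult_left3 (A \<boxtimes> B) (comult (A \<boxtimes> B) x)) \<in> alg_hom K (A \<boxtimes> B) (tcube K (A \<boxtimes> B))"
      by (rule alg_hom_comp[OF comult_alg_hom comult_left3_alg_hom]) simp_all
    show "(\<lambda>x. comult_right K (A \<boxtimes> B) (comult (A \<boxtimes> B) x)) \<in> alg_hom K (A \<boxtimes> B) (tcube K (A \<boxtimes> B))"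
      by (rule alg_hom_comp[OF comult_alg_hom comult_right_alg_hom]) simp_all
  qed (simp_all add: coassoc comult_cube_map[OF _ _ in1_bialg_hom in1_bialg_hom]
      comult_cube_map[OF _ _ in2_bialg_hom in2_bialg_hom])
  moreover have "form_left K (A \<boxtimes> B) (A \<boxtimes> B) (counit (A \<boxtimes> B)) (comult (A \<boxtimes> B) x) = x" if x: "x \<in> carrier (A \<boxtimes> B)" for x
  proof (rule tensor_bialg_hom_eqI[OF _ _ _ _ _ x])
    show "(\<lambda>x. form_left K (A \<boxtimes> B) (A \<boxtimes> B) (counit (A \<boxtimes> B)) (comult (A \<boxtimes> B) x)) \<in> alg_hom K (A \<boxtimes> B) (A \<boxtimes> B)"
      by (rule alg_hom_comp[OF comult_alg_hom form_left_alg_hom]) simp_all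
  qed (simp_all add: form_sq_map[OF _ _ _ e1] form_sq_map[OF _ _ _ e2])
  moreover have "form_right K (A \<boxtimes> B) (A \<boxtimes> B) (counit (A \<boxtimes> B)) (comult (A \<boxtimes> B) x) = x" if x: "x \<in> carrier (A \<boxtimes> B)" for x
  proof (rule tensor_bialg_hom_eqI[OF _ _ _ _ _ x])
    show "(\<lambda>x. form_right K (A \<boxtimes> B) (A \<boxtimes> B) (counit (A \<boxtimes> B)) (comult (A \<boxtimes> B) x)) \<in> alg_hom K (A \<boxtimes> B) (A \<boxtimes> B)"
      by (rule alg_hom_comp[OF comult_alg_hom form_right_alg_hom]) simp_all
  qed (simp_all add: form_sq_map[OF _ _ _ e1] form_sq_map[OF _ _ _ e2])
  ultimately show ?thesis
    using tensor_bialg_pre unfolding bialgebra_def pre_bialgebra_def by blast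
qed

lemmas in_join =
  join2_closed[OF A B tensor_bialgebra in1_bialg_hom in2_bialg_hom in1_in2_commuting]
  join2_mult[OF A B tensor_bialgebra in1_bialg_hom in2_bialg_hom in1_in2_commuting]
  join3_mult[OF A B tensor_bialgebra in1_bialg_hom in2_bialg_hom in1_in2_commuting]
  join2_one[OF A B tensor_bialgebra in1_bialg_hom in2_bialg_hom in1_in2_commuting]
  join2_structure[OF A B tensor_bialgebra in1_bialg_hom in2_bialg_hom in1_in2_commuting]
lemmas in1_join = join2_left[OF A B tensor_bialgebra in1_bialg_hom in2_bialg_hom in1_in2_commuting]
lemmas in2_join = join2_right[OF A B tensor_bialgebra in1_bialg_hom in2_bialg_hom in1_in2_commuting]

lemma in_alg_hom [simp]: "(in1 A B) \<in> alg_hom K A (A \<boxtimes> B)" "(in2 A B) \<in> alg_hom K B (A \<boxtimes> B)"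
  by (simp_all add: bialg_hom_alg_hom[OF in1_bialg_hom] bialg_hom_alg_hom[OF in2_bialg_hom])

lemma comult_in [simp]:
  "a \<in> carrier A \<Longrightarrow> comult (A \<boxtimes> B) ((in1 A B) a) = sq_map A (A \<boxtimes> B) (in1 A B) (comult A a)"
  "b \<in> carrier B \<Longrightarrow> comult (A \<boxtimes> B) ((in2 A B) b) = sq_map B (A \<boxtimes> B) (in2 A B) (comult B b)"
  by (simp_all add: bialg_hom_comult[OF in1_bialg_hom] bialg_hom_comult[OF in2_bialg_hom])

end


text \<open>
  From here on \<open>A \<boxtimes> B\<close> is handled as a bialgebra through its inclusions; rewriting its fields would
  mix terms over the bialgebra with terms over the underlying algebra.
\<close>

declare tensor_bialg_sel [simp del]

section \<open>The tensor product of triangular bialgebras\<close>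

lemma triangular_tensor:
  fixes A :: "('k, 'a) bialg" and B :: "('k, 'b) bialg"
  assumes R: "triangular K (A, R)" and S: "triangular K (B, S)"
  shows "triangular K (tensor_pair K (A, R) (B, S))"
proof -
  note [simp del] = triangular.simps
  from R S have [simp]: "bialgebra K A" "bialgebra K B" "R \<in> carrier (tsquare K A)"
    "S \<in> carrier (tsquare K B)"
    by (simp_all add: triangular_iff)
  let ?M = "A \<boxtimes> B" and ?i = "in1 A B" and ?j = "in2 A B"
  let ?R = "join2 A B ?M ?i ?j R S"
  note rules = in_join[OF \<open>bialgebra K A\<close> \<open>bialgebra K B\<close>] in1_join[OF \<open>bialgebra K A\<close> \<open>bialgebra K B\<close>]
    in2_join[OF \<open>bialgebra K A\<close> \<open>bialgebra K B\<close>]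
  have "flip K ?M ?M (comult ?M x) \<otimes>\<^bsub>tsquare K ?M\<^esub> ?R = ?R \<otimes>\<^bsub>tsquare K ?M\<^esub> comult ?M x"
    if "x \<in> carrier ?M" for x
  proof (rule tensor_bialg_intertwine[OF _ _ _ _ _ _ _ _ that])
    show "(\<lambda>x. flip K ?M ?M (comult ?M x)) \<in> alg_hom K ?M (tsquare K ?M)"
      by (rule alg_hom_comp[OF comult_alg_hom flip_alg_hom]) simp_all
  qed (use R S in \<open>simp_all add: rules triangular_iff\<close>)
  then show ?thesis
    using R S by (simp add: middle_flip_join2 triangular_iff rules)
qed

text \<open>
  Applying \<open>\<epsilon> \<otimes> Id \<otimes> Id\<close> to \<open>(\<Delta> \<otimes> Id)(R) = R\<^sub>1\<^sub>3 R\<^sub>2\<^sub>3\<close> gives \<open>R = (1 \<otimes> (\<epsilon> \<otimes> Id)(R)) R\<close>, where \<open>R\<close> can be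
  cancelled.
\<close>

lemma triangular_form_left:
  assumes R: "triangular K (H, R)"
  shows "form_left K H H (counit H) R = \<one>\<^bsub>H\<^esub>"
proof -
  note [simp del] = triangular.simps
  from R have [simp]: "bialgebra K H" "R \<in> carrier (tsquare K H)"
    and inv: "R \<otimes>\<^bsub>tsquare K H\<^esub> flip K H H R = \<one>\<^bsub>tsquare K H\<^esub>"
    and cl: "comult_left3 H R = leg13 K H R \<otimes>\<^bsub>tcube K H\<^esub> leg23 K H R"
    by (simp_all add: triangular_iff)
  let ?e = "form_left K H H (counit H)" and ?g = "form_left K H (tsquare K H) (counit H)"
  have 0: "?g (tensor_assoc K H H H (tpure K (tsquare K H) H Z y)) = tpure K H H (?e Z) y"
    if "Z \<in> carrier (tsquare K H)" "y \<in> carrier H" for Z y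
    using that by (induct rule: tensor_induction) simp_all
  have 1: "?g (comult_left3 H X) = X" if "X \<in> carrier (tsquare K H)" for X
    using that by (induct rule: tensor_induction)
      (simp_all add: 0)
  have 2: "?g (leg13 K H X) = tpure K H H \<one>\<^bsub>H\<^esub> (?e X)" if "X \<in> carrier (tsquare K H)" for X
    using that by (induct rule: tensor_induction) simp_all
  have 3: "?g (leg23 K H X) = X" if "X \<in> carrier (tsquare K H)" for X
    using that by (simp add: leg23_def)
  have "R = tpure K H H \<one>\<^bsub>H\<^esub> (?e R) \<otimes>\<^bsub>tsquare K H\<^esub> R"
    using arg_cong[OF cl, of ?g] by (simp add: 1 2 3)
  then have "R \<otimes>\<^bsub>tsquare K H\<^esub> flip K H H R =
      tpure K H H \<one>\<^bsub>H\<^esub> (?e R) \<otimes>\<^bsub>tsquare K H\<^esub> (R \<otimes>\<^bsub>tsquare K H\<^esub> flip K H H R)"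
    by (simp flip: alg_m_assoc)
  then have "\<one>\<^bsub>tsquare K H\<^esub> = tpure K H H \<one>\<^bsub>H\<^esub> (?e R)"
    unfolding inv by simp
  from arg_cong[OF this, of ?e] show ?thesis by simp
qed

section \<open>Composition of twisted morphisms\<close>

text \<open>
  Naturality of \<open>\<Delta> \<otimes> Id\<close> and \<open>Id \<otimes> \<Delta>\<close> for a map that is compatible with the comultiplications only up
  to the tensor \<open>G\<close>.
\<close>

lemma twisted_comult_map:
  assumes [simp]: "bialgebra K Y" "bialgebra K Z" and g [simp]: "g \<in> alg_hom K Y Z"
    and G [simp]: "G \<in> carrier (tsquare K Z)"
    and comult_g: "\<And>y. y \<in> carrier Y \<Longrightarrow>
      G \<otimes>\<^bsub>tsquare K Z\<^esub> comult Z (g y) = sq_map Y Z g (comult Y y) \<otimes>\<^bsub>tsquare K Z\<^esub> G"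
    and X: "X \<in> carrier (tsquare K Y)"
  shows "leg12 K Z G \<otimes>\<^bsub>tcube K Z\<^esub> comult_left3 Z (sq_map Y Z g X) =
      cube_map Y Z g (comult_left3 Y X) \<otimes>\<^bsub>tcube K Z\<^esub> leg12 K Z G"
    and "leg23 K Z G \<otimes>\<^bsub>tcube K Z\<^esub> comult_right K Z (sq_map Y Z g X) =
      cube_map Y Z g (comult_right K Y X) \<otimes>\<^bsub>tcube K Z\<^esub> leg23 K Z G"
proof -
  note [simp] = alg_hom_rules[OF g]
  let ?Z3 = "tensor_alg K (tsquare K Z) Z"
  have "tpure K (tsquare K Z) Z G \<one>\<^bsub>Z\<^esub> \<otimes>\<^bsub>?Z3\<^esub> comult_left K Z (sq_map Y Z g X) =
      tensor_map K (tsquare K Y) Y (tsquare K Z) Z (sq_map Y Z g) g (comult_left K Y X)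
        \<otimes>\<^bsub>?Z3\<^esub> tpure K (tsquare K Z) Z G \<one>\<^bsub>Z\<^esub>"
    using X by (induct rule: tensor_induction)
      (simp_all add: comult_g)
  from arg_cong[OF this, of "tensor_assoc K Z Z Z"]
  show "leg12 K Z G \<otimes>\<^bsub>tcube K Z\<^esub> comult_left3 Z (sq_map Y Z g X) =
      cube_map Y Z g (comult_left3 Y X) \<otimes>\<^bsub>tcube K Z\<^esub> leg12 K Z G"
    using X by (simp add: leg12_assoc tensor_assoc_map)
  show "leg23 K Z G \<otimes>\<^bsub>tcube K Z\<^esub> comult_right K Z (sq_map Y Z g X) =
      cube_map Y Z g (comult_right K Y X) \<otimes>\<^bsub>tcube K Z\<^esub> leg23 K Z G"
    using X unfolding leg23_def
    by (induct rule: tensor_induction)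
      (simp_all add: comult_g)
qed

lemma tw_cell_triangular:
  assumes "tw_cell K X (H', R') (f, F)"
  shows "triangular K X" "triangular K (H', R')"
  using assms by (simp_all del: triangular.simps)

text \<open>
  In each side of the cocycle identity for \<open>(g \<otimes> g)(F) G\<close>, the two middle factors are exchanged by
  \<open>twisted_comult_map\<close>; what remains is the image under \<open>g\<close> of the identity for \<open>F\<close>, times the identity
  for \<open>G\<close>.
\<close>

lemma tw_cell_comp:
  assumes f: "tw_cell K (H, R) (H', R') (f, F)" and g: "tw_cell K (H', R') (H'', R'') (g, G)"
  shows "tw_cell K (H, R) (H'', R'') (tw_comp K (H', R') (H'', R'') (g, G) (f, F))"
proof -
  note [simp del] = triangular.simps tw_cell.simps
  note tri = tw_cell_triangular[OF f] tw_cell_triangular(2)[OF g]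
  from tri have [simp]: "bialgebra K H" "bialgebra K H'" "bialgebra K H''" "R \<in> carrier (tsquare K H)"
    "R' \<in> carrier (tsquare K H')" "R'' \<in> carrier (tsquare K H'')"
    by (simp_all add: triangular_iff)
  from f[unfolded tw_cell_iff[OF tri(1,2)]] have F: "twist K H' F" and f_hom [simp]: "f \<in> alg_hom K H H'"
    and counit_f: "\<And>x. x \<in> carrier H \<Longrightarrow> counit H' (f x) = counit H x"
    and comult_f: "\<And>x. x \<in> carrier H \<Longrightarrow>
      F \<otimes>\<^bsub>tsquare K H'\<^esub> comult H' (f x) = sq_map H H' f (comult H x) \<otimes>\<^bsub>tsquare K H'\<^esub> F"
    and Rf: "sq_map H H' f R \<otimes>\<^bsub>tsquare K H'\<^esub> F = flip K H' H' F \<otimes>\<^bsub>tsquare K H'\<^esub> R'"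
    by blast+
  from g[unfolded tw_cell_iff[OF tri(2,3)]] have G: "twist K H'' G" and g_hom [simp]: "g \<in> alg_hom K H' H''"
    and counit_g: "\<And>x. x \<in> carrier H' \<Longrightarrow> counit H'' (g x) = counit H' x"
    and comult_g: "\<And>x. x \<in> carrier H' \<Longrightarrow>
      G \<otimes>\<^bsub>tsquare K H''\<^esub> comult H'' (g x) = sq_map H' H'' g (comult H' x) \<otimes>\<^bsub>tsquare K H''\<^esub> G"
    and Rg: "sq_map H' H'' g R' \<otimes>\<^bsub>tsquare K H''\<^esub> G = flip K H'' H'' G \<otimes>\<^bsub>tsquare K H''\<^esub> R''"
    by blast+
  note [simp] = alg_hom_rules[OF f_hom] alg_hom_rules[OF g_hom]
  have FU: "F \<in> Units (tsquare K H')" and GU: "G \<in> Units (tsquare K H'')"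
    using F G by (simp_all add: twist_def)
  then have [simp]: "F \<in> carrier (tsquare K H')" "G \<in> carrier (tsquare K H'')"
    by (simp_all add: monoid.Units_closed alg_monoid)
  let ?P = "sq_map H' H'' g F" and ?T = "tsquare K H''" and ?C = "tcube K H''"
  have gf: "sq_map H H'' (g \<circ> f) X = sq_map H' H'' g (sq_map H H' f X)"
    if "X \<in> carrier (tsquare K H)" for X
    using that by (simp add: tensor_map_comp comp_def)
  have "twist K H'' (?P \<otimes>\<^bsub>?T\<^esub> G)"
    unfolding twist_iff[OF \<open>bialgebra K H''\<close>]
  proof (intro conjI)
    show "?P \<otimes>\<^bsub>?T\<^esub> G \<in> Units ?T"
      by (intro monoid.Units_m_closed alg_monoid alg_hom_Units(1)[OF _ _ tensor_map_alg_hom] FU GU) simp_all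
    have "leg12 K H'' (?P \<otimes>\<^bsub>?T\<^esub> G) \<otimes>\<^bsub>?C\<^esub> comult_left3 H'' (?P \<otimes>\<^bsub>?T\<^esub> G) =
      (leg12 K H'' ?P \<otimes>\<^bsub>?C\<^esub> leg12 K H'' G) \<otimes>\<^bsub>?C\<^esub> (comult_left3 H'' ?P \<otimes>\<^bsub>?C\<^esub> comult_left3 H'' G)"
      by simp
    also have "\<dots> = (leg12 K H'' ?P \<otimes>\<^bsub>?C\<^esub> cube_map H' H'' g (comult_left3 H' F)) \<otimes>\<^bsub>?C\<^esub>
        (leg12 K H'' G \<otimes>\<^bsub>?C\<^esub> comult_left3 H'' G)"
      by (rule alg_interchange) (simp_all add: twisted_comult_map(1) comult_g)
    also have "\<dots> = cube_map H' H'' g (leg12 K H' F \<otimes>\<^bsub>tcube K H'\<^esub> comult_left3 H' F) \<otimes>\<^bsub>?C\<^esub>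
        (leg12 K H'' G \<otimes>\<^bsub>?C\<^esub> comult_left3 H'' G)"
      by (simp add: leg_map)
    also have "\<dots> = cube_map H' H'' g (leg23 K H' F \<otimes>\<^bsub>tcube K H'\<^esub> comult_right K H' F) \<otimes>\<^bsub>?C\<^esub>
        (leg23 K H'' G \<otimes>\<^bsub>?C\<^esub> comult_right K H'' G)"
      using F G by (simp only: twist_iff \<open>bialgebra K H'\<close> \<open>bialgebra K H''\<close>)
    also have "\<dots> = (leg23 K H'' ?P \<otimes>\<^bsub>?C\<^esub> cube_map H' H'' g (comult_right K H' F)) \<otimes>\<^bsub>?C\<^esub>
        (leg23 K H'' G \<otimes>\<^bsub>?C\<^esub> comult_right K H'' G)"
      by (simp add: leg_map)
    also have "\<dots> = (leg23 K H'' ?P \<otimes>\<^bsub>?C\<^esub> leg23 K H'' G) \<otimes>\<^bsub>?C\<^esub>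
        (comult_right K H'' ?P \<otimes>\<^bsub>?C\<^esub> comult_right K H'' G)"
      by (rule alg_interchange[symmetric]) (simp_all add: twisted_comult_map(2) comult_g)
    also have "\<dots> = leg23 K H'' (?P \<otimes>\<^bsub>?T\<^esub> G) \<otimes>\<^bsub>?C\<^esub> comult_right K H'' (?P \<otimes>\<^bsub>?T\<^esub> G)"
      by simp
    finally show "leg12 K H'' (?P \<otimes>\<^bsub>?T\<^esub> G) \<otimes>\<^bsub>?C\<^esub> comult_left3 H'' (?P \<otimes>\<^bsub>?T\<^esub> G) =
      leg23 K H'' (?P \<otimes>\<^bsub>?T\<^esub> G) \<otimes>\<^bsub>?C\<^esub> comult_right K H'' (?P \<otimes>\<^bsub>?T\<^esub> G)" .
  qed (use F G in \<open>simp_all add: twist_iff form_sq_map counit_g\<close>)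
  moreover have "(?P \<otimes>\<^bsub>?T\<^esub> G) \<otimes>\<^bsub>?T\<^esub> comult H'' (g (f x)) =
      sq_map H H'' (g \<circ> f) (comult H x) \<otimes>\<^bsub>?T\<^esub> (?P \<otimes>\<^bsub>?T\<^esub> G)" if "x \<in> carrier H" for x
  proof -
    have "(?P \<otimes>\<^bsub>?T\<^esub> G) \<otimes>\<^bsub>?T\<^esub> comult H'' (g (f x)) =
        sq_map H' H'' g (F \<otimes>\<^bsub>tsquare K H'\<^esub> comult H' (f x)) \<otimes>\<^bsub>?T\<^esub> G"
      using that by (simp add: alg_m_assoc comult_g)
    also have "\<dots> = sq_map H H'' (g \<circ> f) (comult H x) \<otimes>\<^bsub>?T\<^esub> (?P \<otimes>\<^bsub>?T\<^esub> G)"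
      unfolding comult_f[OF that] using that by (simp add: alg_m_assoc gf)
    finally show ?thesis .
  qed
  moreover have "sq_map H H'' (g \<circ> f) R \<otimes>\<^bsub>?T\<^esub> (?P \<otimes>\<^bsub>?T\<^esub> G) =
      flip K H'' H'' (?P \<otimes>\<^bsub>?T\<^esub> G) \<otimes>\<^bsub>?T\<^esub> R''"
  proof -
    have "sq_map H H'' (g \<circ> f) R \<otimes>\<^bsub>?T\<^esub> (?P \<otimes>\<^bsub>?T\<^esub> G) =
        sq_map H' H'' g (sq_map H H' f R \<otimes>\<^bsub>tsquare K H'\<^esub> F) \<otimes>\<^bsub>?T\<^esub> G"
      by (simp add: gf alg_m_assoc)
    also have "\<dots> = flip K H'' H'' (?P \<otimes>\<^bsub>?T\<^esub> G) \<otimes>\<^bsub>?T\<^esub> R''"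
      unfolding Rf by (simp add: alg_m_assoc Rg flip_tensor_map)
    finally show ?thesis .
  qed
  moreover have "g \<circ> f \<in> alg_hom K H H''"
    using alg_hom_comp[OF f_hom g_hom] by (simp add: comp_def)
  ultimately show ?thesis
    unfolding tw_comp.simps tw_cell_iff[OF tri(1,3)] by (simp add: counit_f counit_g)
qed

section \<open>The projections\<close>

text \<open>
  Morphisms of triangular bialgebras are 1-cells with trivial twist.
\<close>

lemma tw_cell_trivial:
  assumes R: "triangular K (H, R)" and R': "triangular K (H', R')"
    and f: "f \<in> bialg_hom K H H'" and fR: "sq_map H H' f R = R'"
  shows "tw_cell K (H, R) (H', R') (f, tpure K H' H' \<one>\<^bsub>H'\<^esub> \<one>\<^bsub>H'\<^esub>)"
proof -
  note [simp del] = triangular.simps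
  from R R' have [simp]: "bialgebra K H" "bialgebra K H'" "R \<in> carrier (tsquare K H)"
    "R' \<in> carrier (tsquare K H')"
    by (simp_all add: triangular_iff)
  note [simp] = bialg_hom_alg_hom[OF f] lin_closed[OF alg_hom_lin[OF bialg_hom_alg_hom[OF f]]]
  have "twist K H' \<one>\<^bsub>tsquare K H'\<^esub>"
    by (simp add: twist_iff monoid.Units_one_closed alg_monoid)
  then show ?thesis
    unfolding tw_cell_iff[OF R R'] tensor_alg_one[symmetric]
    by (simp add: bialg_hom_comult[OF f] bialg_hom_counit[OF f] fR)
qed

text \<open>
  The projections \<open>Id \<otimes> \<epsilon>\<close> and \<open>\<epsilon> \<otimes> Id\<close>.
\<close>

abbreviation pr1 :: "('k, 'a) bialg \<Rightarrow> ('k, 'b) bialg \<Rightarrow> ('a, 'b) tensor \<Rightarrow> 'a"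
  where "pr1 A B \<equiv> form_right K A B (counit B)"

abbreviation pr2 :: "('k, 'a) bialg \<Rightarrow> ('k, 'b) bialg \<Rightarrow> ('a, 'b) tensor \<Rightarrow> 'b"
  where "pr2 A B \<equiv> form_left K A B (counit A)"

context
  fixes A :: "('k, 'a) bialg" and B :: "('k, 'b) bialg"
  assumes A [simp]: "bialgebra K A" and B [simp]: "bialgebra K B"
begin

lemma in_closed [simp]:
  "a \<in> carrier A \<Longrightarrow> (in1 A B) a \<in> carrier (A \<boxtimes> B)" "b \<in> carrier B \<Longrightarrow> (in2 A B) b \<in> carrier (A \<boxtimes> B)"
  by (simp_all add: tensor_bialg_sel)

lemma pr_alg_hom [simp]: "(pr1 A B) \<in> alg_hom K (A \<boxtimes> B) A" "(pr2 A B) \<in> alg_hom K (A \<boxtimes> B) B"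
  by (simp_all add: tensor_bialg_norm)

lemma pr_in1:
  assumes "X \<in> carrier (tsquare K A)"
  shows "sq_map (A \<boxtimes> B) A (pr1 A B) (sq_map A (A \<boxtimes> B) (in1 A B) X) = X"
    and "sq_map (A \<boxtimes> B) B (pr2 A B) (sq_map A (A \<boxtimes> B) (in1 A B) X) =
      counit A (form_right K A A (counit A) X) \<odot>\<^bsub>tsquare K B\<^esub> \<one>\<^bsub>tsquare K B\<^esub>"
  using assms by (induct rule: tensor_induction)
    (simp_all add: tensor_alg_one alg_smult_swap)

lemma pr_in2:
  assumes "Y \<in> carrier (tsquare K B)"
  shows "sq_map (A \<boxtimes> B) A (pr1 A B) (sq_map B (A \<boxtimes> B) (in2 A B) Y) =
      counit B (form_left K B B (counit B) Y) \<odot>\<^bsub>tsquare K A\<^esub> \<one>\<^bsub>tsquare K A\<^esub>"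
    and "sq_map (A \<boxtimes> B) B (pr2 A B) (sq_map B (A \<boxtimes> B) (in2 A B) Y) = Y"
  using assms by (induct rule: tensor_induction)
    (simp_all add: tensor_alg_one alg_smult_swap)

lemma pr_bialg_hom: "(pr1 A B) \<in> bialg_hom K (A \<boxtimes> B) A" "(pr2 A B) \<in> bialg_hom K (A \<boxtimes> B) B"
proof -
  note [simp] = alg_hom_comp[OF pr_alg_hom(1) comult_alg_hom] alg_hom_comp[OF pr_alg_hom(2) comult_alg_hom]
    alg_hom_comp[OF pr_alg_hom(1) counit_alg_hom] alg_hom_comp[OF pr_alg_hom(2) counit_alg_hom]
    alg_hom_comp[OF comult_alg_hom tensor_map_alg_hom]
  note [simp] = pr_in1 pr_in2 counit_tensor_pure
  have "comult A ((pr1 A B) x) = sq_map (A \<boxtimes> B) A (pr1 A B) (comult (A \<boxtimes> B) x)" if "x \<in> carrier (A \<boxtimes> B)" for x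
    by (rule tensor_bialg_hom_eqI[where N = "tsquare K A", OF _ _ _ _ _ _ _ that]) simp_all
  moreover have "comult B ((pr2 A B) x) = sq_map (A \<boxtimes> B) B (pr2 A B) (comult (A \<boxtimes> B) x)" if "x \<in> carrier (A \<boxtimes> B)" for x
    by (rule tensor_bialg_hom_eqI[where N = "tsquare K B", OF _ _ _ _ _ _ _ that]) simp_all
  moreover have "counit A ((pr1 A B) x) = counit (A \<boxtimes> B) x" if "x \<in> carrier (A \<boxtimes> B)" for x
    by (rule tensor_bialg_hom_eqI[where N = "base_alg K", OF _ _ _ _ _ _ _ that]) simp_all
  moreover have "counit B ((pr2 A B) x) = counit (A \<boxtimes> B) x" if "x \<in> carrier (A \<boxtimes> B)" for x
    by (rule tensor_bialg_hom_eqI[where N = "base_alg K", OF _ _ _ _ _ _ _ that]) simp_all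
  ultimately show "(pr1 A B) \<in> bialg_hom K (A \<boxtimes> B) A" "(pr2 A B) \<in> bialg_hom K (A \<boxtimes> B) B"
    by (simp_all add: bialg_homI)
qed

lemma pr_join2:
  assumes [simp]: "X \<in> carrier (tsquare K A)" "Y \<in> carrier (tsquare K B)"
  shows "form_left K B B (counit B) Y = \<one>\<^bsub>B\<^esub> \<Longrightarrow> sq_map (A \<boxtimes> B) A (pr1 A B) (join2 A B (A \<boxtimes> B) (in1 A B) (in2 A B) X Y) = X"
    and "form_right K A A (counit A) X = \<one>\<^bsub>A\<^esub> \<Longrightarrow> sq_map (A \<boxtimes> B) B (pr2 A B) (join2 A B (A \<boxtimes> B) (in1 A B) (in2 A B) X Y) = Y"
  unfolding join2_def by (simp_all add: pr_in1 pr_in2)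

end

text \<open>
  Since \<open>(Id \<otimes> \<epsilon>)(R) = (\<epsilon> \<otimes> Id)(R\<^sup>o\<^sup>p)\<close> and \<open>R\<^sup>o\<^sup>p\<close> is inverse to \<open>R\<close>, this follows from
  \<open>triangular_form_left\<close>.
\<close>

lemma triangular_form_right:
  assumes R: "triangular K (H, R)"
  shows "form_right K H H (counit H) R = \<one>\<^bsub>H\<^esub>"
proof -
  from R have [simp]: "bialgebra K H" "R \<in> carrier (tsquare K H)"
    and inv: "R \<otimes>\<^bsub>tsquare K H\<^esub> flip K H H R = \<one>\<^bsub>tsquare K H\<^esub>"
    by (simp_all add: triangular_iff del: triangular.simps)
  have "form_right K H H (counit H) X = form_left K H H (counit H) (flip K H H X)"
    if "X \<in> carrier (tsquare K H)" for X
    using that by (induct rule: tensor_induction) simp_all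
  then show ?thesis
    using arg_cong[OF inv, of "form_left K H H (counit H)"] by (simp add: triangular_form_left[OF R])
qed

lemma tw_cell_proj:
  fixes A :: "('k, 'a) bialg" and B :: "('k, 'b) bialg"
  assumes R: "triangular K (A, R)" and S: "triangular K (B, S)"
  shows "tw_cell K (tensor_pair K (A, R) (B, S)) (A, R) (tw_proj1 K (A, R) (B, S))"
    and "tw_cell K (tensor_pair K (A, R) (B, S)) (B, S) (tw_proj2 K (A, R) (B, S))"
proof -
  note [simp del] = triangular.simps tw_cell.simps
  from R S have [simp]: "bialgebra K A" "bialgebra K B" "R \<in> carrier (tsquare K A)"
    "S \<in> carrier (tsquare K B)"
    by (simp_all add: triangular_iff)
  show "tw_cell K (tensor_pair K (A, R) (B, S)) (A, R) (tw_proj1 K (A, R) (B, S))"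
    using triangular_tensor[OF R S] R S unfolding tw_proj1.simps tensor_pair.simps
    by (intro tw_cell_trivial)
      (simp_all add: pr_bialg_hom middle_flip_join2 pr_join2 triangular_form_left[OF S])
  show "tw_cell K (tensor_pair K (A, R) (B, S)) (B, S) (tw_proj2 K (A, R) (B, S))"
    using triangular_tensor[OF R S] R S unfolding tw_proj2.simps tensor_pair.simps
    by (intro tw_cell_trivial)
      (simp_all add: pr_bialg_hom middle_flip_join2 pr_join2 triangular_form_right[OF R])
qed


section \<open>The tensor product of twisted morphisms\<close>

lemma tw_cell_tensor:
  assumes f: "tw_cell K (A, R) (A', R') (f, F)" and g: "tw_cell K (B, S) (B', S') (g, G)"
  shows "tw_cell K (tensor_pair K (A, R) (B, S)) (tensor_pair K (A', R') (B', S'))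
    (tensor_map K A B A' B' f g, middle_flip K A' A' B' B' (tpure K (tsquare K A') (tsquare K B') F G))"
proof -
  note [simp del] = triangular.simps tw_cell.simps
  note tri = tw_cell_triangular[OF f] tw_cell_triangular[OF g]
  from tri have [simp]: "bialgebra K A" "bialgebra K A'" "bialgebra K B" "bialgebra K B'"
    "R \<in> carrier (tsquare K A)" "R' \<in> carrier (tsquare K A')"
    "S \<in> carrier (tsquare K B)" "S' \<in> carrier (tsquare K B')"
    by (simp_all add: triangular_iff)
  from f[unfolded tw_cell_iff[OF tri(1,2)]] have F: "twist K A' F" and f_hom [simp]: "f \<in> alg_hom K A A'"
    and counit_f: "\<And>x. x \<in> carrier A \<Longrightarrow> counit A' (f x) = counit A x"
    and comult_f: "\<And>x. x \<in> carrier A \<Longrightarrow>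
      F \<otimes>\<^bsub>tsquare K A'\<^esub> comult A' (f x) = sq_map A A' f (comult A x) \<otimes>\<^bsub>tsquare K A'\<^esub> F"
    and Rf: "sq_map A A' f R \<otimes>\<^bsub>tsquare K A'\<^esub> F = flip K A' A' F \<otimes>\<^bsub>tsquare K A'\<^esub> R'"
    by blast+
  from g[unfolded tw_cell_iff[OF tri(3,4)]] have G: "twist K B' G" and g_hom [simp]: "g \<in> alg_hom K B B'"
    and counit_g: "\<And>x. x \<in> carrier B \<Longrightarrow> counit B' (g x) = counit B x"
    and comult_g: "\<And>x. x \<in> carrier B \<Longrightarrow>
      G \<otimes>\<^bsub>tsquare K B'\<^esub> comult B' (g x) = sq_map B B' g (comult B x) \<otimes>\<^bsub>tsquare K B'\<^esub> G"
    and Rg: "sq_map B B' g S \<otimes>\<^bsub>tsquare K B'\<^esub> G = flip K B' B' G \<otimes>\<^bsub>tsquare K B'\<^esub> S'"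
    by blast+
  note [simp] = alg_hom_rules[OF f_hom] alg_hom_rules[OF g_hom]
  have [simp]: "F \<in> carrier (tsquare K A')" "G \<in> carrier (tsquare K B')"
    using F G by (simp_all add: twist_def monoid.Units_closed alg_monoid)
  let ?M = "A \<boxtimes> B" and ?N = "A' \<boxtimes> B'" and ?h = "tensor_map K A B A' B' f g"
  let ?J = "join2 A' B' ?N (in1 A' B') (in2 A' B')"
  note rules = in_join[OF \<open>bialgebra K A'\<close> \<open>bialgebra K B'\<close>]
  note left = in1_join[OF \<open>bialgebra K A'\<close> \<open>bialgebra K B'\<close>]
    and right = in2_join[OF \<open>bialgebra K A'\<close> \<open>bialgebra K B'\<close>]
  have h [simp]: "?h \<in> alg_hom K ?M ?N"
    unfolding tensor_bialg_norm by simp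
  have sq1: "sq_map ?M ?N ?h (sq_map A ?M (in1 A B) X) = ?J (sq_map A A' f X) \<one>\<^bsub>tsquare K B'\<^esub>"
    if "X \<in> carrier (tsquare K A)" for X
    using that by (simp flip: left) (rule sq_map_square, simp_all)
  have sq2: "sq_map ?M ?N ?h (sq_map B ?M (in2 A B) Y) = ?J \<one>\<^bsub>tsquare K A'\<^esub> (sq_map B B' g Y)"
    if "Y \<in> carrier (tsquare K B)" for Y
    using that by (simp flip: right) (rule sq_map_square, simp_all)
  have h_in: "?h (in1 A B a) = in1 A' B' (f a)" "?h (in2 A B b) = in2 A' B' (g b)"
    if "a \<in> carrier A" "b \<in> carrier B" for a b
    using that by simp_all
  have "counit ?N (?h x) = counit ?M x" if "x \<in> carrier ?M" for x
    by (rule tensor_bialg_hom_eqI[where N = "base_alg K", OF _ _ _ _ _ _ _ that])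
      (simp_all add: alg_hom_comp[OF h counit_alg_hom] counit_tensor_pure counit_f counit_g)
  moreover have "sq_map ?M ?N ?h (comult ?M x) \<otimes>\<^bsub>tsquare K ?N\<^esub> ?J F G =
      ?J F G \<otimes>\<^bsub>tsquare K ?N\<^esub> comult ?N (?h x)" if "x \<in> carrier ?M" for x
  proof (rule tensor_bialg_intertwine[where N = "tsquare K ?N", OF _ _ _ _ _ _ _ _ that])
    fix a assume a: "a \<in> carrier A"
    show "sq_map ?M ?N ?h (comult ?M (in1 A B a)) \<otimes>\<^bsub>tsquare K ?N\<^esub> ?J F G =
        ?J F G \<otimes>\<^bsub>tsquare K ?N\<^esub> comult ?N (?h (in1 A B a))"
      using a by (simp add: h_in sq1 comult_f rules left)
  next
    fix b assume b: "b \<in> carrier B"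
    show "sq_map ?M ?N ?h (comult ?M (in2 A B b)) \<otimes>\<^bsub>tsquare K ?N\<^esub> ?J F G =
        ?J F G \<otimes>\<^bsub>tsquare K ?N\<^esub> comult ?N (?h (in2 A B b))"
      using b by (simp add: h_in sq2 comult_g rules right)
  qed (simp_all add: alg_hom_comp[OF comult_alg_hom tensor_map_alg_hom] alg_hom_comp[OF h comult_alg_hom] rules)
  moreover have "sq_map ?M ?N ?h (join2 A B ?M (in1 A B) (in2 A B) R S) \<otimes>\<^bsub>tsquare K ?N\<^esub> ?J F G =
      flip K ?N ?N (?J F G) \<otimes>\<^bsub>tsquare K ?N\<^esub> ?J R' S'"
    unfolding join2_def[of A B] by (simp add: sq1 sq2 rules Rf Rg)
  moreover have "twist K ?N (?J F G)"
    by (rule twist_join2[OF _ _ _ in1_bialg_hom in2_bialg_hom in1_in2_commuting F G]) simp_all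
  ultimately show ?thesis
    using triangular_tensor[OF tri(1,3)] triangular_tensor[OF tri(2,4)]
    by (simp add: tw_cell_iff middle_flip_join2)
qed

section \<open>The comultiplication of a triangular bialgebra\<close>

context
  fixes H :: "('k, 'h) bialg" and S :: "('h, 'h) tensor"
  assumes HS: "triangular K (H, S)"
begin

lemma H_simps [simp]: "bialgebra K H" "S \<in> carrier (tsquare K H)"
  using HS by (simp_all add: triangular_iff del: triangular.simps)

text \<open>
  Below, \<open>Q\<close> is the inverse of \<open>S\<close>, and \<open>leg4\<close> places the legs of a twofold tensor inside
  \<open>(H \<otimes> H) \<otimes> (H \<otimes> H)\<close>: for instance \<open>leg4 (in2 H H) (in1 H H)\<close> uses legs 2 and 3.
\<close>

abbreviation (input) "T \<equiv> tsquare K H"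
abbreviation (input) "Q \<equiv> flip K H H S"
abbreviation (input) "leg4 g h \<equiv> tensor_map K H H (tsquare K H) (tsquare K H) g h"

lemma S_Q: "S \<otimes>\<^bsub>T\<^esub> Q = \<one>\<^bsub>T\<^esub>"
  using HS by (simp add: triangular_iff del: triangular.simps)

lemma Q_Units: "Q \<in> Units T" "Q = inv\<^bsub>T\<^esub> S" "S \<in> Units T"
  using triangular_Units[OF HS] monoid.Units_inv_Units[OF alg_monoid, of T S] by simp_all

lemma form_Q: "form_left K H H (counit H) Q = \<one>\<^bsub>H\<^esub>" "form_right K H H (counit H) Q = \<one>\<^bsub>H\<^esub>"
proof -
  from alg_hom_Units(2)[OF _ _ form_left_alg_hom Q_Units(3), of "counit H"]
  show "form_left K H H (counit H) Q = \<one>\<^bsub>H\<^esub>"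
    by (simp add: triangular_form_left[OF HS] monoid.inv_one alg_monoid flip: Q_Units(2))
  from alg_hom_Units(2)[OF _ _ form_right_alg_hom Q_Units(3), of "counit H"]
  show "form_right K H H (counit H) Q = \<one>\<^bsub>H\<^esub>"
    by (simp add: triangular_form_right[OF HS] monoid.inv_one alg_monoid flip: Q_Units(2))
qed

text \<open>
  The inverses of the two hexagon identities; inversion reverses the order of the factors.
\<close>

lemma comult_right_Q: "comult_right K H Q = leg12 K H Q \<otimes>\<^bsub>tcube K H\<^esub> leg13 K H Q"
  and comult_left3_Q: "comult_left3 H Q = leg23 K H Q \<otimes>\<^bsub>tcube K H\<^esub> leg13 K H Q"
proof -
  have S: "comult_right K H S = leg13 K H S \<otimes>\<^bsub>tcube K H\<^esub> leg12 K H S"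
    "comult_left3 H S = leg13 K H S \<otimes>\<^bsub>tcube K H\<^esub> leg23 K H S"
    using HS by (simp_all add: triangular_iff del: triangular.simps)
  have inv: "f Q = inv\<^bsub>tcube K H\<^esub> f S" "f S \<in> Units (tcube K H)" if "f \<in> alg_hom K T (tcube K H)" for f
    using alg_hom_Units[OF _ _ that Q_Units(3)] by (simp_all add: Q_Units(2))
  show "comult_right K H Q = leg12 K H Q \<otimes>\<^bsub>tcube K H\<^esub> leg13 K H Q"
    by (simp add: inv S alg_inv_mult)
  show "comult_left3 H Q = leg23 K H Q \<otimes>\<^bsub>tcube K H\<^esub> leg13 K H Q"
    by (simp add: inv(1)[OF comult_left3_alg_hom] S alg_inv_mult inv)
qed

lemma insert_middle_leg4: "insert_middle K H H X = leg4 (in2 H H) (in1 H H) X"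
  by (simp add: insert_middle_def tensor_map_def)

text \<open>
  With legs numbered from 1 to 6, \<open>?L\<close> and \<open>?R\<close> take \<open>Q\<^sub>1\<^sub>3\<close> to \<open>Q\<^sub>2\<^sub>5\<close>, and the sides of the cocycle identity
  are \<open>Q\<^sub>2\<^sub>3 Q\<^sub>4\<^sub>5 Q\<^sub>2\<^sub>5\<close> and \<open>Q\<^sub>4\<^sub>5 Q\<^sub>2\<^sub>3 Q\<^sub>2\<^sub>5\<close>.
\<close>

lemma twist_insert_middle: "twist K (H \<boxtimes> H) (leg4 (in2 H H) (in1 H H) Q)"
proof -
  let ?M = "H \<boxtimes> H" and ?i = "in1 H H" and ?j = "in2 H H"
  have E: "leg4 ?j ?i = tensor_map K H H ?M ?M ?j ?i"
    by (simp add: tensor_bialg_norm)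
  let ?E = "tensor_map K H H ?M ?M ?j ?i"
  let ?L = "tensor_map K H T ?M (tsquare K ?M) ?j ?E"
    and ?R = "tensor_map K H T ?M (tsquare K ?M) ?j (sq_map H ?M ?i)"
  have j_one: "?j \<one>\<^bsub>H\<^esub> = \<one>\<^bsub>?M\<^esub>" and i_one: "?i \<one>\<^bsub>H\<^esub> = \<one>\<^bsub>?M\<^esub>"
    by (simp_all add: tensor_bialg_sel tensor_alg_one)
  note [simp del] = tensor_map_alg_rules(2)
  have L23: "?L (leg23 K H X) = leg23 K ?M (?E X)" if "X \<in> carrier T" for X
    using that by (simp add: leg23_def j_one)
  have L13: "?L (leg13 K H X) = ?R (leg13 K H X)" if "X \<in> carrier T" for X
    using that by (induct rule: tensor_induction)
      (simp_all add: j_one i_one)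
  have R12: "?R (leg12 K H X) = leg12 K ?M (?E X)" if "X \<in> carrier T" for X
    using that by (induct rule: tensor_induction)
      (simp_all add: i_one)
  have comm: "leg12 K ?M (?E X) \<otimes>\<^bsub>tcube K ?M\<^esub> leg23 K ?M (?E Y) =
      leg23 K ?M (?E Y) \<otimes>\<^bsub>tcube K ?M\<^esub> leg12 K ?M (?E X)"
    if X: "X \<in> carrier T" and Y: "Y \<in> carrier T" for X Y
    using X
  proof (induct rule: tensor_induction)
    case (pure x y)
    from Y show ?case
      using in1_in2_commuting[of H H]
      by (induct rule: tensor_induction)
        (simp_all add: pure commuting_def)
  qed (simp_all add: Y)
  let ?P = "?E Q"
  have "leg12 K ?M ?P \<otimes>\<^bsub>tcube K ?M\<^esub> comult_left3 ?M ?P =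
      leg12 K ?M ?P \<otimes>\<^bsub>tcube K ?M\<^esub> (leg23 K ?M ?P \<otimes>\<^bsub>tcube K ?M\<^esub> ?R (leg13 K H Q))"
    by (simp add: comult_tensor_map[OF _ _ in2_bialg_hom in1_bialg_hom] comult_left3_Q
        tensor_map_alg_rules L23 L13)
  also have "\<dots> = leg23 K ?M ?P \<otimes>\<^bsub>tcube K ?M\<^esub> (leg12 K ?M ?P \<otimes>\<^bsub>tcube K ?M\<^esub> ?R (leg13 K H Q))"
    using comm[of Q Q] by (simp flip: alg_m_assoc)
  also have "\<dots> = leg23 K ?M ?P \<otimes>\<^bsub>tcube K ?M\<^esub> comult_right K ?M ?P"
    by (simp add: comult_tensor_map[OF _ _ in2_bialg_hom in1_bialg_hom] comult_right_Q
        tensor_map_alg_rules R12)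
  finally have "leg12 K ?M ?P \<otimes>\<^bsub>tcube K ?M\<^esub> comult_left3 ?M ?P =
      leg23 K ?M ?P \<otimes>\<^bsub>tcube K ?M\<^esub> comult_right K ?M ?P" .
  moreover have "?P \<in> Units (tsquare K ?M)"
    by (rule alg_hom_Units(1)[OF _ _ tensor_map_alg_hom Q_Units(1)]) simp_all
  ultimately show ?thesis
    unfolding E by (simp add: twist_iff form_tensor_map form_Q j_one i_one
        bialg_hom_counit[OF in1_bialg_hom] bialg_hom_counit[OF in2_bialg_hom])
qed

text \<open>The map \<open>x \<otimes> (Y \<otimes> z) \<mapsto> x \<otimes> Y \<otimes> z\<close> with values in \<open>(H \<otimes> H) \<otimes> (H \<otimes> H)\<close>.\<close>

definition wrap :: "('h, (('h, 'h) tensor, 'h) tensor) tensor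
    \<Rightarrow> (('h, 'h) tensor, ('h, 'h) tensor) tensor"
  where "wrap X = tensor_unassoc H H T
    (tensor_map K H (tensor_alg K T H) H (tcube K H) (\<lambda>x. x) (tensor_assoc K H H H) X)"

lemma wrap_alg_hom [simp]: "wrap \<in> alg_hom K (tensor_alg K H (tensor_alg K T H)) (tsquare K T)"
  unfolding wrap_def by (rule alg_hom_comp[OF tensor_map_alg_hom tensor_unassoc_alg_hom]) simp_all

lemmas wrap_rules [simp] = alg_hom_rules[OF wrap_alg_hom]

lemma wrap_pure [simp]: "x \<in> carrier H \<Longrightarrow> y \<in> carrier H \<Longrightarrow> y' \<in> carrier H \<Longrightarrow> z \<in> carrier H \<Longrightarrow>
    wrap (tpure K H (tensor_alg K T H) x (tpure K T H (tpure K H H y y') z)) =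
    tpure K T T (tpure K H H x y) (tpure K H H y' z)"
  by (simp add: wrap_def)

lemma wrap_middle: "Y \<in> carrier T \<Longrightarrow>
    wrap (tpure K H (tensor_alg K T H) \<one>\<^bsub>H\<^esub> (tpure K T H Y \<one>\<^bsub>H\<^esub>)) = leg4 (in2 H H) (in1 H H) Y"
  by (induct rule: tensor_induction) simp_all

text \<open>
  The map \<open>Id \<otimes> (D \<otimes> Id)\<close> on \<open>H \<otimes> (H \<otimes> H)\<close>, for \<open>D\<close> from \<open>H\<close> to \<open>H \<otimes> H\<close>.
\<close>

abbreviation (input) "mid D \<equiv> tensor_map K H T H (tensor_alg K T H) (\<lambda>x. x) (tensor_map K H H T H D (\<lambda>x. x))"

text \<open>
  Coassociativity, used twice: \<open>(\<Delta> \<otimes> \<Delta>)(\<Delta> x)\<close> is the fourfold coproduct of \<open>x\<close>, obtained from the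
  threefold one by applying \<open>\<Delta>\<close> to the middle factor.
\<close>

lemma comult_comult:
  assumes x: "x \<in> carrier H"
  shows "sq_map H T (comult H) (comult H x) = wrap (mid (comult H) (comult_right K H (comult H x)))"
proof -
  let ?D = "comult H" and ?X = "comult H x" and ?C = "tcube K H"
  have X [simp]: "?X \<in> carrier T" using x by simp
  let ?R = "tensor_map K H T H ?C (\<lambda>x. x) (comult_right K H)"
  have 1: "tensor_unassoc H H T (?R (tensor_assoc K H H H (tpure K T H Z y))) = tpure K T T Z (?D y)"
    if "Z \<in> carrier T" "y \<in> carrier H" for Z y
    using that by (induct rule: tensor_induction) simp_all
  have 2: "tensor_unassoc H H T (?R (comult_left3 H Y)) = sq_map H T ?D Y" if "Y \<in> carrier T" for Y
    using that by (induct rule: tensor_induction)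
      (simp_all add: 1)
  \<comment> \<open>The first use of coassociativity splits the last factor instead of the first one.\<close>
  have "sq_map H T ?D ?X = tensor_unassoc H H T (?R (comult_right K H ?X))"
    using x by (simp add: coassoc flip: 2)
  also have "?R (comult_right K H ?X) = tensor_map K H H H ?C (\<lambda>x. x) (\<lambda>y. comult_right K H (?D y)) ?X"
    unfolding comult_right_def[of K H]
    by (rule tensor_map_comp) (simp_all flip: comult_right_def)
  \<comment> \<open>The second one acts inside the second factor.\<close>
  also have "\<dots> = tensor_map K H H H ?C (\<lambda>x. x) (\<lambda>y. comult_left3 H (?D y)) ?X"
    by (rule tensor_map_cong)
      (simp_all add: coassoc lin_comp[OF alg_hom_lin alg_hom_lin, OF comult_alg_hom comult_right_alg_hom]
        lin_comp[OF alg_hom_lin alg_hom_lin, OF comult_alg_hom comult_left3_alg_hom])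
  also have "tensor_unassoc H H T \<dots> = wrap (mid ?D (comult_right K H ?X))"
  proof -
    have "tensor_map K H H H ?C (\<lambda>x. x) (\<lambda>y. comult_left3 H (?D y)) Y =
        tensor_map K H (tensor_alg K T H) H ?C (\<lambda>x. x) (tensor_assoc K H H H)
          (mid ?D (comult_right K H Y))" if "Y \<in> carrier T" for Y
      using that lin_comp[OF alg_hom_lin alg_hom_lin, OF comult_alg_hom comult_left3_alg_hom, of H]
      by (induct rule: tensor_induction)
        (simp_all add: comult_left_def)
    then show ?thesis by (simp add: wrap_def)
  qed
  finally show ?thesis .
qed

text \<open>
  Exchanging legs 2 and 3 replaces \<open>\<Delta>\<close> on the middle factor by its opposite.
\<close>

lemma middle_flip_wrap:
  assumes W: "W \<in> carrier (tcube K H)"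
  shows "middle_flip K H H H H (wrap (mid (comult H) W)) =
    wrap (mid (\<lambda>y. flip K H H (comult H y)) W)"
proof -
  let ?D = "comult H" and ?Do = "\<lambda>y. flip K H H (comult H y)"
  have [simp]: "?Do \<in> alg_hom K H T"
    by (rule alg_hom_comp[OF comult_alg_hom flip_alg_hom]) simp_all
  have 1: "middle_flip K H H H H (wrap (tpure K H (tensor_alg K T H) x (tpure K T H Y z))) =
      wrap (tpure K H (tensor_alg K T H) x (tpure K T H (flip K H H Y) z))"
    if "Y \<in> carrier T" "x \<in> carrier H" "z \<in> carrier H" for x Y z
    using that by (induct rule: tensor_induction) simp_all
  show ?thesis
    using W
  proof (induct rule: tensor_induction)
    case (pure x V)
    from pure(2) show ?case
      by (induct rule: tensor_induction)
        (simp_all add: 1 pure(1))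
  qed simp_all
qed

text \<open>
  The relation \<open>Q \<Delta>\<^sup>o\<^sup>p(y) = \<Delta>(y) Q\<close>, inserted in the middle legs.
\<close>

lemma conjugate_middle:
  assumes W: "W \<in> carrier (tcube K H)"
  shows "leg4 (in2 H H) (in1 H H) Q \<otimes>\<^bsub>tsquare K T\<^esub> wrap (mid (\<lambda>y. flip K H H (comult H y)) W) =
    wrap (mid (comult H) W) \<otimes>\<^bsub>tsquare K T\<^esub> leg4 (in2 H H) (in1 H H) Q"
proof -
  let ?D = "comult H" and ?Do = "\<lambda>y. flip K H H (comult H y)"
  let ?U = "tensor_alg K H (tensor_alg K T H)"
  let ?Q = "tpure K H (tensor_alg K T H) \<one>\<^bsub>H\<^esub> (tpure K T H Q \<one>\<^bsub>H\<^esub>)"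
  have Do [simp]: "?Do \<in> alg_hom K H T"
    by (rule alg_hom_comp[OF comult_alg_hom flip_alg_hom]) simp_all
  have "Q \<otimes>\<^bsub>T\<^esub> ?Do y = ?D y \<otimes>\<^bsub>T\<^esub> Q" if "y \<in> carrier H" for y
  proof -
    have "?Do y \<otimes>\<^bsub>T\<^esub> S = S \<otimes>\<^bsub>T\<^esub> ?D y"
      using HS that by (simp add: triangular_iff del: triangular.simps)
    \<comment> \<open>Flipping both sides turns \<open>S\<close> into its inverse \<open>Q\<close>.\<close>
    from arg_cong[OF this, of "flip K H H"] show ?thesis using that by simp
  qed
  note QD = this
  have "?Q \<otimes>\<^bsub>?U\<^esub> mid ?Do W = mid ?D W \<otimes>\<^bsub>?U\<^esub> ?Q"
    using W
  proof (induct rule: tensor_induction)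
    case (pure x V)
    from pure(2) show ?case
      by (induct rule: tensor_induction)
        (simp_all add: pure(1) QD)
  qed simp_all
  from arg_cong[OF this, of wrap] show ?thesis
    using W by (simp add: wrap_middle)
qed

text \<open>
  In leg notation, \<open>(\<Delta> \<otimes> \<Delta>)(S) = (S\<^sub>1\<^sub>4 S\<^sub>1\<^sub>3) (S\<^sub>2\<^sub>4 S\<^sub>2\<^sub>3)\<close>.
\<close>

lemma comult_S:
  "sq_map H T (comult H) S =
    (leg4 (in1 H H) (in2 H H) S \<otimes>\<^bsub>tsquare K T\<^esub> leg4 (in1 H H) (in1 H H) S) \<otimes>\<^bsub>tsquare K T\<^esub>
    (leg4 (in2 H H) (in2 H H) S \<otimes>\<^bsub>tsquare K T\<^esub> leg4 (in2 H H) (in1 H H) S)"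
proof -
  let ?D = "comult H" and ?TH = "tensor_alg K T H"
  have S: "comult_right K H S = leg13 K H S \<otimes>\<^bsub>tcube K H\<^esub> leg12 K H S"
    "comult_left3 H S = leg13 K H S \<otimes>\<^bsub>tcube K H\<^esub> leg23 K H S"
    using HS by (simp_all add: triangular_iff del: triangular.simps)
  have right: "leg4 g ?D S = leg4 g (in2 H H) S \<otimes>\<^bsub>tsquare K T\<^esub> leg4 g (in1 H H) S"
    if g [simp]: "g \<in> alg_hom K H T" for g
  proof -
    note [simp] = alg_hom_rules[OF g]
    let ?g = "tensor_map K H T T T g (\<lambda>x. x)"
    have "leg4 g ?D X = ?g (comult_right K H X)" "?g (leg13 K H X) = leg4 g (in2 H H) X"
      "?g (leg12 K H X) = leg4 g (in1 H H) X" if "X \<in> carrier T" for X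
      using that by (induct rule: tensor_induction) simp_all
    then show ?thesis by (simp add: S)
  qed
  have "tensor_unassoc H H H (leg13 K H X) = tensor_map K H H T H (in1 H H) (\<lambda>x. x) X"
    "tensor_unassoc H H H (leg23 K H X) = tensor_map K H H T H (in2 H H) (\<lambda>x. x) X"
    if "X \<in> carrier T" for X
    using that by (induct rule: tensor_induction) simp_all
  with arg_cong[OF S(2), of "tensor_unassoc H H H"]
  have "comult_left K H S = tensor_map K H H T H (in1 H H) (\<lambda>x. x) S \<otimes>\<^bsub>?TH\<^esub>
      tensor_map K H H T H (in2 H H) (\<lambda>x. x) S"
    by simp
  moreover have comp: "tensor_map K T H T T (\<lambda>x. x) ?D (tensor_map K H H T H g (\<lambda>x. x) X) = leg4 g ?D X"
    if "g \<in> alg_hom K H T" "X \<in> carrier T" for g X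
    using that by (subst tensor_map_comp) simp_all
  ultimately have "sq_map H T ?D S = leg4 (in1 H H) ?D S \<otimes>\<^bsub>tsquare K T\<^esub> leg4 (in2 H H) ?D S"
    using comp[of ?D S] by (simp add: comult_left_def)
  then show ?thesis
    by (simp add: right[of "in1 H H"] right[of "in2 H H"])
qed

lemma tw_cell_comult:
  "tw_cell K (H, S) (tensor_pair K (H, S) (H, S)) (comult H, insert_middle K H H (inv\<^bsub>T\<^esub> S))"
proof -
  note [simp del] = triangular.simps tw_cell.simps
  let ?M = "H \<boxtimes> H" and ?D = "comult H" and ?F = "leg4 (in2 H H) (in1 H H) Q"
  have hom: "?D \<in> alg_hom K H ?M"
    by (simp add: tensor_bialg_norm)
  have "counit ?M X = counit H (form_left K H H (counit H) X)" if "X \<in> carrier T" for X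
  proof -
    have "counit ?M \<in> alg_hom K T (base_alg K)"
      using counit_tensor_alg_hom[of H H] by (simp add: tensor_bialg_norm)
    note [simp] = alg_hom_rules[OF this]
    from that show ?thesis
      by (induct rule: tensor_induction)
        (simp_all add: counit_tensor_pure)
  qed
  then have counit: "counit ?M (?D x) = counit H x" if "x \<in> carrier H" for x
    using that by simp
  have comult: "?F \<otimes>\<^bsub>tsquare K T\<^esub> comult ?M (?D x) = sq_map H T ?D (?D x) \<otimes>\<^bsub>tsquare K T\<^esub> ?F"
    if x: "x \<in> carrier H" for x
  proof -
    have "comult ?M (?D x) = wrap (mid (\<lambda>y. flip K H H (?D y)) (comult_right K H (?D x)))"
      using x by (simp add: tensor_bialg_comult comult_comult middle_flip_wrap)
    then show ?thesis
      using x by (simp add: conjugate_middle comult_comult)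
  qed
  have R: "sq_map H T ?D S \<otimes>\<^bsub>tsquare K T\<^esub> ?F =
      flip K T T ?F \<otimes>\<^bsub>tsquare K T\<^esub> middle_flip K H H H H (tpure K T T S S)"
  proof -
    have "leg4 (in2 H H) (in1 H H) S \<otimes>\<^bsub>tsquare K T\<^esub> ?F = \<one>\<^bsub>tsquare K T\<^esub>"
      by (simp add: S_Q flip: tensor_map_alg_rules(1))
    moreover have "flip K T T ?F = leg4 (in1 H H) (in2 H H) S"
      by (simp add: flip_tensor_map)
    moreover have "middle_flip K H H H H (tpure K T T S S) =
        leg4 (in1 H H) (in1 H H) S \<otimes>\<^bsub>tsquare K T\<^esub> leg4 (in2 H H) (in2 H H) S"
      by (simp add: middle_flip_join2 join2_def tensor_bialg_norm)
    ultimately show ?thesis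
      by (simp add: comult_S alg_m_assoc)
  qed
  show ?thesis
    using twist_insert_middle hom counit comult R triangular_tensor[OF HS HS] HS
    by (simp add: tw_cell_iff tensor_bialg_norm insert_middle_leg4 flip: Q_Units(2))
qed

end


section \<open>The diagonal morphism\<close>

lemma insert_middle_tensor_map:
  assumes [simp]: "k_algebra K A" "k_algebra K B" "k_algebra K A'" "k_algebra K B'"
    and f: "f \<in> alg_hom K A A'" and g: "g \<in> alg_hom K B B'" and X: "X \<in> carrier (tensor_alg K B A)"
  shows "sq_map (tensor_alg K A B) (tensor_alg K A' B') (tensor_map K A B A' B' f g)
      (insert_middle K A B X) = insert_middle K A' B' (tensor_map K B A B' A' g f X)"
proof -
  note [simp] = f g alg_hom_rules[OF f] alg_hom_rules[OF g]
  have i: "insert_middle K A B = tensor_map K B A (tensor_alg K A B) (tensor_alg K A B)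
      (tpure K A B \<one>\<^bsub>A\<^esub>) (\<lambda>a. tpure K A B a \<one>\<^bsub>B\<^esub>)"
    "insert_middle K A' B' = tensor_map K B' A' (tensor_alg K A' B') (tensor_alg K A' B')
      (tpure K A' B' \<one>\<^bsub>A'\<^esub>) (\<lambda>a. tpure K A' B' a \<one>\<^bsub>B'\<^esub>)"
    by (simp_all add: insert_middle_def tensor_map_def)
  show ?thesis
    unfolding i using X
    by (induct rule: tensor_induction) simp_all
qed

text \<open>
  The diagonal morphism factors through the comultiplication of \<open>H\<close>.
\<close>

lemma tw_diagonal_eq_comp:
  assumes "tw_cell K (H, S) (H1, R1) (f1, F1)" and "tw_cell K (H, S) (H2, R2) (f2, F2)"
  shows "tw_diagonal K (H, S) (H1, R1) (H2, R2) (f1, F1) (f2, F2) =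
    tw_comp K (tensor_pair K (H, S) (H, S)) (tensor_pair K (H1, R1) (H2, R2))
      (tensor_map K H H H1 H2 f1 f2,
        middle_flip K H1 H1 H2 H2 (tpure K (tsquare K H1) (tsquare K H2) F1 F2))
      (comult H, insert_middle K H H (inv\<^bsub>tsquare K H\<^esub> S))"
proof -
  note tri = tw_cell_triangular[OF assms(1)] tw_cell_triangular[OF assms(2)]
  from tri have [simp]: "bialgebra K H" "bialgebra K H1" "bialgebra K H2" "S \<in> carrier (tsquare K H)"
    unfolding triangular_iff by blast+
  have "f1 \<in> alg_hom K H H1" "f2 \<in> alg_hom K H H2"
    using assms unfolding tw_cell_iff[OF tri(1,2)] tw_cell_iff[OF tri(3,4)] by blast+
  then show ?thesis
    by (simp add: insert_middle_tensor_map tensor_bialg_norm comp_def triangular_Units(2)[OF tri(1)])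
qed

lemma pr_insert_middle:
  assumes [simp]: "bialgebra K A" "bialgebra K B" and X: "X \<in> carrier (tensor_alg K B A)"
  shows "sq_map (A \<boxtimes> B) A (pr1 A B) (insert_middle K A B X) =
      tpure K A A \<one>\<^bsub>A\<^esub> (form_left K B A (counit B) X)"
    and "sq_map (A \<boxtimes> B) B (pr2 A B) (insert_middle K A B X) =
      tpure K B B (form_right K B A (counit A) X) \<one>\<^bsub>B\<^esub>"
proof -
  have i: "insert_middle K A B = tensor_map K B A (A \<boxtimes> B) (A \<boxtimes> B) (in2 A B) (in1 A B)"
    by (simp add: insert_middle_def tensor_map_def tensor_bialg_norm)
  show "sq_map (A \<boxtimes> B) A (pr1 A B) (insert_middle K A B X) =
      tpure K A A \<one>\<^bsub>A\<^esub> (form_left K B A (counit B) X)"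
    "sq_map (A \<boxtimes> B) B (pr2 A B) (insert_middle K A B X) =
      tpure K B B (form_right K B A (counit A) X) \<one>\<^bsub>B\<^esub>"
    unfolding i using X
    by (induct rule: tensor_induction) simp_all
qed

lemma tw_comp_proj_diagonal:
  assumes f1: "tw_cell K (H, S) (H1, R1) (f1, F1)" and f2: "tw_cell K (H, S) (H2, R2) (f2, F2)"
  shows "tw_eq (H, S)
      (tw_comp K (tensor_pair K (H1, R1) (H2, R2)) (H1, R1) (tw_proj1 K (H1, R1) (H2, R2))
         (tw_diagonal K (H, S) (H1, R1) (H2, R2) (f1, F1) (f2, F2)))
      (f1, F1)"
    and "tw_eq (H, S)
      (tw_comp K (tensor_pair K (H1, R1) (H2, R2)) (H2, R2) (tw_proj2 K (H1, R1) (H2, R2))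
         (tw_diagonal K (H, S) (H1, R1) (H2, R2) (f1, F1) (f2, F2)))
      (f2, F2)"
proof -
  note [simp del] = triangular.simps tw_cell.simps
  note tri = tw_cell_triangular[OF f1] tw_cell_triangular[OF f2]
  from tri have [simp]: "bialgebra K H" "bialgebra K H1" "bialgebra K H2" "S \<in> carrier (tsquare K H)"
    unfolding triangular_iff by blast+
  have F: "twist K H1 F1" "twist K H2 F2"
    and hom [simp]: "f1 \<in> alg_hom K H H1" "f2 \<in> alg_hom K H H2"
    and counit: "\<And>x. x \<in> carrier H \<Longrightarrow> counit H1 (f1 x) = counit H x"
      "\<And>x. x \<in> carrier H \<Longrightarrow> counit H2 (f2 x) = counit H x"
    using f1 f2 unfolding tw_cell_iff[OF tri(1,2)] tw_cell_iff[OF tri(3,4)] by blast+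
  have [simp]: "F1 \<in> carrier (tsquare K H1)" "F2 \<in> carrier (tsquare K H2)"
    and forms: "form_right K H1 H1 (counit H1) F1 = \<one>\<^bsub>H1\<^esub>" "form_left K H2 H2 (counit H2) F2 = \<one>\<^bsub>H2\<^esub>"
    using F by (simp_all add: twist_def monoid.Units_closed alg_monoid)
  note inv = triangular_Units(2)[OF tri(1)]
  let ?M = "H1 \<boxtimes> H2"
  have T: "tsquare K (tensor_alg K H1 H2) = tsquare K ?M"
    by (simp add: tensor_bialg_norm)
  have im: "insert_middle K H1 H2 Z \<in> carrier (tsquare K ?M)" if "Z \<in> carrier (tensor_alg K H2 H1)" for Z
  proof -
    have "insert_middle K H1 H2 = tensor_map K H2 H1 ?M ?M (in2 H1 H2) (in1 H1 H2)"
      by (simp add: insert_middle_def tensor_map_def tensor_bialg_norm)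
    then show ?thesis using that by simp
  qed
  note [simp] = im in_join(1) alg_hom_one[OF hom(1)] alg_hom_one[OF hom(2)]
    lin_closed[OF alg_hom_lin[OF hom(1)]] lin_closed[OF alg_hom_lin[OF hom(2)]]
  show "tw_eq (H, S)
      (tw_comp K (tensor_pair K (H1, R1) (H2, R2)) (H1, R1) (tw_proj1 K (H1, R1) (H2, R2))
         (tw_diagonal K (H, S) (H1, R1) (H2, R2) (f1, F1) (f2, F2)))
      (f1, F1)"
    by (simp add: T inv middle_flip_join2 pr_insert_middle pr_join2 forms form_tensor_map counit
        form_Q[OF tri(1)] flip: tensor_alg_one)
  show "tw_eq (H, S)
      (tw_comp K (tensor_pair K (H1, R1) (H2, R2)) (H2, R2) (tw_proj2 K (H1, R1) (H2, R2))
         (tw_diagonal K (H, S) (H1, R1) (H2, R2) (f1, F1) (f2, F2)))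
      (f2, F2)"
    by (simp add: T inv middle_flip_join2 pr_insert_middle pr_join2 forms form_tensor_map counit
        form_Q[OF tri(1)] flip: tensor_alg_one)
qed

end

theorem proposition5p2:
  fixes K :: "'k ring"
    and H :: "('k, 'h) bialg" and H1 :: "('k, 'a) bialg" and H2 :: "('k, 'b) bialg"
    and S :: "('h, 'h) tensor" and R1 :: "('a, 'a) tensor" and R2 :: "('b, 'b) tensor"
    and f1 :: "'h \<Rightarrow> 'a" and f2 :: "'h \<Rightarrow> 'b"
    and F1 :: "('a, 'a) tensor" and F2 :: "('b, 'b) tensor"
  assumes "field K"
    and "tw_cell K (H, S) (H1, R1) (f1, F1)"
    and "tw_cell K (H, S) (H2, R2) (f2, F2)"
  shows "tw_cell K (tensor_pair K (H1, R1) (H2, R2)) (H1, R1) (tw_proj1 K (H1, R1) (H2, R2)) \<and>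
    tw_cell K (tensor_pair K (H1, R1) (H2, R2)) (H2, R2) (tw_proj2 K (H1, R1) (H2, R2)) \<and>
    tw_cell K (H, S) (tensor_pair K (H1, R1) (H2, R2))
      (tw_diagonal K (H, S) (H1, R1) (H2, R2) (f1, F1) (f2, F2)) \<and>
    tw_eq (H, S)
      (tw_comp K (tensor_pair K (H1, R1) (H2, R2)) (H1, R1) (tw_proj1 K (H1, R1) (H2, R2))
         (tw_diagonal K (H, S) (H1, R1) (H2, R2) (f1, F1) (f2, F2)))
      (f1, F1) \<and>
    tw_eq (H, S)
      (tw_comp K (tensor_pair K (H1, R1) (H2, R2)) (H2, R2) (tw_proj2 K (H1, R1) (H2, R2))
         (tw_diagonal K (H, S) (H1, R1) (H2, R2) (f1, F1) (f2, F2)))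
      (f2, F2)"
proof -
  interpret scalars K
    using \<open>field K\<close> by (simp add: scalars_def field_def domain_def)
  note cells = assms(2,3)
  note tri = tw_cell_triangular[OF cells(1)] tw_cell_triangular[OF cells(2)]
  have "tw_cell K (H, S) (tensor_pair K (H1, R1) (H2, R2))
      (tw_diagonal K (H, S) (H1, R1) (H2, R2) (f1, F1) (f2, F2))"
    using tw_cell_comult[OF tri(1)] tw_cell_tensor[OF cells]
    unfolding tw_diagonal_eq_comp[OF cells] tensor_pair.simps by (rule tw_cell_comp)
  with tw_cell_proj[OF tri(2,4)] tw_comp_proj_diagonal[OF cells] show ?thesis
    by blast
qed

end
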